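(* Let $S$ be either the unit sphere $\mathbb{S}^2$ (radius $1$) or the hyperbolic plane $\mathbb{H}^2$, with an orientation, and let $x_0\in S$. Consider the Lagrange problem on $S$ for a swiveling arm with $N=3$ joints of type $(l_1,l_2,l_3)$, $l_j>0$, based at $x_0$, with angular velocities $\omega_1,\omega_2,\omega_3$. Suppose that: (1) $l_1,l_2,l_3$ satisfy all three strict triangle inequalities $l_1<l_2+l_3$, $l_2<l_3+l_1$, $l_3<l_1+l_2$; (2) $\omega_1,\omega_2,\omega_3\in\mathbb{R}_+$ are rationally independent (linearly independent over $\mathbb{Q}$); (3) in the case $S=\mathbb{S}^2$, in addition $l_1+l_2+l_3<\pi$. Then there exists a geodesic triangle $\Delta$ on $S$ with side lengths $l_1,l_2,l_3$, and its angles are uniquely determined by the side lengths; denote by $\alpha_j$ the angle of $\Delta$ opposite to the side of length $l_j$. Moreover, for every initial condition $\bm{\theta}^{(0)}\in\mathbb{T}^3$ the asymptotic angular velocity $\omega$ exists and $$\omega=\omega_1+\frac{\pi-\alpha_1}{\pi}\,\omega_2+\frac{\alpha_3}{\pi}\,\omega_3 .$$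
   Context: $\mathbb{T}^N=\mathbb{R}^N/(2\pi\mathbb{Z})^N$. Swiveling arm on a surface. Let $S$ be an oriented complete Riemannian surface, $x_0\in S$, $l_1,\dots,l_N>0$, $\omega_1,\dots,\omega_N\in\mathbb{R}$ and $\bm{\theta}^{(0)}=(\theta^{(0)}_1,\dots,\theta^{(0)}_N)\in\mathbb{T}^N$. Fix an angle coordinate on the unit tangent circle $T^1_{x_0}S$ (angles are measured counterclockwise with respect to the orientation). At time $t\ge 0$, start from $x_0$ and draw the geodesic segment of length $l_1$ in the direction $\theta^{(0)}_1+\omega_1 t$; let $x_1$ be its endpoint. From $x_1$ draw the geodesic segment of length $l_2$ whose initial direction makes the oriented angle $\theta^{(0)}_2+\omega_2 t$ with the direction of the forward continuation of the previous geodesic segment at $x_1$; let $x_2$ be its endpoint; and so on. Thus, for $j\ge2$, the angle of the $j$-th joint is measured with respect to the direction of the $(j-1)$-st joint. The final endpoint $x_N$ at time $t$ is denoted $z(t)$; it defines a curve $z:\mathbb{R}_+\to S$, the motion of the end of the swiveling arm of type $(l_1,\dots,l_N)$ based at $x_0$ under the flow of the vector field $X=\sum_j\omega_j\,\partial/\partial\theta_j$ on $\mathbb{T}^N$. Lagrange problem on $S$. Suppose there is a complex chart on $S$ (compatible with the metric and orientation), sending $x_0$ to $0\in\mathbb{C}$, such that the curve $z(t)$ stays in a bounded ball $B(x_0,R)$ contained in the chart. Identify $z(t)$ with a complex number through the chart, and let $\varphi(t)$ be a continuous branch of $\arg z(t)$. The asymptotic angular velocity is $\omega:=\lim_{t\to\infty}\varphi(t)/t$,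 and the Lagrange problem is the study of the existence and the value of this limit. Convention for passages through zero. If $z(t)$ vanishes at some times, the continuous branch $\varphi$ is understood in the following sense: $\varphi$ is a continuous real function with $z(t)=r(t)e^{i\varphi(t)}$, where $r$ is real-valued and allowed to change sign; for analytic $z$ not identically zero, with discrete zero set, near a zero $t_0$ of order $k$ one writes $z(t)=a(t)(t-t_0)^k$ with $a(t_0)\ne0$ and takes $r(t)=\pm|a(t)|(t-t_0)^k$, so that $\varphi(t)=\varphi(0)+\int_0^t\mathrm{Im}\,\frac{z'(s)}{z(s)}\,ds$, where the integrand extends analytically across the zeros. *)

theory Defs
  imports "HOL-Analysis.Analysis"
begin

text \<open>
  The unit sphere in Euclidean space and the upper sheet of the unit hyperboloid in Minkowski space.
  Both carry the Riemannian metric induced by the ambient bilinear form, and in both cases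
  the position vector is normal to the surface.
\<close>

datatype surface = Sphere | Hyperbolic_Plane

fun form :: "surface \<Rightarrow> real^3 \<Rightarrow> real^3 \<Rightarrow> real" where
  "form Sphere x y = x \<bullet> y"
| "form Hyperbolic_Plane x y = x $ 1 * y $ 1 + x $ 2 * y $ 2 - x $ 3 * y $ 3"

fun points :: "surface \<Rightarrow> (real^3) set" where
  "points Sphere = sphere 0 1"
| "points Hyperbolic_Plane = {x. form Hyperbolic_Plane x x = -1 \<and> x $ 3 > 0}"

definition tangent_space :: "surface \<Rightarrow> real^3 \<Rightarrow> (real^3) set" where
  "tangent_space S x = {v. form S x v = 0}"

definition unit_tangent :: "surface \<Rightarrow> real^3 \<Rightarrow> (real^3) set" where
  "unit_tangent S x = {v \<in> tangent_space S x. form S v v = 1}"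

text \<open>
  The covariant derivative along a curve in the surface is the tangential part of the ambient
  derivative, so a geodesic is a curve whose ambient acceleration is normal to the surface.
\<close>

definition geodesic :: "surface \<Rightarrow> (real \<Rightarrow> real^3) \<Rightarrow> bool" where
  "geodesic S \<gamma> \<longleftrightarrow> range \<gamma> \<subseteq> points S \<and>
     (\<exists>\<gamma>' \<gamma>''. \<forall>s. (\<gamma> has_vector_derivative \<gamma>' s) (at s) \<and>
        (\<gamma>' has_vector_derivative \<gamma>'' s) (at s) \<and>
        (\<forall>w \<in> tangent_space S (\<gamma> s). form S (\<gamma>'' s) w = 0))"

abbreviation velocity :: "(real \<Rightarrow> real^3) \<Rightarrow> real \<Rightarrow> real^3" where
  "velocity \<gamma> s \<equiv> vector_derivative \<gamma> (at s)"

definition unit_speed_geodesic :: "surface \<Rightarrow> (real \<Rightarrow> real^3) \<Rightarrow> bool" where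
  "unit_speed_geodesic S \<gamma> \<longleftrightarrow> geodesic S \<gamma> \<and> (\<forall>s. velocity \<gamma> s \<in> unit_tangent S (\<gamma> s))"

definition geodesic_from :: "surface \<Rightarrow> real^3 \<Rightarrow> real^3 \<Rightarrow> real \<Rightarrow> real^3" where
  "geodesic_from S x v = (THE \<gamma>. geodesic S \<gamma> \<and> \<gamma> 0 = x \<and> velocity \<gamma> 0 = v)"

text \<open>
  The position vector never lies in the tangent plane, so the two orientations of the (connected)
  surface correspond to a sign \<open>\<epsilon> \<in> {1, -1}\<close>: a basis \<open>(v, w)\<close> of the tangent plane at \<open>x\<close>
  is positively oriented iff the following holds.
\<close>

definition positively_oriented :: "real \<Rightarrow> real^3 \<Rightarrow> real^3 \<Rightarrow> real^3 \<Rightarrow> bool" where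
  "positively_oriented \<epsilon> x v w \<longleftrightarrow> \<epsilon> * det (vector [x, v, w] :: real^3^3) > 0"

definition quarter_turn :: "surface \<Rightarrow> real \<Rightarrow> real^3 \<Rightarrow> real^3 \<Rightarrow> real^3" where
  "quarter_turn S \<epsilon> x v =
     (THE w. w \<in> unit_tangent S x \<and> form S v w = 0 \<and> positively_oriented \<epsilon> x v w)"

text \<open>The unit tangent vector at \<open>x\<close> making the oriented angle \<open>\<theta>\<close> with the unit tangent vector \<open>v\<close>.\<close>

definition turn :: "surface \<Rightarrow> real \<Rightarrow> real^3 \<Rightarrow> real \<Rightarrow> real^3 \<Rightarrow> real^3" where
  "turn S \<epsilon> x \<theta> v = cos \<theta> *\<^sub>R v + sin \<theta> *\<^sub>R quarter_turn S \<epsilon> x v"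

text \<open>
  The list contains the pairs (length of the joint, angle of the joint), and \<open>v\<close> is the direction
  with respect to which the next angle is measured: initially the zero of the angle coordinate
  at the base point, afterwards the forward direction of the previous joint at its endpoint.
\<close>

fun arm_end :: "surface \<Rightarrow> real \<Rightarrow> real^3 \<Rightarrow> real^3 \<Rightarrow> (real \<times> real) list \<Rightarrow> real^3" where
  "arm_end S \<epsilon> x v [] = x"
| "arm_end S \<epsilon> x v ((l, \<theta>) # joints) =
     (let \<gamma> = geodesic_from S x (turn S \<epsilon> x \<theta> v)
      in arm_end S \<epsilon> (\<gamma> l) (velocity \<gamma> l) joints)"

text \<open>
  By completeness, a point has distance at most \<open>R\<close> from \<open>x\<close> iff it is the endpoint of
  a geodesic segment of length at most \<open>R\<close> starting at \<open>x\<close>.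
\<close>

definition closed_ball :: "surface \<Rightarrow> real^3 \<Rightarrow> real \<Rightarrow> (real^3) set" where
  "closed_ball S x R = {\<gamma> s | \<gamma> s. unit_speed_geodesic S \<gamma> \<and> \<gamma> 0 = x \<and> 0 \<le> s \<and> s \<le> R}"

text \<open>
  A chart compatible with the metric and the orientation: a homeomorphism \<open>\<psi>\<close> between open sets
  whose inverse \<open>X\<close> is differentiable, conformal and orientation preserving. Smoothness of \<open>X\<close>
  follows, since changes of such charts are complex differentiable.
\<close>

definition conformal_chart ::
  "surface \<Rightarrow> real \<Rightarrow> (real^3) set \<Rightarrow> (real^3 \<Rightarrow> complex) \<Rightarrow> bool" where
  "conformal_chart S \<epsilon> U \<psi> \<longleftrightarrow>
     openin (top_of_set (points S)) U \<and> open (\<psi> ` U) \<and>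
     (\<exists>X. homeomorphism U (\<psi> ` U) \<psi> X \<and>
        (\<forall>p \<in> \<psi> ` U. \<exists>X'. (X has_derivative X') (at p) \<and>
           (\<exists>c>0. \<forall>a b. form S (X' a) (X' b) = c * (a \<bullet> b)) \<and>
           positively_oriented \<epsilon> (X p) (X' 1) (X' \<i>)))"

definition lagrange_chart ::
  "surface \<Rightarrow> real \<Rightarrow> real^3 \<Rightarrow> (real \<Rightarrow> real^3) \<Rightarrow> (real^3) set \<Rightarrow> (real^3 \<Rightarrow> complex) \<Rightarrow> bool" where
  "lagrange_chart S \<epsilon> x\<^sub>0 z U \<psi> \<longleftrightarrow>
     conformal_chart S \<epsilon> U \<psi> \<and> x\<^sub>0 \<in> U \<and> \<psi> x\<^sub>0 = 0 \<and>
     (\<exists>R. closed_ball S x\<^sub>0 R \<subseteq> U \<and> (\<forall>t\<ge>0. z t \<in> closed_ball S x\<^sub>0 R))"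

text \<open>
  The radius \<open>r\<close> may change sign, which allows a continuous branch of the argument
  to pass through zeros of \<open>z\<close>; where the zeros of \<open>z\<close> are isolated, the branch is unique up to
  an additive constant.
\<close>

definition arg_branch :: "(real \<Rightarrow> complex) \<Rightarrow> (real \<Rightarrow> real) \<Rightarrow> bool" where
  "arg_branch z \<phi> \<longleftrightarrow> continuous_on {0..} \<phi> \<and>
     (\<exists>r :: real \<Rightarrow> real. \<forall>t\<ge>0. z t = of_real (r t) * cis (\<phi> t))"

definition has_asymptotic_angular_velocity :: "(real \<Rightarrow> complex) \<Rightarrow> real \<Rightarrow> bool" where
  "has_asymptotic_angular_velocity z \<omega> \<longleftrightarrow>
     (\<exists>\<phi>. arg_branch z \<phi>) \<and>
     (\<forall>\<phi>. arg_branch z \<phi> \<longrightarrow> ((\<lambda>t. \<phi> t / t) \<longlongrightarrow> \<omega>) at_top)"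

definition angle_between :: "surface \<Rightarrow> real^3 \<Rightarrow> real^3 \<Rightarrow> real" where
  "angle_between S v w = arccos (form S v w / (sqrt (form S v v) * sqrt (form S w w)))"

text \<open>
  There is a geodesic triangle whose sides have lengths \<open>l\<^sub>1, l\<^sub>2, l\<^sub>3\<close> and whose angles opposite
  to them are \<open>\<alpha>\<^sub>1, \<alpha>\<^sub>2, \<alpha>\<^sub>3\<close>. The sides \<open>\<sigma>\<^sub>1, \<sigma>\<^sub>2, \<sigma>\<^sub>3\<close> are traversed cyclically; the vertex
  opposite to \<open>\<sigma>\<^sub>1\<close> is the endpoint of \<open>\<sigma>\<^sub>2\<close> and the starting point of \<open>\<sigma>\<^sub>3\<close>, and so on.
\<close>

definition geodesic_triangle ::
  "surface \<Rightarrow> real \<Rightarrow> real \<Rightarrow> real \<Rightarrow> real \<Rightarrow> real \<Rightarrow> real \<Rightarrow> bool" where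
  "geodesic_triangle S l\<^sub>1 l\<^sub>2 l\<^sub>3 \<alpha>\<^sub>1 \<alpha>\<^sub>2 \<alpha>\<^sub>3 \<longleftrightarrow>
     (\<exists>\<sigma>\<^sub>1 \<sigma>\<^sub>2 \<sigma>\<^sub>3.
        unit_speed_geodesic S \<sigma>\<^sub>1 \<and> unit_speed_geodesic S \<sigma>\<^sub>2 \<and> unit_speed_geodesic S \<sigma>\<^sub>3 \<and>
        \<sigma>\<^sub>1 l\<^sub>1 = \<sigma>\<^sub>2 0 \<and> \<sigma>\<^sub>2 l\<^sub>2 = \<sigma>\<^sub>3 0 \<and> \<sigma>\<^sub>3 l\<^sub>3 = \<sigma>\<^sub>1 0 \<and>
        \<alpha>\<^sub>1 = angle_between S (velocity \<sigma>\<^sub>3 0) (- velocity \<sigma>\<^sub>2 l\<^sub>2) \<and>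
        \<alpha>\<^sub>2 = angle_between S (velocity \<sigma>\<^sub>1 0) (- velocity \<sigma>\<^sub>3 l\<^sub>3) \<and>
        \<alpha>\<^sub>3 = angle_between S (velocity \<sigma>\<^sub>2 0) (- velocity \<sigma>\<^sub>1 l\<^sub>1))"

end

theory Submission
  imports Defs
begin

text \<open>
In the stereographic coordinate centred at the base point, the point at distance \<open>l\<close> in
  direction \<open>\<theta>\<close> has the coordinate \<open>cis \<theta> * gtan l\<close>, where \<open>gtan l\<close> is \<open>tan (l / 2)\<close> or
  \<open>tanh (l / 2)\<close>, and replacing the frame at the end of a joint by the frame at its start is a
  Moebius transformation. With \<open>a, b, c\<close> the values of \<open>gtan\<close> at the three lengths and \<open>\<kappa>\<close> the
  curvature, composing three joints gives for the end of the arm the coordinate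

    \<open>w = cis \<theta>\<^sub>1 * N / (E * F)\<close>,  \<open>N = A(\<theta>\<^sub>3) + cis \<theta>\<^sub>2 * B(\<theta>\<^sub>3)\<close>,
    \<open>A(\<theta>\<^sub>3) = a * (1 - \<kappa> * b * c * cis \<theta>\<^sub>3)\<close>,  \<open>B(\<theta>\<^sub>3) = b + c * cis \<theta>\<^sub>3\<close>,

  where \<open>E\<close> and \<open>F\<close> have positive real part, hence bounded argument. In any other chart \<open>w\<close> is
  multiplied by the exponential of a function that is bounded on the disc in question
  (\<open>chart_stereo_quotient\<close>). So the asymptotic angular velocity is \<open>\<omega>\<^sub>1\<close> plus the mean motion of
  \<open>N\<close> (\<open>arm_chart_angular_velocity\<close>).

  Which of the two terms of \<open>N\<close> is larger depends on \<open>\<theta>\<^sub>3\<close> alone: the second one wins exactly for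
  \<open>\<theta>\<^sub>3\<close> between \<open>-\<theta>\<close> and \<open>\<theta>\<close> modulo \<open>2 * pi\<close>, where \<open>\<theta> = pi - \<alpha>\<^sub>1\<close> is the exterior angle of the
  triangle. The argument of \<open>N\<close> stays within \<open>pi / 2\<close> of the argument of the larger term. At the
  passages of \<open>\<theta>\<^sub>3\<close> through \<open>-\<theta>\<close> and \<open>\<theta>\<close> both terms have the same modulus and \<open>N / A = 1 + cis \<psi>\<close>,
  whose argument is \<open>\<psi> / 2\<close> reduced to \<open>(-pi/2, pi/2)\<close>, a sawtooth in \<open>\<psi>\<close>. Hence the increment of the
  argument of \<open>N\<close> over one period \<open>2 * pi / \<omega>\<^sub>3\<close> of \<open>\<theta>\<^sub>3\<close> is exactly

    \<open>2 * \<theta> * \<omega>\<^sub>2 / \<omega>\<^sub>3 + 2 * (arg B(\<theta>) - arg A(\<theta>))\<close> plus sawtooth values at the passages.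

  From one period to the next \<open>\<psi>\<close> moves by an angle incommensurable with \<open>2 * pi\<close>, so the sawtooth
  values average to zero for every initial condition (\<open>rotation_sawtooth_average\<close>, by Dirichlet
  approximation). Dividing by the period gives the mean motion
  \<open>\<omega>\<^sub>2 * \<theta> / pi + \<omega>\<^sub>3 * (arg B(\<theta>) - arg A(\<theta>)) / pi\<close> (\<open>two_term_mean_motion\<close>). The last difference of
  arguments is the direction of the third side seen from the start of the second one, that is,
  \<open>\<alpha>\<^sub>3\<close> (\<open>Arg_quotient_angle\<close>). Existence and uniqueness of the angles is the law of cosines
  (\<open>triangle_angle\<close>).

  Zeros of \<open>N\<close> do not interfere. They require \<open>\<theta>\<^sub>3\<close> and \<open>\<theta>\<^sub>2\<close> to take one of two pairs of values, so
  by irrationality there are at most two of them, and they are simple because the difference of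
  the squared moduli of the two terms changes sign there with nonzero speed. Thus a branch of the
  argument exists (\<open>arg_branch_exists_simple_zeros\<close>), and its growth is read off after the last
  zero, where two branches differ by a constant.
\<close>

section \<open>Sawtooth averages along irrational rotations\<close>

text \<open>
  A step coprime to \<open>q\<close> visits every residue class once, whatever the starting point.
\<close>

lemma sum_mod_coprime:
  fixes h j :: int and q :: nat
  assumes "coprime h (int q)" "q > 0"
  shows "(\<Sum>k<q. (j + int k * h) mod int q) = (\<Sum>k<q. int k)"
proof -
  define m where "m = (\<lambda>k. nat ((j + int k * h) mod int q))"
  have inj: "inj_on m {..<q}"
  proof (rule inj_onI)
    fix k k' assume k: "k \<in> {..<q}" "k' \<in> {..<q}" and eq: "m k = m k'"
    have "(j + int k * h) mod int q = (j + int k' * h) mod int q"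
      using eq assms(2) unfolding m_def by (simp add: nat_eq_iff)
    then have "int q dvd (int k - int k') * h"
      by (simp add: mod_eq_dvd_iff algebra_simps)
    then have "int q dvd int k - int k'"
      using assms(1) by (simp add: coprime_commute coprime_dvd_mult_left_iff)
    then show "k = k'"
      using k dvd_imp_le_int[of "int k - int k'" "int q"] by (cases "k = k'") auto
  qed
  have "m ` {..<q} \<subseteq> {..<q}"
    using assms(2) by (auto simp: m_def nat_less_iff)
  then have "m ` {..<q} = {..<q}"
    using inj by (simp add: card_image card_subset_eq)
  then have "(\<Sum>k<q. int (m k)) = (\<Sum>k<q. int k)"
    using inj sum.reindex[of m "{..<q}" int] by simp
  then show ?thesis
    using assms(2) by (simp add: m_def)
qed

lemma sum_floor_progression:
  fixes h j :: int and q :: nat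
  assumes "coprime h (int q)" "q > 0"
  shows "(\<Sum>k<q. real_of_int ((j + int k * h) div int q))
       = (\<Sum>k<q. (real_of_int j + real k * real_of_int h) / real q) - (real q - 1) / 2"
proof -
  have "real_of_int ((j + int k * h) div int q)
      = (real_of_int j + real k * real_of_int h) / real q - real_of_int ((j + int k * h) mod int q) / real q"
          for k
  proof -
    have "real_of_int (j + int k * h)
        = real_of_int ((j + int k * h) div int q * int q + (j + int k * h) mod int q)"
      by (simp only: div_mult_mod_eq)
    then have "real_of_int j + real k * real_of_int h
        = real_of_int ((j + int k * h) div int q) * real q + real_of_int ((j + int k * h) mod int q)"
      by (simp only: of_int_add of_int_mult of_int_of_nat_eq)
    then show ?thesis
      using assms(2) by (simp add: field_simps del: of_int_add)
  qed
  then have "(\<Sum>k<q. real_of_int ((j + int k * h) div int q))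
      = (\<Sum>k<q. (real_of_int j + real k * real_of_int h) / real q)
        - real_of_int (\<Sum>k<q. (j + int k * h) mod int q) / real q"
    by (simp add: sum_subtractf sum_divide_distrib)
  also have "real_of_int (\<Sum>k<q. (j + int k * h) mod int q) / real q = (real q - 1) / 2"
  proof -
    have "(\<Sum>k<n. real k) = real n * (real n - 1) / 2" for n
      by (induction n) (auto simp: field_simps)
    then show ?thesis
      using sum_mod_coprime[OF assms, of j] assms(2) by simp
  qed
  finally show ?thesis .
qed

text \<open>
  Shifting \<open>k * \<alpha>\<close> to \<open>k * h / q\<close> moves the \<open>q\<close> points by at most \<open>1 / q\<close>, so their integer parts lie
  between those of two arithmetic progressions of rationals with denominator \<open>q\<close> that differ by
  \<open>2 / q\<close>. For these progressions the sum of the integer parts is known exactly.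
\<close>

lemma rotation_block_bound:
  fixes \<alpha> y :: real and h :: int and q :: nat
  assumes "coprime h (int q)" "q > 0" and approx: "\<bar>\<alpha> - real_of_int h / real q\<bar> < 1 / (real q)\<^sup>2"
  shows "\<bar>\<Sum>k<q. frac (y + real k * \<alpha>) - 1 / 2\<bar> \<le> 3"
proof -
  have q: "real q > 0" using assms(2) by simp
  define m where "m = \<lfloor>real q * y\<rfloor>"
  have m: "real_of_int m / real q \<le> y" "y < (real_of_int m + 1) / real q"
    using q unfolding m_def by (simp_all add: field_simps; linarith)+
  have near: "\<bar>real k * \<alpha> - real k * real_of_int h / real q\<bar> \<le> 1 / real q" if "k < q" for k
  proof -
    have "\<bar>real k * \<alpha> - real k * real_of_int h / real q\<bar> = real k * \<bar>\<alpha> - real_of_int h / real q\<bar>"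
      by (simp add: abs_mult flip: right_diff_distrib times_divide_eq_right)
    also have "\<dots> \<le> real q * (1 / (real q)\<^sup>2)"
      using that approx by (intro mult_mono) auto
    finally show ?thesis using q by (simp add: power2_eq_square)
  qed
  have low: "real_of_int ((m - 1 + int k * h) div int q) \<le> real_of_int \<lfloor>y + real k * \<alpha>\<rfloor>"
    and upp: "real_of_int \<lfloor>y + real k * \<alpha>\<rfloor> \<le> real_of_int ((m + 1 + int k * h) div int q)" 
    and d1: "y + real k * \<alpha> - (real_of_int (m - 1) + real k * real_of_int h) / real q \<le> 3 / real q"
    and d2: "y + real k * \<alpha> - (real_of_int (m + 1) + real k * real_of_int h) / real q \<ge> - 2 / real q"
    if "k < q" for k
  proof -
    note n = near[OF that] 
    show "y + real k * \<alpha> - (real_of_int (m - 1) + real k * real_of_int h) / real q \<le> 3 / real q"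
      "y + real k * \<alpha> - (real_of_int (m + 1) + real k * real_of_int h) / real q \<ge> - 2 / real q"
      using n m by (auto simp: add_divide_distrib diff_divide_distrib)
    have "real_of_int (m - 1 + int k * h) / real_of_int (int q) \<le> y + real k * \<alpha>"
      using n m by (auto simp: add_divide_distrib diff_divide_distrib)
    then have "\<lfloor>real_of_int (m - 1 + int k * h) / real_of_int (int q)\<rfloor> \<le> \<lfloor>y + real k * \<alpha>\<rfloor>"
      by (rule floor_mono)
    then show "real_of_int ((m - 1 + int k * h) div int q) \<le> real_of_int \<lfloor>y + real k * \<alpha>\<rfloor>"
      by (simp only: floor_divide_of_int_eq of_int_le_iff)
    have "real_of_int \<lfloor>y + real k * \<alpha>\<rfloor> < (real_of_int (m + 1 + int k * h) + 1) / real q"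
      using n m by (auto simp: add_divide_distrib diff_divide_distrib) linarith
    then have "real_of_int (\<lfloor>y + real k * \<alpha>\<rfloor> * int q) < real_of_int (m + 1 + int k * h + 1)"
      using q by (simp add: field_simps)
    then have "\<lfloor>y + real k * \<alpha>\<rfloor> * int q \<le> m + 1 + int k * h"
      by linarith
    then have "\<lfloor>y + real k * \<alpha>\<rfloor> \<le> (m + 1 + int k * h) div int q"
      using assms(2) by (metis nonzero_mult_div_cancel_right of_nat_0_less_iff order_less_irrefl zdiv_mono1)
    then show "real_of_int \<lfloor>y + real k * \<alpha>\<rfloor> \<le> real_of_int ((m + 1 + int k * h) div int q)"
      by simp
  qed
  have fr: "(\<Sum>k<q. frac (y + real k * \<alpha>) - 1 / 2)
      = (\<Sum>k<q. y + real k * \<alpha>) - (\<Sum>k<q. real_of_int \<lfloor>y + real k * \<alpha>\<rfloor>) - real q / 2"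
    by (simp add: frac_def sum_subtractf sum.distrib algebra_simps)
  have s1: "(\<Sum>k<q. real_of_int ((m - 1 + int k * h) div int q)) \<le> (\<Sum>k<q. real_of_int \<lfloor>y + real k * \<alpha>\<rfloor>)"
    by (rule sum_mono) (use low in auto)
  have s2: "(\<Sum>k<q. real_of_int \<lfloor>y + real k * \<alpha>\<rfloor>) \<le> (\<Sum>k<q. real_of_int ((m + 1 + int k * h) div int q))"
    by (rule sum_mono) (use upp in auto)
  have "(\<Sum>k<q. y + real k * \<alpha> - (real_of_int (m - 1) + real k * real_of_int h) / real q) \<le> (\<Sum>k<q. 3 / real q)"
    by (rule sum_mono) (use d1 in auto)
  then have s3: "(\<Sum>k<q. y + real k * \<alpha>) - (\<Sum>k<q. (real_of_int (m - 1) + real k * real_of_int h) / real q) \<le> 3"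
    using q by (simp add: sum_subtractf)
  have "(\<Sum>k<q. y + real k * \<alpha> - (real_of_int (m + 1) + real k * real_of_int h) / real q) \<ge> (\<Sum>k<q. - 2 / real q)"
    by (rule sum_mono) (use d2 in auto)
  then have s4: "(\<Sum>k<q. y + real k * \<alpha>) - (\<Sum>k<q. (real_of_int (m + 1) + real k * real_of_int h) / real q) \<ge> - 2"
    using q by (simp add: sum_subtractf)
  show ?thesis
    unfolding fr using s1 s2 s3 s4
    unfolding sum_floor_progression[OF assms(1,2)] by argo
qed

text \<open>
  Blocks whose length \<open>q\<close> is the denominator of a good approximation contribute at most \<open>3\<close> each,
  and an irrational number has good approximations with arbitrarily large \<open>q\<close>. The bound on a block
  is uniform in its starting point, hence the average vanishes for every \<open>y\<close>.
\<close>

lemma rotation_sawtooth_average: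
  fixes \<alpha> y :: real
  assumes "\<alpha> \<notin> \<rat>"
  shows "(\<lambda>n. (\<Sum>k<n. frac (y + real k * \<alpha>) - 1 / 2) / real n) \<longlonglongrightarrow> 0"
proof (rule LIMSEQ_I)
  fix e :: real assume e: "e > 0"
  define s where "s = (\<lambda>k. frac (y + real k * \<alpha>) - 1 / 2)"
  have "infinite (approx_set \<alpha>)"
    using assms rational_iff_finite_approx_set by blast
  then obtain h k where hk: "(h, k) \<in> approx_set \<alpha>" "k > \<lceil>6 / e\<rceil>"
    using infinite_approx_set by blast
  define q where "q = nat k"
  have k0: "k > 0" using hk(1) by (auto simp: approx_set_def)
  have kq: "k = int q" using k0 by (simp add: q_def)
  have q: "q > 0" "real q > 6 / e" using hk(2) kq k0 by (simp, linarith)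
  have block: "\<bar>\<Sum>k<q. frac (z + real k * \<alpha>) - 1 / 2\<bar> \<le> 3" for z
    using hk k0 kq q by (intro rotation_block_bound[of h q]) (auto simp: approx_set_def)
  (* The bound for a block does not depend on its starting point, so blocks can be added up. *)
  have blocks: "\<bar>\<Sum>k<q * N. s k\<bar> \<le> 3 * real N" for N
  proof (induction N)
    case (Suc N)
    have "(\<Sum>k<q * Suc N. s k) = (\<Sum>k<q * N. s k) + (\<Sum>k<q. s (q * N + k))"
      using sum.atLeastLessThan_concat[of 0 "q * N" "q * N + q" s] sum.shift_bounds_nat_ivl[of s 0 "q * N" q]
      by (simp add: lessThan_atLeast0 add.commute)
    also have "(\<Sum>k<q. s (q * N + k)) = (\<Sum>k<q. frac ((y + real (q * N) * \<alpha>) + real k * \<alpha>) - 1 / 2)"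
      by (simp add: s_def algebra_simps)
    finally show ?case using Suc block[of "y + real (q * N) * \<alpha>"] by (simp add: algebra_simps)
  qed simp
  have sb: "\<bar>s k\<bar> \<le> 1" for k
    using frac_ge_0[of "y + real k * \<alpha>"] frac_lt_1[of "y + real k * \<alpha>"] unfolding s_def by arith
  have total: "\<bar>\<Sum>k<n. s k\<bar> \<le> 3 * real n / real q + real q" for n
  proof -
    have "(\<Sum>k<n. s k) = (\<Sum>k<q * (n div q). s k) + (\<Sum>k\<in>{q * (n div q)..<n}. s k)"
      by (simp add: lessThan_atLeast0 sum.atLeastLessThan_concat)
    moreover have "\<bar>\<Sum>k\<in>{q * (n div q)..<n}. s k\<bar> \<le> (\<Sum>k\<in>{q * (n div q)..<n}. 1)"
      by (rule order_trans[OF sum_abs], rule sum_mono, rule sb)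
    moreover have "(\<Sum>k\<in>{q * (n div q)..<n}. 1::real) \<le> real q"
    proof -
      have "card {q * (n div q)..<n} = n mod q" by (simp add: minus_mult_div_eq_mod)
      then show ?thesis using q(1) mod_less_divisor[of q n]
          by (simp only: sum_constant) (simp del: card_atLeastLessThan)
    qed
    moreover have "3 * real (n div q) \<le> 3 * real n / real q"
      using q of_nat_div_le_of_nat[where ?'a = real, of n q] by simp
    ultimately show ?thesis using blocks[of "n div q"] by linarith
  qed
  show "\<exists>no. \<forall>n\<ge>no. norm ((\<Sum>k<n. frac (y + real k * \<alpha>) - 1 / 2) / real n - 0) < e"
  proof (intro exI allI impI)
    fix n assume n: "n \<ge> nat \<lceil>2 * real q / e\<rceil> + 1"
    then have n2: "real n > 2 * real q / e" by linarith
    then have n0: "real n > 0" using q e by (smt (verit) divide_nonneg_pos of_nat_0_le_iff)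
    have "3 * real n / real q < e / 2 * real n"
      using q n0 e by (simp add: field_simps)
    moreover have "real q < e / 2 * real n" using n2 e by (simp add: field_simps)
    ultimately have "\<bar>\<Sum>k<n. s k\<bar> < e * real n" using total[of n] by linarith
    then show "norm ((\<Sum>k<n. frac (y + real k * \<alpha>) - 1 / 2) / real n - 0) < e"
      using n0 by (simp add: s_def field_simps)
  qed
qed

section \<open>The argument of a sum of two rotating terms\<close>

text \<open>
  The factors in front of the two phases are real and may be negative, so the phases
  agree only modulo \<open>pi\<close>. Their difference is continuous with values in the multiples of \<open>pi\<close>.
\<close>

lemma branch_increment_unique:
  fixes \<phi> \<mu> r s :: "real \<Rightarrow> real"
  assumes "connected I" "continuous_on I \<phi>" "continuous_on I \<mu>"
    and eq: "\<And>t. t \<in> I \<Longrightarrow> of_real (r t) * cis (\<phi> t) = of_real (s t) * cis (\<mu> t)"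
    and nz: "\<And>t. t \<in> I \<Longrightarrow> r t \<noteq> 0"
    and "a \<in> I" "b \<in> I"
  shows "\<phi> b - \<phi> a = \<mu> b - \<mu> a"
proof -
  define d where "d = (\<lambda>t. (\<phi> t - \<mu> t) / pi)"
  have int: "d t \<in> \<int>" if "t \<in> I" for t
  proof -
    have "of_real (r t) * cis (\<phi> t) * cis (- \<mu> t) = of_real (s t) * cis (\<mu> t) * cis (- \<mu> t)"
      using eq[OF that] by simp
    then have "of_real (r t) * cis (\<phi> t - \<mu> t) = of_real (s t)"
      by (simp add: cis_mult mult.assoc)
    then have "Im (of_real (r t) * cis (\<phi> t - \<mu> t)) = 0" by simp
    then have "sin (\<phi> t - \<mu> t) = 0" using nz[OF that] by simp
    then show ?thesis unfolding sin_zero_iff_int2 d_def by (auto simp: field_simps)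
  qed
  have "d constant_on I"
  proof (rule continuous_discrete_range_constant[OF assms(1)])
    show "continuous_on I d" unfolding d_def by (intro continuous_intros assms) simp
    fix x assume x: "x \<in> I"
    have "1 \<le> norm (d y - d x)" if "y \<in> I \<and> d y \<noteq> d x" for y
    proof -
      have "d y - d x \<in> \<int>" "d y - d x \<noteq> 0" using int x that by auto
      then show ?thesis by (auto simp: Ints_nonzero_abs_ge1)
    qed
    then show "\<exists>e>0. \<forall>y. y \<in> I \<and> d y \<noteq> d x \<longrightarrow> e \<le> norm (d y - d x)"
      by (intro exI[of _ 1]) auto
  qed
  then have "d a = d b" using assms(6,7) by (auto simp: constant_on_def)
  then show ?thesis by (simp add: d_def)
qed

lemma Re_one_plus_pos:
  assumes "norm q \<le> 1" "1 + q \<noteq> 0"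
  shows "Re (1 + q) > 0"
proof (rule ccontr)
  assume "\<not> Re (1 + q) > 0"
  then have "Re q \<le> - 1" by simp
  moreover have "- Re q \<le> 1" using abs_Re_le_cmod[of q] assms(1) by linarith
  ultimately have re: "Re q = - 1" by linarith
  have "(norm q)\<^sup>2 \<le> 1\<^sup>2" using assms(1) by (intro power_mono) auto
  then have "(Im q)\<^sup>2 \<le> 0" unfolding cmod_power2 re by simp
  then have "Im q = 0" by simp
  then show False using re assms(2) by (simp add: complex_eq_iff)
qed

lemma pos_Re_not_nonpos: "Re z > 0 \<Longrightarrow> z \<notin> \<real>\<^sub>\<le>\<^sub>0"
  by (auto simp: complex_nonpos_Reals_iff)

text \<open>
  This is the identity \<open>1 + cis x = 2 * cos (x / 2) * cis (x / 2)\<close>, applied to the representative \<open>x\<close> of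
  \<open>y\<close> in \<open>(-pi, pi)\<close>.
\<close>

lemma Arg_one_plus_cis:
  assumes "1 + cis y \<noteq> 0"
  shows "Arg (1 + cis y) = pi * (frac (y / (2 * pi) + 1 / 2) - 1 / 2)"
proof -
  define n where "n = \<lfloor>y / (2 * pi) + 1 / 2\<rfloor>"
  (* The representative of y in the half-open interval from -pi to pi. *)
  define x where "x = y - 2 * pi * of_int n"
  have fr: "frac (y / (2 * pi) + 1 / 2) = x / (2 * pi) + 1 / 2"
    unfolding frac_def n_def[symmetric] x_def by (simp add: field_simps)
  have b: "0 \<le> x / (2 * pi) + 1 / 2" "x / (2 * pi) + 1 / 2 < 1"
    using frac_ge_0[of "y / (2 * pi) + 1 / 2"] frac_lt_1[of "y / (2 * pi) + 1 / 2"] by (simp_all only: fr)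
  have x: "- pi \<le> x" "x < pi" using b pi_gt_zero by (simp_all add: field_simps)
  have "cis y = cis x"
    unfolding x_def cis_divide[symmetric] by (simp add: cis_multiple_2pi)
  then have half: "1 + cis y = of_real (2 * cos (x / 2)) * cis (x / 2)"
    using cos_double_cos[of "x / 2"] sin_double[of "x / 2"]
    by (simp add: complex_eq_iff power2_eq_square)
  have "x \<noteq> - pi" using assms half by auto
  then have "cos (x / 2) > 0" using x by (intro cos_gt_zero_pi) auto
  then have "Arg (1 + cis y) = x / 2"
    unfolding half using x by (intro Arg_unique[of "2 * cos (x / 2)"]) (auto simp: cis_conv_exp)
  then show ?thesis unfolding fr by (simp add: field_simps)
qed

text \<open>
  The quotient of the sum by its larger term lies in the half-plane of positive real part, where
  the principal argument is continuous.
\<close>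

lemma dominant_term_branch:
  fixes M m :: "real \<Rightarrow> complex" and \<phi> \<mu> r :: "real \<Rightarrow> real"
  assumes I: "connected I" "s \<in> I" "t \<in> I"
    and cont: "continuous_on I \<phi>" "continuous_on I \<mu>" "continuous_on I M" "continuous_on I m"
    and polar: "\<And>t. t \<in> I \<Longrightarrow> M t = of_real (norm (M t)) * cis (\<mu> t)"
    and nz: "\<And>t. t \<in> I \<Longrightarrow> M t \<noteq> 0" "\<And>t. t \<in> I \<Longrightarrow> M t + m t \<noteq> 0"
    and dom: "\<And>t. t \<in> I \<Longrightarrow> norm (m t) \<le> norm (M t)"
    and branch: "\<And>t. t \<in> I \<Longrightarrow> M t + m t = of_real (r t) * cis (\<phi> t)"
  shows "\<phi> t - \<phi> s = \<mu> t - \<mu> s + (Arg (1 + m t / M t) - Arg (1 + m s / M s))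
    \<and> \<bar>Arg (1 + m t / M t)\<bar> < pi / 2"
proof -
  have q: "Re (1 + m t / M t) > 0" if "t \<in> I" for t
  proof (rule Re_one_plus_pos)
    show "norm (m t / M t) \<le> 1" using nz(1)[OF that] dom[OF that] by (simp add: norm_divide)
    show "1 + m t / M t \<noteq> 0" using nz[OF that] by (simp add: field_simps)
  qed
  have "\<bar>Arg (1 + m t / M t)\<bar> < pi / 2" using q[OF I(3)] unfolding Arg_Re_pos by simp
  moreover have "\<phi> t - \<phi> s = (\<mu> t + Arg (1 + m t / M t)) - (\<mu> s + Arg (1 + m s / M s))"
  proof (rule branch_increment_unique[OF I(1) cont(1)])
    show "continuous_on I (\<lambda>t. \<mu> t + Arg (1 + m t / M t))"
      using q pos_Re_not_nonpos nz(1) by (intro continuous_intros cont) auto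
    fix t assume t: "t \<in> I"
    show "r t \<noteq> 0" using branch[OF t] nz(2)[OF t] by auto
    have q0: "1 + m t / M t \<noteq> 0" using q[OF t] by (metis less_irrefl zero_complex.sel(1))
    have "of_real (r t) * cis (\<phi> t) = M t * (1 + m t / M t)"
      using branch[OF t] nz(1)[OF t] by (simp add: field_simps)
    also have "\<dots> = of_real (norm (M t)) * cis (\<mu> t)
        * (of_real (norm (1 + m t / M t)) * cis (Arg (1 + m t / M t)))"
      using polar[OF t] q0 by (simp add: cis_Arg sgn_eq)
    finally show "of_real (r t) * cis (\<phi> t) = of_real (norm (M t) * norm (1 + m t / M t)) * cis (\<mu> t
        + Arg (1 + m t / M t))"
      by (simp add: cis_mult[symmetric] mult_ac)
  qed (use I in auto)
  ultimately show ?thesis by simp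
qed

lemma periodic_shift:
  fixes F :: "real \<Rightarrow> 'a"
  assumes "\<And>x. F (x + 2 * pi) = F x"
  shows "F (x + 2 * pi * real n) = F x"
proof (induction n)
  case (Suc n)
  have "F (x + 2 * pi * real (Suc n)) = F ((x + 2 * pi * real n) + 2 * pi)" by (simp add: algebra_simps)
  then show ?case using assms Suc by simp
qed simp

text \<open>
  Passes from the times \<open>a + n * P\<close> at the ends of the periods to all times.
\<close>

lemma tendsto_ratio_of_bounded_steps:
  fixes \<phi> :: "real \<Rightarrow> real" and a P K C :: real
  assumes "P > 0"
    and lattice: "(\<lambda>n. (\<phi> (a + real n * P) - K * real n) / real n) \<longlonglongrightarrow> 0"
    and step: "\<And>n t. n \<ge> n0 \<Longrightarrow> a + real n * P \<le> t \<Longrightarrow> t \<le> a + real (Suc n) * P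
                   \<Longrightarrow> \<bar>\<phi> t - \<phi> (a + real n * P)\<bar> \<le> C"
  shows "((\<lambda>t. \<phi> t / t) \<longlongrightarrow> K / P) at_top"
proof -
  define n where "n = (\<lambda>t. nat \<lfloor>(t - a) / P\<rfloor>)"
  define s where "s = (\<lambda>m. \<phi> (a + real m * P) - K * real m)"
  have ntop: "filterlim n at_top at_top"
    unfolding n_def
    by (intro filterlim_compose[OF filterlim_nat_sequentially]
        filterlim_compose[OF filterlim_floor_sequentially])
      (use assms(1) in real_asymp)
  have near: "\<forall>\<^sub>F t in at_top. n t \<ge> n0 \<and> n t \<ge> 1 \<and> t > max 0 (2 * \<bar>a\<bar>) \<and> t > a"
    using ntop by (intro eventually_conj eventually_gt_at_top filterlim_at_top[THEN iffD1, rule_format])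
  have lo: "a + real (n t) * P \<le> t" and hi: "t \<le> a + real (Suc (n t)) * P" if "t > a" for t
  proof -
    have "(t - a) / P \<ge> 0" using that assms(1) by simp
    then have "real (n t) \<le> (t - a) / P" "(t - a) / P \<le> real (n t) + 1"
      unfolding n_def by linarith+
    then show "a + real (n t) * P \<le> t" "t \<le> a + real (Suc (n t)) * P"
      using assms(1) by (simp_all add: field_simps)
  qed
  have lim_s: "((\<lambda>t. s (n t) / real (n t)) \<longlongrightarrow> 0) at_top"
    using filterlim_compose[OF lattice ntop] by (simp add: s_def)
  define E where "E = C + \<bar>K / P\<bar> * (\<bar>a\<bar> + P)"
  have "\<forall>\<^sub>F t in at_top. norm (\<phi> t / t - K / P) \<le> 2 / P * \<bar>s (n t) / real (n t)\<bar> + E / t"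
    using near
  proof eventually_elim
    case (elim t)
    then have t: "t > 0" "t > 2 * \<bar>a\<bar>" "t > a" "n t \<ge> n0" "n t \<ge> 1" by auto
    have l: "a + real (n t) * P \<le> t" and h: "t \<le> a + real (Suc (n t)) * P"
      using lo hi t by auto
    have c: "\<bar>\<phi> t - \<phi> (a + real (n t) * P)\<bar> \<le> C" using step[OF t(4) l h] .
    have "\<bar>K / P * (real (n t) * P - t)\<bar> \<le> \<bar>K / P\<bar> * (\<bar>a\<bar> + P)"
      unfolding abs_mult using l h by (intro mult_left_mono) (auto simp: algebra_simps)
    moreover have "K / P * (real (n t) * P - t) = K * real (n t) - K / P * t"
      using assms(1) by (simp add: field_simps)
    ultimately have "\<bar>K * real (n t) - K / P * t\<bar> \<le> E - C"
      unfolding E_def by (simp only: add_diff_cancel_left')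
    moreover have "\<phi> t - K / P * t
        = s (n t) + (\<phi> t - \<phi> (a + real (n t) * P)) + (K * real (n t) - K / P * t)"
      unfolding s_def by simp
    ultimately have "\<bar>\<phi> t - K / P * t\<bar> \<le> \<bar>s (n t)\<bar> + E"
      using c by linarith
    then have "\<bar>\<phi> t - K / P * t\<bar> / t \<le> (\<bar>s (n t)\<bar> + E) / t"
      using t by (intro divide_right_mono) auto
    moreover have "\<bar>\<phi> t - K / P * t\<bar> / t = norm (\<phi> t / t - K / P)"
    proof -
      have "\<phi> t / t - K / P = (\<phi> t - K / P * t) / t" using t by (simp add: field_simps)
      then show ?thesis using t by (simp add: abs_divide)
    qed
    moreover have "\<bar>s (n t)\<bar> / t \<le> 2 / P * \<bar>s (n t) / real (n t)\<bar>"
    proof -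
      have "real (n t) * P \<le> 2 * t" using l t by linarith
      then have "1 / t \<le> 2 / (P * real (n t))"
        using t assms(1) by (simp add: field_simps)
      then have "\<bar>s (n t)\<bar> * (1 / t) \<le> \<bar>s (n t)\<bar> * (2 / (P * real (n t)))"
        by (intro mult_left_mono) auto
      then show ?thesis by (simp add: field_simps abs_divide)
    qed
    ultimately show ?case by (simp add: add_divide_distrib)
  qed
  moreover have "((\<lambda>t. 2 / P * \<bar>s (n t) / real (n t)\<bar> + E / t) \<longlongrightarrow> 0) at_top"
  proof -
    have "((\<lambda>t. E / t) \<longlongrightarrow> 0) at_top"
      by (intro tendsto_divide_0[OF tendsto_const] filterlim_at_top_imp_at_infinity filterlim_ident)
    then have "((\<lambda>t. 2 / P * \<bar>s (n t) / real (n t)\<bar> + E / t) \<longlongrightarrow> 2 / P * \<bar>0\<bar> + 0) at_top"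
      by (intro tendsto_intros lim_s)
    then show ?thesis by simp
  qed
  ultimately have "((\<lambda>t. \<phi> t / t - K / P) \<longlongrightarrow> 0) at_top"
    by (rule Lim_null_comparison)
  then show ?thesis by (simp add: LIM_zero_iff)
qed

text \<open>
  The roles of the two terms change at the times \<open>a + n * P\<close> and \<open>b + n * P\<close> when the argument
  \<open>\<tau> + \<nu> * t\<close> of \<open>A\<close> and \<open>B\<close> passes \<open>-\<theta>\<close> and \<open>\<theta>\<close> modulo \<open>2 * pi\<close>. On each interval between such
  times the branch is that of the larger term up to the argument of a number in the right
  half-plane; at the ends of the interval this correction is a sawtooth value. Nothing is lost in
  this bookkeeping, so the increment over a period is a constant plus sawtooth values whose
  averages tend to zero.
\<close>

lemma two_term_mean_motion:
  fixes A B :: "real \<Rightarrow> complex" and \<alpha> \<beta> \<phi> r :: "real \<Rightarrow> real" and \<theta> \<sigma> \<tau> \<omega> \<nu> T :: real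
  defines "N \<equiv> \<lambda>t. A (\<tau> + \<nu> * t) + cis (\<sigma> + \<omega> * t) * B (\<tau> + \<nu> * t)"
  assumes \<nu>: "\<nu> > 0" and irrational: "\<omega> / \<nu> \<notin> \<rat>" and \<theta>: "0 < \<theta>" "\<theta> < pi"
    and periodic: "\<And>x. A (x + 2 * pi) = A x" "\<And>x. B (x + 2 * pi) = B x"
    and cont: "continuous_on UNIV A" "continuous_on UNIV B"
    and inner: "\<And>x. x \<in> {-\<theta>..\<theta>} \<Longrightarrow> B x \<noteq> 0 \<and> norm (A x) \<le> norm (B x) \<and> B x = of_real (norm (B x)) * cis (\<beta> x)"
      "continuous_on {-\<theta>..\<theta>} \<beta>"
    and outer: "\<And>x. x \<in> {\<theta>..2 * pi - \<theta>} \<Longrightarrow> A x \<noteq> 0 \<and> norm (B x) \<le> norm (A x) \<and> A x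
        = of_real (norm (A x)) * cis (\<alpha> x)"
      "continuous_on {\<theta>..2 * pi - \<theta>} \<alpha>"
    and nonzero: "\<And>t. t \<ge> T \<Longrightarrow> N t \<noteq> 0"
    and branch: "continuous_on {T..} \<phi>" "\<And>t. t \<ge> T \<Longrightarrow> N t = of_real (r t) * cis (\<phi> t)"
  shows "((\<lambda>t. \<phi> t / t) \<longlongrightarrow>
           \<omega> * \<theta> / pi + \<nu> * (\<beta> \<theta> - \<beta> (-\<theta>) + \<alpha> (2 * pi - \<theta>) - \<alpha> \<theta>) / (2 * pi)) at_top"
proof -
  define P where "P = 2 * pi / \<nu>"
  define a where "a = (- \<theta> - \<tau>) / \<nu>"
  define b where "b = (\<theta> - \<tau>) / \<nu>"
  define K where "K = 2 * \<omega> * \<theta> / \<nu> + (\<beta> \<theta> - \<beta> (-\<theta>)) + (\<alpha> (2 * pi - \<theta>) - \<alpha> \<theta>)"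
  define G where "G = (\<lambda>y. Arg (1 + cis y))"
  have P: "P > 0" using \<nu> by (simp add: P_def)
  have ab: "a < b" "b < a + P" "\<nu> * P = 2 * pi" "\<nu> * a = - \<theta> - \<tau>" "\<nu> * b = \<theta> - \<tau>"
    using \<nu> \<theta> by (simp_all add: a_def b_def P_def field_simps)
  have shift: "A x = A (x - 2 * pi * real n)" "B x = B (x - 2 * pi * real n)" for x n
    using periodic_shift[of A "x - 2 * pi * real n" n] periodic_shift[of B "x - 2 * pi * real n" n] periodic
        by auto
  (* Only the passages after all zeros are used; there the sum has an honest branch. *)
  obtain n0 :: nat where n0: "a + real n * P \<ge> T" if "n \<ge> n0" for n
  proof
    fix n :: nat assume "n \<ge> nat \<lceil>(T - a) / P\<rceil>"
    then have "(T - a) / P \<le> real n" by linarith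
    then show "a + real n * P \<ge> T" using P by (simp add: field_simps)
  qed

  (* Both dominance assumptions hold where the arcs meet; the period identifies 2 * pi - \<theta>
     with -\<theta>. *)
  have norm_eq: "norm (A x) = norm (B x)" if "x = \<theta> \<or> x = - \<theta>" for x
  proof -
    have "norm (B (-\<theta>)) \<le> norm (A (-\<theta>))"
      using outer(1)[of "2 * pi - \<theta>"] periodic[of "-\<theta>"] \<theta> by auto
    then show ?thesis using that inner(1)[of x] outer(1)[of \<theta>] \<theta> by (auto intro: order_antisym)
  qed
  define \<eta> where "\<eta> = (\<lambda>x. Arg (B x / A x))"
  have \<eta>: "B x = A x * cis (\<eta> x)" "A x \<noteq> 0" "B x \<noteq> 0" if "x = \<theta> \<or> x = - \<theta>" for x
  proof -
    show "B x \<noteq> 0" using that inner(1)[of x] \<theta> by auto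
    then show "A x \<noteq> 0" using norm_eq[OF that] by auto
    then show "B x = A x * cis (\<eta> x)"
      using norm_eq[OF that] \<open>B x \<noteq> 0\<close> by (simp add: \<eta>_def cis_Arg sgn_eq norm_divide)
  qed
  (* The phase between the two terms when the argument of A and B is x. *)
  define y where "y = (\<lambda>x t. \<eta> x + \<sigma> + \<omega> * t)"
  have nP: "\<nu> * (real n * P) = 2 * pi * real n" for n
    using ab(3) by (simp add: mult.left_commute)
  have at_a: "\<tau> + \<nu> * (a + real n * P) = - \<theta> + 2 * pi * real n" for n
    unfolding distrib_left nP ab by simp
  have at_b: "\<tau> + \<nu> * (b + real n * P) = \<theta> + 2 * pi * real n" for n
    unfolding distrib_left nP ab by simp

  define X where "X = (\<lambda>n t. \<tau> + \<nu> * t - 2 * pi * real n)"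
  define I where "I = (\<lambda>n. {a + real n * P..b + real n * P})"
  define J where "J = (\<lambda>n. {b + real n * P..a + real (Suc n) * P})"
  define ratio where "ratio = (\<lambda>x t. cis (\<sigma> + \<omega> * t) * B x / A x)"
  define inv_ratio where "inv_ratio = (\<lambda>x t. A x / (cis (\<sigma> + \<omega> * t) * B x))"
  have crossing: "inv_ratio x t = cis (- y x t)" "ratio x t = cis (y x t)" if "x = \<theta> \<or> x = - \<theta>" for x t
  proof -
    have e: "cis (\<sigma> + \<omega> * t) * cis (\<eta> x) = cis (y x t)"
      by (simp add: cis_mult y_def algebra_simps)
    have "inv_ratio x t = inverse (cis (\<sigma> + \<omega> * t) * cis (\<eta> x))" "ratio x t = cis (\<sigma> + \<omega> * t) * cis (\<eta> x)"
      using \<eta>(1,2)[OF that] by (simp_all add: inv_ratio_def ratio_def divide_inverse)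
    then show "inv_ratio x t = cis (- y x t)" "ratio x t = cis (y x t)"
      unfolding e by simp_all
  qed

  have X_I: "X n t \<in> {-\<theta>..\<theta>}" if "t \<in> I n" for n t
  proof -
    have "\<tau> + \<nu> * (a + real n * P) \<le> \<tau> + \<nu> * t" "\<tau> + \<nu> * t \<le> \<tau> + \<nu> * (b + real n * P)"
      using that \<nu> by (auto simp: I_def)
    then show ?thesis unfolding at_a at_b X_def by (simp add: algebra_simps)
  qed
  have X_J: "X n t \<in> {\<theta>..2 * pi - \<theta>}" if "t \<in> J n" for n t
  proof -
    have "\<tau> + \<nu> * (b + real n * P) \<le> \<tau> + \<nu> * t" "\<tau> + \<nu> * t \<le> \<tau> + \<nu> * (a + real (Suc n) * P)"
      using that \<nu> by (auto simp: J_def simp del: of_nat_Suc)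
    then show ?thesis unfolding at_a at_b X_def by (simp add: algebra_simps)
  qed
  have IJ_T: "t \<ge> T" if "n \<ge> n0" "t \<in> I n \<union> J n" for n t
    using n0[OF that(1)] that(2) ab by (auto simp: I_def J_def)
  have N_X: "N t = A (X n t) + cis (\<sigma> + \<omega> * t) * B (X n t)" for n t
    unfolding N_def X_def using shift[of "\<tau> + \<nu> * t" n] by simp
  have cX: "continuous_on Q (X n)" for Q n unfolding X_def by (intro continuous_intros)
  have cA: "continuous_on Q (\<lambda>t. A (X n t))"
    and cB: "continuous_on Q (\<lambda>t. cis (\<sigma> + \<omega> * t) * B (X n t))" for Q n
    by (intro continuous_intros continuous_on_compose2[OF cont(1) cX] continuous_on_compose2[OF cont(2) cX];
        simp)+

  have inner_step: "\<phi> t - \<phi> s = \<omega> * (t - s) + (\<beta> (X n t) - \<beta> (X n s))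
        + (Arg (1 + inv_ratio (X n t) t) - Arg (1 + inv_ratio (X n s) s))
      \<and> \<bar>Arg (1 + inv_ratio (X n t) t)\<bar> < pi / 2"
    if n: "n \<ge> n0" and st: "s \<in> I n" "t \<in> I n" for n s t
  proof -
    have "\<phi> t - \<phi> s = (\<sigma> + \<omega> * t + \<beta> (X n t)) - (\<sigma> + \<omega> * s + \<beta> (X n s))
        + (Arg (1 + A (X n t) / (cis (\<sigma> + \<omega> * t) * B (X n t)))
            - Arg (1 + A (X n s) / (cis (\<sigma> + \<omega> * s) * B (X n s))))
      \<and> \<bar>Arg (1 + A (X n t) / (cis (\<sigma> + \<omega> * t) * B (X n t)))\<bar> < pi / 2"
    proof (rule dominant_term_branch[where r = r])
      show "connected (I n)" by (simp add: I_def)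
      show "continuous_on (I n) \<phi>" using IJ_T[OF n] by (intro continuous_on_subset[OF branch(1)]) auto
      show "continuous_on (I n) (\<lambda>t. \<sigma> + \<omega> * t + \<beta> (X n t))"
        by (intro continuous_intros continuous_on_compose2[OF inner(2) cX]) (use X_I in auto)
      fix u assume u: "u \<in> I n"
      show "cis (\<sigma> + \<omega> * u) * B (X n u) = of_real (norm (cis (\<sigma> + \<omega> * u) * B (X n u))) * cis (\<sigma> + \<omega> * u
          + \<beta> (X n u))"
      proof -
        have "cis (\<sigma> + \<omega> * u) * B (X n u) = cis (\<sigma> + \<omega> * u) * (of_real (norm (B (X n u))) * cis (\<beta> (X n u)))"
          using inner(1)[OF X_I[OF u]] by simp
        then show ?thesis by (simp add: norm_mult cis_mult[symmetric] mult_ac)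
      qed
      show "cis (\<sigma> + \<omega> * u) * B (X n u) \<noteq> 0" "norm (A (X n u)) \<le> norm (cis (\<sigma> + \<omega> * u) * B (X n u))"
        using inner(1)[OF X_I[OF u]] by (simp_all add: norm_mult)
      have "N u = cis (\<sigma> + \<omega> * u) * B (X n u) + A (X n u)" using N_X[of u n] by simp
      then show "cis (\<sigma> + \<omega> * u) * B (X n u) + A (X n u) \<noteq> 0"
        "cis (\<sigma> + \<omega> * u) * B (X n u) + A (X n u) = of_real (r u) * cis (\<phi> u)"
        using nonzero[of u] branch(2)[of u] IJ_T[OF n, of u] u by simp_all
    qed (rule st cA cB)+
    then show ?thesis unfolding inv_ratio_def by (simp add: algebra_simps)
  qed

  have outer_step: "\<phi> t - \<phi> s = \<alpha> (X n t) - \<alpha> (X n s)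
        + (Arg (1 + ratio (X n t) t) - Arg (1 + ratio (X n s) s))
      \<and> \<bar>Arg (1 + ratio (X n t) t)\<bar> < pi / 2"
    if n: "n \<ge> n0" and st: "s \<in> J n" "t \<in> J n" for n s t
    unfolding ratio_def
  proof (rule dominant_term_branch[where r = r])
    show "connected (J n)" by (simp add: J_def)
    show "continuous_on (J n) \<phi>" using IJ_T[OF n] by (intro continuous_on_subset[OF branch(1)]) auto
    show "continuous_on (J n) (\<lambda>t. \<alpha> (X n t))"
      by (intro continuous_on_compose2[OF outer(2) cX]) (use X_J in auto)
    fix u assume u: "u \<in> J n"
    show "A (X n u) = of_real (norm (A (X n u))) * cis (\<alpha> (X n u))" "A (X n u) \<noteq> 0"
      "norm (cis (\<sigma> + \<omega> * u) * B (X n u)) \<le> norm (A (X n u))"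
      using outer(1)[OF X_J[OF u]] by (simp_all add: norm_mult)
    show "A (X n u) + cis (\<sigma> + \<omega> * u) * B (X n u) \<noteq> 0"
      "A (X n u) + cis (\<sigma> + \<omega> * u) * B (X n u) = of_real (r u) * cis (\<phi> u)"
      using nonzero[of u] branch(2)[of u] IJ_T[OF n, of u] u unfolding N_X[of u n] by simp_all
  qed (rule st cA cB)+

  have G: "1 + cis (y x t) \<noteq> 0" "Arg (1 + cis (- y x t)) = - G (y x t)"
    if "N t \<noteq> 0" "x = \<theta> \<or> x = - \<theta>" "\<tau> + \<nu> * t = x + 2 * pi * real n" for x t n
  proof -
    have "N t = A x + cis (\<sigma> + \<omega> * t) * B x"
      unfolding N_def that(3) using periodic_shift[of A x n] periodic_shift[of B x n] periodic by auto
    also have "\<dots> = A x * (1 + cis (y x t))"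
      using \<eta>[OF that(2)] by (simp add: y_def cis_mult[symmetric] field_simps)
    finally show nz: "1 + cis (y x t) \<noteq> 0" using that(1) by auto
    have "Re (1 + cis (y x t)) > 0" using nz by (intro Re_one_plus_pos) auto
    then show "Arg (1 + cis (- y x t)) = - G (y x t)"
      unfolding G_def cis_cnj[symmetric] using Arg_cnj[of "1 + cis (y x t)"]
      by (auto simp: Arg_real split: if_splits)
  qed
  define Ga where "Ga = (\<lambda>n. G (y (-\<theta>) (a + real n * P)))"
  define Gb where "Gb = (\<lambda>n. G (y \<theta> (b + real n * P)))"
  have Ta: "N (a + real n * P) \<noteq> 0" and Tb: "N (b + real n * P) \<noteq> 0" if "n \<ge> n0" for n
    using n0[OF that] ab by (auto intro!: nonzero)

  (* The inner correction enters with the opposite sign of the outer one, since there the quotient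
     of the terms is inverted; so the two contributions at a passage add up instead of cancelling. *)
  have period: "\<phi> (a + real (Suc n) * P) - \<phi> (a + real n * P) = K + (Ga n + Ga (Suc n) - 2 * Gb n)"
    if n: "n \<ge> n0" for n
  proof -
    have Xab: "X n (a + real n * P) = - \<theta>" "X n (b + real n * P) = \<theta>" "X n (a + real (Suc n) * P) = 2 * pi - \<theta>"
      unfolding X_def at_a at_b by (simp_all add: algebra_simps)
    have in_I: "a + real n * P \<in> I n" "b + real n * P \<in> I n" using ab by (simp_all add: I_def)
    have in_J: "b + real n * P \<in> J n" "a + real (Suc n) * P \<in> J n" using ab
        by (simp_all add: J_def algebra_simps)
    note cross = crossing[OF disjI1[OF refl]] crossing[OF disjI2[OF refl]]
    have wrap: "ratio (2 * pi - \<theta>) t = ratio (- \<theta>) t" for t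
      using periodic[of "- \<theta>"] by (simp add: ratio_def)
    have ba: "\<omega> * ((b + real n * P) - (a + real n * P)) = 2 * \<omega> * \<theta> / \<nu>"
      by (simp add: a_def b_def diff_divide_distrib algebra_simps)
    have "\<phi> (b + real n * P) - \<phi> (a + real n * P) = \<omega> * ((b + real n * P) - (a + real n * P))
        + (\<beta> \<theta> - \<beta> (-\<theta>)) + (Arg (1 + cis (- y \<theta> (b + real n * P))) - Arg (1 + cis (- y (-\<theta>) (a + real n * P))))"
      using inner_step[OF n in_I] by (simp only: Xab cross)
    also have "\<dots> = 2 * \<omega> * \<theta> / \<nu> + (\<beta> \<theta> - \<beta> (-\<theta>)) + (Ga n - Gb n)"
      using G(2)[OF Ta[OF n] _ at_a] G(2)[OF Tb[OF n] _ at_b] ba by (simp add: Ga_def Gb_def)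
    finally have 1: "\<phi> (b + real n * P) - \<phi> (a + real n * P) = \<dots>" .
    have "\<phi> (a + real (Suc n) * P) - \<phi> (b + real n * P) = (\<alpha> (2 * pi - \<theta>) - \<alpha> \<theta>) + (Ga (Suc n) - Gb n)"
      using outer_step[OF n in_J] unfolding Xab wrap cross by (simp add: Ga_def Gb_def G_def)
    then show ?thesis using 1 by (simp add: K_def)
  qed

  define saw where "saw = (\<lambda>u n. pi * (frac (u + real n * (\<omega> / \<nu>)) - 1 / 2))"
  have saw: "(\<lambda>n. (\<Sum>k<n. saw u k) / real n) \<longlonglongrightarrow> 0" for u
    using tendsto_mult[OF tendsto_const[of pi] rotation_sawtooth_average[OF irrational, of u]]
    by (simp add: saw_def sum_distrib_left[symmetric])
  define ua where "ua = y (-\<theta>) a / (2 * pi) + 1 / 2"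
  define ub where "ub = y \<theta> b / (2 * pi) + 1 / 2"
  have GaS: "Ga n = saw ua n" if "n \<ge> n0" for n
  proof -
    have "y (-\<theta>) (a + real n * P) / (2 * pi) + 1 / 2 = ua + real n * (\<omega> / \<nu>)"
      by (simp add: ua_def y_def P_def field_simps)
    then show ?thesis
      using Arg_one_plus_cis[OF G(1)[OF Ta[OF that] _ at_a]] by (simp add: Ga_def G_def saw_def)
  qed
  have GbS: "Gb n = saw ub n" if "n \<ge> n0" for n
  proof -
    have "y \<theta> (b + real n * P) / (2 * pi) + 1 / 2 = ub + real n * (\<omega> / \<nu>)"
      by (simp add: ub_def y_def P_def field_simps)
    then show ?thesis
      using Arg_one_plus_cis[OF G(1)[OF Tb[OF that] _ at_b]] by (simp add: Gb_def G_def saw_def)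
  qed
  have sawS: "saw ua (Suc n) = saw (ua + \<omega> / \<nu>) n" for n
    by (simp add: saw_def algebra_simps add_divide_distrib)
  define D where "D = (\<lambda>n. saw ua n + saw (ua + \<omega> / \<nu>) n - 2 * saw ub n)"
  have limD: "(\<lambda>n. (\<Sum>k<n. D k) / real n) \<longlonglongrightarrow> 0"
  proof -
    have "(\<lambda>n. (\<Sum>k<n. saw ua k) / real n + (\<Sum>k<n. saw (ua + \<omega> / \<nu>) k) / real n
        - 2 * ((\<Sum>k<n. saw ub k) / real n)) \<longlonglongrightarrow> 0 + 0 - 2 * 0"
      by (intro tendsto_intros saw)
    then show ?thesis
      by (simp add: D_def sum.distrib sum_subtractf sum_distrib_left[symmetric] add_divide_distrib
          diff_divide_distrib)
  qed
  have acc: "\<phi> (a + real n * P) - K * real n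
      = (\<phi> (a + real n0 * P) - K * real n0 - (\<Sum>k<n0. D k)) + (\<Sum>k<n. D k)" if "n \<ge> n0" for n
    using that
  proof (induction n rule: dec_induct)
    case (step n)
    have "\<phi> (a + real (Suc n) * P) = \<phi> (a + real n * P) + K + D n"
      using period[OF step(1)] GaS[OF step(1)] GaS[of "Suc n"] GbS[OF step(1)] step(1)
      by (simp add: D_def sawS del: of_nat_Suc)
    then show ?case using step.IH by (simp add: algebra_simps)
  qed simp
  have lattice: "(\<lambda>n. (\<phi> (a + real n * P) - K * real n) / real n) \<longlonglongrightarrow> 0"
  proof -
    define c where "c = \<phi> (a + real n0 * P) - K * real n0 - (\<Sum>k<n0. D k)"
    have "(\<lambda>n. c / real n + (\<Sum>k<n. D k) / real n) \<longlonglongrightarrow> 0 + 0"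
      by (intro tendsto_add limD lim_const_over_n)
    moreover have "\<forall>\<^sub>F n in sequentially. c / real n + (\<Sum>k<n. D k) / real n
        = (\<phi> (a + real n * P) - K * real n) / real n"
      using eventually_ge_at_top[of n0]
      by eventually_elim (subst acc, assumption, simp only: c_def add_divide_distrib)
    ultimately show ?thesis by (auto intro: Lim_transform_eventually)
  qed

  obtain M\<beta> where M\<beta>: "\<bar>\<beta> x\<bar> \<le> M\<beta>" if "x \<in> {-\<theta>..\<theta>}" for x
  proof -
    have "bounded (\<beta> ` {-\<theta>..\<theta>})"
      using inner(2) compact_continuous_image compact_imp_bounded by blast
    then obtain c where "\<forall>v\<in>\<beta> ` {-\<theta>..\<theta>}. norm v \<le> c" unfolding bounded_iff by blast
    then show ?thesis by (intro that[of c]) auto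
  qed
  obtain M\<alpha> where M\<alpha>: "\<bar>\<alpha> x\<bar> \<le> M\<alpha>" if "x \<in> {\<theta>..2 * pi - \<theta>}" for x
  proof -
    have "bounded (\<alpha> ` {\<theta>..2 * pi - \<theta>})"
      using outer(2) compact_continuous_image compact_imp_bounded by blast
    then obtain c where "\<forall>v\<in>\<alpha> ` {\<theta>..2 * pi - \<theta>}. norm v \<le> c" unfolding bounded_iff by blast
    then show ?thesis by (intro that[of c]) auto
  qed
  have step: "\<bar>\<phi> t - \<phi> (a + real n * P)\<bar> \<le> (\<bar>\<omega>\<bar> * P + 2 * M\<beta> + pi) + (2 * M\<alpha> + pi)"
    if n: "n \<ge> n0" and t: "a + real n * P \<le> t" "t \<le> a + real (Suc n) * P" for n t
  proof -
    have in1: "\<bar>\<phi> u - \<phi> (a + real n * P)\<bar> \<le> \<bar>\<omega>\<bar> * P + 2 * M\<beta> + pi" if "u \<in> I n" for u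
    proof -
      have s: "a + real n * P \<in> I n" using ab by (auto simp: I_def)
      have "\<bar>\<omega> * (u - (a + real n * P))\<bar> \<le> \<bar>\<omega>\<bar> * P"
        unfolding abs_mult using that ab by (intro mult_left_mono) (auto simp: I_def)
      then show ?thesis
        using inner_step[OF n s that] inner_step[OF n s s] M\<beta>[OF X_I[OF that]] M\<beta>[OF X_I[OF s]] by linarith
    qed
    have in2: "\<bar>\<phi> u - \<phi> (b + real n * P)\<bar> \<le> 2 * M\<alpha> + pi" if "u \<in> J n" for u
    proof -
      have s: "b + real n * P \<in> J n" using ab by (auto simp: J_def algebra_simps)
      show ?thesis
        using outer_step[OF n s that] outer_step[OF n s s] M\<alpha>[OF X_J[OF that]] M\<alpha>[OF X_J[OF s]] by linarith
    qed
    have "M\<alpha> \<ge> 0" using M\<alpha>[of \<theta>] \<theta> by auto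
    show ?thesis
    proof (cases "t \<le> b + real n * P")
      case True
      then have "t \<in> I n" using t by (simp add: I_def)
      from in1[OF this] \<open>M\<alpha> \<ge> 0\<close> pi_gt_zero show ?thesis by argo
    next
      case False
      then have "t \<in> J n" "b + real n * P \<in> I n" using t ab by (simp_all add: I_def J_def del: of_nat_Suc)
      from in1[OF this(2)] in2[OF this(1)] show ?thesis by argo
    qed
  qed
  have "K / P = \<omega> * \<theta> / pi + \<nu> * (\<beta> \<theta> - \<beta> (-\<theta>) + \<alpha> (2 * pi - \<theta>) - \<alpha> \<theta>) / (2 * pi)"
    using \<nu> by (simp add: K_def P_def field_simps)
  with tendsto_ratio_of_bounded_steps[OF P lattice step] show ?thesis by simp
qed

section \<open>Branches of the argument through simple zeros\<close>

text \<open>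
  Dividing by \<open>t - t\<^sub>0\<close> removes a simple zero and leaves a continuous function whose value at \<open>t\<^sub>0\<close> is
  the derivative. The divided factor is real, so a branch for the quotient is one for \<open>f\<close>, with
  a radius that changes sign. A function without zeros on the half-line has a logarithm.
\<close>

lemma arg_branch_exists_simple_zeros:
  assumes "finite Z" "Z \<subseteq> {0..}" "continuous_on {0..} f"
    and "\<And>t. t \<ge> 0 \<Longrightarrow> f t = 0 \<longleftrightarrow> t \<in> Z"
    and "\<And>t. t \<in> Z \<Longrightarrow> \<exists>d. d \<noteq> 0 \<and> (f has_vector_derivative d) (at t within {0..})"
  shows "\<exists>\<phi>. arg_branch f \<phi>"
  using assms
proof (induction Z arbitrary: f rule: finite_induct)
  case empty
  then obtain g where g: "continuous_on {0..} g" "\<And>t. t \<in> {0..} \<Longrightarrow> f t = exp (g t)"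
    using continuous_logarithm_on_contractible[of "{0..}" f] convex_imp_contractible[of "{0::real..}"]
    by (metis atLeast_iff convex_real_interval(1) empty_iff)
  have "arg_branch f (\<lambda>t. Im (g t))"
    unfolding arg_branch_def
  proof (intro conjI exI allI impI)
    show "continuous_on {0..} (\<lambda>t. Im (g t))" by (intro continuous_intros g)
    show "f t = of_real (exp (Re (g t))) * cis (Im (g t))" if "0 \<le> t" for t
      using g(2)[of t] that exp_eq_polar[of "g t"] by simp
  qed
  then show ?case by blast
next
  case (insert t0 Z)
  obtain d where d: "d \<noteq> 0" "(f has_vector_derivative d) (at t0 within {0..})"
    using insert.prems(4) by blast
  have f0: "f t0 = 0" "t0 \<ge> 0" using insert.prems by auto
  define g where "g = (\<lambda>t. if t = t0 then d else f t / of_real (t - t0))"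
  have "\<exists>\<phi>. arg_branch g \<phi>"
  proof (rule insert.IH)
    show "Z \<subseteq> {0..}" using insert.prems by auto
    show "continuous_on {0..} g"
      unfolding continuous_on_eq_continuous_within
    proof
      fix t :: real assume t: "t \<in> {0..}"
      show "continuous (at t within {0..}) g"
      proof (cases "t = t0")
        case True
        have "((\<lambda>y. (1 / norm (y - t0)) *\<^sub>R (f y - (f t0 + (y - t0) *\<^sub>R d))) \<longlongrightarrow> 0) (at t0 within {0..})"
          using d(2) unfolding has_vector_derivative_def has_derivative_within by blast
        then have "((\<lambda>y. norm ((1 / norm (y - t0)) *\<^sub>R (f y - (f t0 + (y - t0) *\<^sub>R d)))) \<longlongrightarrow> 0)
            (at t0 within {0..})"
          by (rule tendsto_norm_zero)
        moreover have "\<forall>\<^sub>F y in at t0 within {0..}.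
            norm ((1 / norm (y - t0)) *\<^sub>R (f y - (f t0 + (y - t0) *\<^sub>R d))) = norm (g y - d)"
          unfolding eventually_at_filter
        proof (intro always_eventually allI impI)
          fix y assume y: "y \<noteq> t0"
          have "g y - d = (f y - (f t0 + (y - t0) *\<^sub>R d)) / of_real (y - t0)"
            using y by (simp add: g_def f0 scaleR_conv_of_real diff_divide_distrib del: of_real_diff)
          then show "norm ((1 / norm (y - t0)) *\<^sub>R (f y - (f t0 + (y - t0) *\<^sub>R d))) = norm (g y - d)"
            by (simp add: norm_divide del: of_real_diff)
        qed
        ultimately have "((\<lambda>y. norm (g y - d)) \<longlongrightarrow> 0) (at t0 within {0..})"
          by (rule Lim_transform_eventually)
        then have "((\<lambda>y. g y - d) \<longlongrightarrow> 0) (at t0 within {0..})"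
          by (rule tendsto_norm_zero_cancel)
        then show ?thesis
          unfolding True continuous_within LIM_zero_iff by (simp add: g_def)
      next
        case False
        have "continuous (at t within {0..}) (\<lambda>t. f t / of_real (t - t0))"
          using insert.prems(2) t False unfolding continuous_on_eq_continuous_within
          by (intro continuous_intros) auto
        then show ?thesis
          by (rule continuous_transform_within[where \<delta> = "dist t t0"])
              (use t False in \<open>auto simp: g_def dist_commute\<close>)
      qed
    qed
    show "g t = 0 \<longleftrightarrow> t \<in> Z" if "t \<ge> 0" for t
      using insert.prems(3)[OF that] insert.hyps d by (auto simp: g_def)
    show "\<exists>d. d \<noteq> 0 \<and> (g has_vector_derivative d) (at t within {0..})" if tZ: "t \<in> Z" for t
    proof -
      have t: "t \<noteq> t0" "t \<ge> 0" using that insert.hyps(2) insert.prems(1) by auto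
      then have t3: "f t = 0" using insert.prems(3)[of t] that by simp
      obtain e where e: "e \<noteq> 0" "(f has_vector_derivative e) (at t within {0..})"
        using insert.prems(4)[OF insertI2[OF tZ]] by auto
      have "((\<lambda>t. t - t0) has_real_derivative 1) (at t within {0..})"
        by (auto intro!: derivative_eq_intros)
      from DERIV_inverse'[OF this] t(1) obtain c where
        "((\<lambda>t. inverse (t - t0)) has_real_derivative c) (at t within {0..})" by auto
      from has_vector_derivative_scaleR[OF this e(2)]
      have "((\<lambda>t. inverse (t - t0) *\<^sub>R f t) has_vector_derivative inverse (t - t0) *\<^sub>R e) (at t within {0..})"
        by (simp add: t3)
      moreover have "inverse (s - t0) *\<^sub>R f s = g s" if "dist s t < dist t t0" for s
        using that by (auto simp: g_def dist_commute scaleR_conv_of_real divide_inverse)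
      ultimately have "(g has_vector_derivative inverse (t - t0) *\<^sub>R e) (at t within {0..})"
        using t by (elim has_vector_derivative_transform_within[where d = "dist t t0"]) auto
      then show ?thesis using e t by (intro exI[of _ "inverse (t - t0) *\<^sub>R e"]) auto
    qed
  qed
  then obtain \<phi> r where \<phi>: "continuous_on {0..} \<phi>" "\<And>t. t \<ge> 0 \<Longrightarrow> g t = of_real (r t) * cis (\<phi> t)"
    unfolding arg_branch_def by blast
  have "f t = of_real ((t - t0) * r t) * cis (\<phi> t)" if "t \<ge> 0" for t
  proof (cases "t = t0")
    case False
    then have "f t = of_real (t - t0) * g t" by (simp add: g_def del: of_real_diff)
    then show ?thesis using \<phi>(2)[OF that] by simp
  qed (simp add: f0)
  then show ?case using \<phi>(1) unfolding arg_branch_def by (intro exI conjI[of "continuous_on _ _"] allI impI)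
qed

lemma arg_branch_mult:
  assumes "arg_branch f \<phi>" "continuous_on {0..} \<mu>"
    and "\<And>t. t \<ge> 0 \<Longrightarrow> z t = f t * (of_real (\<rho> t) * cis (\<mu> t))"
  shows "arg_branch z (\<lambda>t. \<phi> t + \<mu> t)"
proof -
  obtain r where r: "continuous_on {0..} \<phi>" "\<And>t. t \<ge> 0 \<Longrightarrow> f t = of_real (r t) * cis (\<phi> t)"
    using assms(1) unfolding arg_branch_def by blast
  then have "z t = of_real (r t * \<rho> t) * cis (\<phi> t + \<mu> t)" if "t \<ge> 0" for t
    using assms(3)[OF that] that by (simp add: cis_mult[symmetric])
  then show ?thesis
    unfolding arg_branch_def by (intro conjI exI[of _ "\<lambda>t. r t * \<rho> t"]) (auto intro: continuous_intros r assms)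
qed

lemma asymptotic_angular_velocity_mult:
  assumes f: "has_asymptotic_angular_velocity f \<omega>"
    and \<mu>: "continuous_on {0..} \<mu>" "((\<lambda>t. \<mu> t / t) \<longlongrightarrow> m) at_top"
    and z: "\<And>t. t \<ge> 0 \<Longrightarrow> z t = f t * (of_real (\<rho> t) * cis (\<mu> t))" "\<And>t. t \<ge> 0 \<Longrightarrow> \<rho> t \<noteq> 0"
  shows "has_asymptotic_angular_velocity z (m + \<omega>)"
  unfolding has_asymptotic_angular_velocity_def
proof (intro conjI allI impI)
  show "\<exists>\<phi>. arg_branch z \<phi>"
    using f arg_branch_mult[OF _ \<mu>(1) z(1)] unfolding has_asymptotic_angular_velocity_def by blast
  fix \<phi> assume "arg_branch z \<phi>"
  then have "arg_branch f (\<lambda>t. \<phi> t + - \<mu> t)"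
  proof (rule arg_branch_mult)
    show "continuous_on {0..} (\<lambda>t. - \<mu> t)" by (intro continuous_intros \<mu>)
    show "f t = z t * (of_real (1 / \<rho> t) * cis (- \<mu> t))" if "t \<ge> 0" for t
      using z[OF that] by (simp add: cis_inverse[symmetric] divide_inverse mult_ac del: cis_inverse)
  qed
  then have "((\<lambda>t. (\<phi> t + - \<mu> t) / t) \<longlongrightarrow> \<omega>) at_top"
    using f unfolding has_asymptotic_angular_velocity_def by blast
  from tendsto_add[OF \<mu>(2) this] show "((\<lambda>t. \<phi> t / t) \<longlongrightarrow> m + \<omega>) at_top"
    by (simp add: diff_divide_distrib)
qed

section \<open>The mean motion of the linkage function\<close>

lemma cos_le_on_outer_arc:
  assumes "0 < \<theta>" "\<theta> < pi" "x \<in> {\<theta>..2 * pi - \<theta>}"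
  shows "cos x \<le> cos \<theta>"
proof (cases "x \<le> pi")
  case True
  then show ?thesis using assms by (intro cos_monotone_0_pi_le) auto
next
  case False
  have "cos (2 * pi - x) \<le> cos \<theta>" using assms False by (intro cos_monotone_0_pi_le) auto
  then show ?thesis by (simp add: cos_diff)
qed

lemma cos_ge_on_inner_arc:
  assumes "0 < \<theta>" "\<theta> < pi" "x \<in> {-\<theta>..\<theta>}"
  shows "cos \<theta> \<le> cos x"
proof -
  have "cos \<theta> \<le> cos \<bar>x\<bar>" using assms by (intro cos_monotone_0_pi_le) auto
  then show ?thesis by simp
qed

text \<open>
  With \<open>a, b, c\<close> the values of \<open>gtan\<close> at the lengths of the joints and \<open>\<kappa>\<close> the curvature,
  the formula for \<open>cos \<theta>\<close> says that the second and third joint, bent at the angle \<open>\<theta>\<close>, span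
  a distance equal to the first length. The difference of the squared moduli of the two terms is a positive
  multiple of \<open>cos x - cos \<theta>\<close>, which decides the dominant term and makes the zeros simple.
\<close>

lemma linkage_mean_motion:
  fixes \<kappa> a b c \<theta> \<sigma> \<tau> \<omega> \<nu> :: real
  defines "A \<equiv> \<lambda>x. of_real a * (1 - of_real (\<kappa> * b * c) * cis x)"
    and "B \<equiv> \<lambda>x. of_real b + of_real c * cis x"
  assumes \<kappa>: "\<kappa> = 1 \<or> \<kappa> = - 1" and pos: "a > 0" "b > 0" "c > 0"
    and small: "b * c < 1" "1 + \<kappa> * a\<^sup>2 > 0"
    and \<theta>: "0 < \<theta>" "\<theta> < pi" "cos \<theta> = (a\<^sup>2 * (1 + (b * c)\<^sup>2) - b\<^sup>2 - c\<^sup>2) / (2 * b * c * (1 + \<kappa> * a\<^sup>2))"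
    and \<nu>: "\<nu> > 0" and irrational: "\<omega> / \<nu> \<notin> \<rat>"
  shows "has_asymptotic_angular_velocity (\<lambda>t. A (\<tau> + \<nu> * t) + cis (\<sigma> + \<omega> * t) * B (\<tau> + \<nu> * t))
     (\<omega> * \<theta> / pi + \<nu> * (Arg (B \<theta>) - Arg (1 - of_real (\<kappa> * b * c) * cis \<theta>)) / pi)"
proof -
  define N where "N = (\<lambda>t. A (\<tau> + \<nu> * t) + cis (\<sigma> + \<omega> * t) * B (\<tau> + \<nu> * t))"
  define A1 where "A1 = (\<lambda>x. 1 - of_real (\<kappa> * b * c) * cis x)"
  define k where "k = 2 * b * c * (1 + \<kappa> * a\<^sup>2)"
  have k: "k > 0" using pos small by (simp add: k_def)
  have A: "A x = of_real a * A1 x" for x by (simp add: A_def A1_def)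
  have gap: "(norm (B x))\<^sup>2 - (norm (A x))\<^sup>2 = k * (cos x - cos \<theta>)" for x
  proof -
    have k\<theta>: "k * cos \<theta> = a\<^sup>2 * (1 + (b * c)\<^sup>2) - b\<^sup>2 - c\<^sup>2"
      using \<theta>(3) k unfolding k_def by (simp add: field_simps)
    have s: "(sin x)\<^sup>2 = 1 - (cos x)\<^sup>2" by (simp add: sin_squared_eq)
    have "(norm (B x))\<^sup>2 = b\<^sup>2 + c\<^sup>2 + 2 * b * c * cos x"
      unfolding cmod_power2 B_def by (simp add: power2_sum power_mult_distrib s algebra_simps)
    moreover have "(norm (A1 x))\<^sup>2 = 1 + \<kappa>\<^sup>2 * (b * c)\<^sup>2 - 2 * \<kappa> * b * c * cos x"
      unfolding cmod_power2 A1_def by (simp add: power2_diff power_mult_distrib s algebra_simps)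
    moreover have "\<kappa>\<^sup>2 = 1" using \<kappa> by auto
    ultimately show ?thesis
      unfolding right_diff_distrib k\<theta> using pos(1)
      by (simp add: A norm_mult power_mult_distrib k_def) (simp add: algebra_simps power2_eq_square)
  qed
  have BA: "norm (A x) \<le> norm (B x)" if "x \<in> {-\<theta>..\<theta>}" for x
  proof -
    have "k * (cos x - cos \<theta>) \<ge> 0" using k cos_ge_on_inner_arc[OF \<theta>(1,2) that] by simp
    then have "(norm (A x))\<^sup>2 \<le> (norm (B x))\<^sup>2" using gap[of x] by linarith
    then show ?thesis by (rule power2_le_imp_le) simp
  qed
  have AB: "norm (B x) \<le> norm (A x)" if "x \<in> {\<theta>..2 * pi - \<theta>}" for x
  proof -
    have "k * (cos x - cos \<theta>) \<le> 0" using k cos_le_on_outer_arc[OF \<theta>(1,2) that] by (simp add: mult_nonneg_nonpos)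
    then have "(norm (B x))\<^sup>2 \<le> (norm (A x))\<^sup>2" using gap[of x] by linarith
    then show ?thesis by (rule power2_le_imp_le) simp
  qed
  have A1_pos: "Re (A1 x) > 0" for x
  proof -
    have "norm (of_real (\<kappa> * b * c) * cis x) = b * c" using \<kappa> pos by (auto simp: norm_mult)
    then have "\<bar>Re (of_real (\<kappa> * b * c) * cis x)\<bar> \<le> b * c" by (metis abs_Re_le_cmod)
    moreover have "Re (1 - w) = 1 - Re w" for w by simp
    ultimately show ?thesis using small unfolding A1_def by fastforce
  qed
  have A1_nz: "A1 x \<noteq> 0" "A x \<noteq> 0" for x
    using A1_pos[of x] pos by (auto simp: A)
  have B_pos: "B x \<notin> \<real>\<^sub>\<le>\<^sub>0" if "x \<in> {-\<theta>..\<theta>}" for x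
  proof
    assume neg: "B x \<in> \<real>\<^sub>\<le>\<^sub>0"
    then have "sin x = 0" "b + c * cos x \<le> 0" using pos by (auto simp: complex_nonpos_Reals_iff B_def)
    moreover have "x = 0"
      using \<open>sin x = 0\<close> that \<theta> sin_gt_zero[of x] sin_gt_zero[of "- x"]
          by (cases x "0::real" rule: linorder_cases) auto
    ultimately show False using pos by simp
  qed
  have polar: "z = of_real (norm z) * cis (Arg z)" for z
    by (cases "z = 0") (simp_all add: cis_Arg sgn_eq)
  have cont: "continuous_on UNIV A" "continuous_on UNIV B" "continuous_on UNIV A1"
    unfolding A_def B_def A1_def by (intro continuous_intros)+
  have periodic: "A (x + 2 * pi) = A x" "B (x + 2 * pi) = B x" for x
    by (simp_all add: A_def B_def complex_eq_iff)

  define Z where "Z = {t. t \<ge> 0 \<and> N t = 0}"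
  have Z_cos: "cos (\<tau> + \<nu> * t) = cos \<theta>" "cis (\<sigma> + \<omega> * t) * B (\<tau> + \<nu> * t) = - A (\<tau> + \<nu> * t)" if "t \<in> Z" for t
  proof -
    show e: "cis (\<sigma> + \<omega> * t) * B (\<tau> + \<nu> * t) = - A (\<tau> + \<nu> * t)"
      using that by (simp add: Z_def N_def add_eq_0_iff)
    have "norm (B (\<tau> + \<nu> * t)) = norm (A (\<tau> + \<nu> * t))"
      using arg_cong[OF e, of norm] by (simp add: norm_mult)
    then show "cos (\<tau> + \<nu> * t) = cos \<theta>" using gap[of "\<tau> + \<nu> * t"] k by simp
  qed
  have sin\<theta>: "sin \<theta> > 0" using \<theta> by (intro sin_gt_zero)
  have Z_sin: "sin (\<tau> + \<nu> * t) \<in> {sin \<theta>, - sin \<theta>}" if "t \<in> Z" for t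
  proof -
    have "(sin (\<tau> + \<nu> * t))\<^sup>2 = (sin \<theta>)\<^sup>2" using Z_cos(1)[OF that] by (simp add: sin_squared_eq)
    then show ?thesis by (simp add: power2_eq_iff)
  qed
  (* At a zero the cosine of the third angle is that of \<theta>, so its sine determines both terms
     and with them the phase of the second angle. Two zeros with the same angles would make \<omega> /
     \<nu> rational. *)
  have "inj_on (\<lambda>t. sin (\<tau> + \<nu> * t)) Z"
  proof (rule inj_onI, rule ccontr)
    fix s t assume st: "s \<in> Z" "t \<in> Z" "sin (\<tau> + \<nu> * s) = sin (\<tau> + \<nu> * t)" "s \<noteq> t"
    then have "cos (\<tau> + \<nu> * s) = cos (\<tau> + \<nu> * t)" using Z_cos(1) by simp
    with st(3) obtain m :: int where m: "\<tau> + \<nu> * s = \<tau> + \<nu> * t + 2 * pi * of_int m"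
      using sin_cos_eq_iff[of "\<tau> + \<nu> * s" "\<tau> + \<nu> * t"] by auto
    have "cis (\<tau> + \<nu> * s) = cis (\<tau> + \<nu> * t)"
      using st(3) \<open>cos (\<tau> + \<nu> * s) = cos (\<tau> + \<nu> * t)\<close> by (simp add: complex_eq_iff)
    then have same: "A (\<tau> + \<nu> * s) = A (\<tau> + \<nu> * t)" "B (\<tau> + \<nu> * s) = B (\<tau> + \<nu> * t)"
      by (simp_all add: A_def B_def)
    have "B (\<tau> + \<nu> * t) \<noteq> 0" using Z_cos(2)[OF st(2)] A1_nz by auto
    then have "cis (\<sigma> + \<omega> * s) = cis (\<sigma> + \<omega> * t)"
      using Z_cos(2)[OF st(1)] Z_cos(2)[OF st(2)] unfolding same by (metis mult_right_cancel)
    then obtain n :: int where n: "\<sigma> + \<omega> * s = \<sigma> + \<omega> * t + 2 * pi * of_int n"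
      using sin_cos_eq_iff[of "\<sigma> + \<omega> * s" "\<sigma> + \<omega> * t"] by (auto simp: complex_eq_iff)
    have "\<omega> * (s - t) = 2 * pi * of_int n" "\<nu> * (s - t) = 2 * pi * of_int m"
      using m n by (simp_all add: algebra_simps)
    then have "\<omega> / \<nu> = of_int n / of_int m"
      using \<open>s \<noteq> t\<close> \<nu> mult_divide_mult_cancel_right[of "s - t" \<omega> \<nu>] by simp
    then show False using irrational by simp
  qed
  moreover have "(\<lambda>t. sin (\<tau> + \<nu> * t)) ` Z \<subseteq> {sin \<theta>, - sin \<theta>}" using Z_sin by auto
  ultimately have finZ: "finite Z" by (meson finite.emptyI finite.insertI finite_imageD finite_subset)

  have simple: "\<exists>d. d \<noteq> 0 \<and> (N has_vector_derivative d) (at t within {0..})" if t: "t \<in> Z" for t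
  proof -
    define A' where "A' = of_real a * (- of_real (\<kappa> * b * c) * (\<nu> *\<^sub>R (\<i> * cis (\<tau> + \<nu> * t))))"
    have dA: "((\<lambda>t. A (\<tau> + \<nu> * t)) has_vector_derivative A') (at t)"
      unfolding A_def A'_def has_vector_derivative_def
      by (rule derivative_eq_intros refl | simp)+ (simp add: scaleR_conv_of_real algebra_simps)
    obtain N' where dN: "(N has_vector_derivative N') (at t)"
    proof -
      have "\<exists>D. (N has_derivative D) (at t)"
        unfolding N_def A_def B_def by (rule exI) (rule derivative_eq_intros refl)+
      then show ?thesis using that by (metis differentiable_def vector_derivative_works)
    qed
    have "N' \<noteq> 0"
    proof
      assume N0: "N' = 0"
      (* Written through N, the difference of the squared moduli has a double zero wherever N and
         its derivative vanish; but its derivative at a zero of N is a nonzero multiple of sin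
         \<theta>. *)
      have gapt: "N u \<bullet> N u - 2 * (N u \<bullet> A (\<tau> + \<nu> * u)) = k * (cos (\<tau> + \<nu> * u) - cos \<theta>)" for u
      proof -
        have e: "norm (B (\<tau> + \<nu> * u)) = norm (N u - A (\<tau> + \<nu> * u))" by (simp add: N_def norm_mult)
        show ?thesis
          unfolding gap[symmetric] e power2_norm_eq_inner
          by (simp add: inner_diff_left inner_diff_right inner_commute)
      qed
      have "((\<lambda>u. N u \<bullet> N u - 2 * (N u \<bullet> A (\<tau> + \<nu> * u))) has_derivative
          (\<lambda>h. (N t \<bullet> (h *\<^sub>R N') + (h *\<^sub>R N') \<bullet> N t) - 2 * (N t \<bullet> (h *\<^sub>R A') + (h *\<^sub>R N') \<bullet> A (\<tau> + \<nu> * t)))) (at t)"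
        using dN dA unfolding has_vector_derivative_def
        by (intro has_derivative_diff has_derivative_inner has_derivative_mult_right)
      moreover have "N t = 0" using t by (simp add: Z_def)
      ultimately have "((\<lambda>u. k * (cos (\<tau> + \<nu> * u) - cos \<theta>)) has_real_derivative 0) (at t)"
        unfolding gapt N0 has_field_derivative_def by (simp add: mult_zero_left[abs_def])
      moreover have "((\<lambda>u. k * (cos (\<tau> + \<nu> * u) - cos \<theta>)) has_real_derivative k * (- sin (\<tau> + \<nu> * t) * \<nu>))
          (at t)"
        by (auto intro!: derivative_eq_intros)
      ultimately have "k * (- sin (\<tau> + \<nu> * t) * \<nu>) = 0" by (rule DERIV_unique[symmetric])
      then show False using Z_sin[OF t] sin\<theta> k \<nu> by auto
    qed
    then show ?thesis using dN has_vector_derivative_at_within by blast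
  qed
  have exists: "\<exists>\<phi>. arg_branch N \<phi>"
  proof (rule arg_branch_exists_simple_zeros[OF finZ])
    show "continuous_on {0..} N"
      unfolding N_def A_def B_def by (intro continuous_intros)
  qed (use simple in \<open>auto simp: Z_def\<close>)

  have "((\<lambda>t. \<phi> t / t) \<longlongrightarrow> \<omega> * \<theta> / pi + \<nu> * (Arg (B \<theta>) - Arg (A1 \<theta>)) / pi) at_top"
    if br: "arg_branch N \<phi>" for \<phi>
  proof -
    obtain r where r: "continuous_on {0..} \<phi>" "\<And>t. t \<ge> 0 \<Longrightarrow> N t = of_real (r t) * cis (\<phi> t)"
      using br unfolding arg_branch_def by blast
    obtain T0 where T0: "\<And>t. t \<in> Z \<Longrightarrow> t \<le> T0"
      using finZ by (meson bdd_above_def bdd_above_finite)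
    define T where "T = max 0 (T0 + 1)"
    have "((\<lambda>t. \<phi> t / t) \<longlongrightarrow> \<omega> * \<theta> / pi + \<nu> * (Arg (B \<theta>) - Arg (B (-\<theta>)) + Arg (A1 (2 * pi - \<theta>))
        - Arg (A1 \<theta>)) / (2 * pi)) at_top"
    proof (rule two_term_mean_motion[where A = A and B = B and r = r and T = T and \<alpha> = "\<lambda>x. Arg (A1 x)"
          and \<beta> = "\<lambda>x. Arg (B x)", OF \<nu> irrational \<theta>(1,2) periodic cont(1,2)])
      show "B x \<noteq> 0 \<and> norm (A x) \<le> norm (B x) \<and> B x = of_real (norm (B x)) * cis (Arg (B x))"
        if "x \<in> {-\<theta>..\<theta>}" for x
        using B_pos[OF that] BA[OF that] polar[of "B x"] by auto
      show "A x \<noteq> 0 \<and> norm (B x) \<le> norm (A x) \<and> A x = of_real (norm (A x)) * cis (Arg (A1 x))"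
        if "x \<in> {\<theta>..2 * pi - \<theta>}" for x
        using A1_nz AB[OF that] polar[of "A1 x"] pos by (simp add: A norm_mult mult.assoc)
      show "continuous_on {-\<theta>..\<theta>} (\<lambda>x. Arg (B x))"
        using B_pos by (intro continuous_intros continuous_on_subset[OF cont(2)]) auto
      show "continuous_on {\<theta>..2 * pi - \<theta>} (\<lambda>x. Arg (A1 x))"
        using A1_pos pos_Re_not_nonpos by (intro continuous_intros continuous_on_subset[OF cont(3)]) auto
      show "continuous_on {T..} \<phi>" by (rule continuous_on_subset[OF r(1)]) (auto simp: T_def)
      fix t assume t: "t \<ge> T"
      show "A (\<tau> + \<nu> * t) + cis (\<sigma> + \<omega> * t) * B (\<tau> + \<nu> * t) \<noteq> 0"
        using t T0[of t] by (auto simp: T_def Z_def N_def)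
      show "A (\<tau> + \<nu> * t) + cis (\<sigma> + \<omega> * t) * B (\<tau> + \<nu> * t) = of_real (r t) * cis (\<phi> t)"
        using t r(2)[of t] by (simp add: T_def N_def)
    qed
    moreover have "Arg (B (-\<theta>)) = - Arg (B \<theta>)"
    proof -
      have "B (-\<theta>) = cnj (B \<theta>)" by (simp add: B_def cis_cnj)
      moreover have "B \<theta> \<notin> \<real>" using pos sin\<theta> by (simp add: B_def complex_is_Real_iff)
      ultimately show ?thesis by (simp add: Arg_cnj)
    qed
    moreover have "Arg (A1 (2 * pi - \<theta>)) = - Arg (A1 \<theta>)"
    proof -
      have "A1 (2 * pi - \<theta>) = cnj (A1 \<theta>)" by (simp add: A1_def complex_eq_iff cos_diff sin_diff)
      moreover have "A1 \<theta> \<notin> \<real>" using pos sin\<theta> \<kappa> by (auto simp: A1_def complex_is_Real_iff)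
      ultimately show ?thesis by (simp add: Arg_cnj)
    qed
    moreover have "\<nu> * (x - - x + - y - y) / (2 * pi) = \<nu> * (x - y) / pi" for x y
      by (simp add: field_simps)
    ultimately show ?thesis by (simp only:)
  qed
  with exists show ?thesis
    unfolding has_asymptotic_angular_velocity_def N_def A1_def by simp
qed

section \<open>Frames and geodesics\<close>

fun curv :: "surface \<Rightarrow> real" where
  "curv Sphere = 1"
| "curv Hyperbolic_Plane = - 1"

fun gcos :: "surface \<Rightarrow> real \<Rightarrow> real" where
  "gcos Sphere = cos"
| "gcos Hyperbolic_Plane = cosh"

fun gsin :: "surface \<Rightarrow> real \<Rightarrow> real" where
  "gsin Sphere = sin"
| "gsin Hyperbolic_Plane = sinh"

lemma curv_cases: "curv S = 1 \<or> curv S = - 1"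
  by (cases S) auto

lemma curv_square [simp]: "curv S * curv S = 1" "(curv S)\<^sup>2 = 1"
  by (cases S; simp)+

lemma curv_mult_cancel [simp]: "curv S * (curv S * x) = x"
  by (cases S) auto

lemma gcos_gsin_square: "(gcos S t)\<^sup>2 + curv S * (gsin S t)\<^sup>2 = 1"
  by (cases S) (auto simp: cosh_square_eq)

lemma gcos_0 [simp]: "gcos S 0 = 1" and gsin_0 [simp]: "gsin S 0 = 0"
  by (cases S; simp)+

lemma gcos_deriv: "(gcos S has_real_derivative - curv S * gsin S t) (at t)"
  by (cases S) (auto intro!: derivative_eq_intros)

lemma gsin_deriv: "(gsin S has_real_derivative gcos S t) (at t)"
  by (cases S) (auto intro!: derivative_eq_intros)

lemma form_coords: "form S x y = x $ 1 * y $ 1 + x $ 2 * y $ 2 + curv S * (x $ 3 * y $ 3)"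
  by (cases S) (auto simp: inner_vec_def sum_3)

lemma form_linear:
  "form S (x + y) z = form S x z + form S y z" "form S z (x + y) = form S z x + form S z y"
  "form S (x - y) z = form S x z - form S y z" "form S z (x - y) = form S z x - form S z y"
  "form S (c *\<^sub>R x) z = c * form S x z" "form S z (c *\<^sub>R x) = c * form S z x"
  "form S (- x) z = - form S x z" "form S z (- x) = - form S z x"
  "form S 0 z = 0" "form S z 0 = 0"
  by (simp_all add: form_coords algebra_simps)

lemma form_commute: "form S x y = form S y x"
  by (simp add: form_coords mult.commute)

text \<open>
  Needed for the geodesic equation, where the acceleration is known only through its products with
  other vectors.
\<close>

lemma form_nondegenerate:
  assumes "\<And>w. form S d w = 0"
  shows "d = 0"
  using assms[of "axis 1 1"] assms[of "axis 2 1"] assms[of "axis 3 1"] curv_cases[of S]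
  by (auto simp: form_coords axis_def vec_eq_iff forall_3)

lemma points_form: "x \<in> points S \<Longrightarrow> form S x x = curv S"
  by (cases S) (auto simp: dot_square_norm)

lemma form_has_derivative:
  assumes "(u has_vector_derivative u') (at s)" "(v has_vector_derivative v') (at s)"
  shows "((\<lambda>s. form S (u s) (v s)) has_real_derivative (form S u' (v s) + form S (u s) v')) (at s)"
proof -
  have c: "((\<lambda>s. w s $ i) has_real_derivative w' $ i) (at s)"
    if "(w has_vector_derivative w') (at s)" for w :: "real \<Rightarrow> real^3" and w' i
    using bounded_linear.has_vector_derivative[OF bounded_linear_vec_nth that, of i]
    by (simp add: has_real_derivative_iff_has_vector_derivative)
  have m: "((\<lambda>s. u s $ i * v s $ i) has_real_derivative (u' $ i * v s $ i + v' $ i * u s $ i)) (at s)" for i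
    by (rule DERIV_mult[OF c[OF assms(1)] c[OF assms(2)]])
  show ?thesis
    unfolding form_coords
    using DERIV_add[OF DERIV_add[OF m[of 1] m[of 2]] DERIV_cmult[OF m[of 3], of "curv S"]]
    by (simp add: algebra_simps)
qed

lemma vector_linear_combination:
  fixes x e f :: "real^3"
  shows "(vector [a1 *\<^sub>R x + a2 *\<^sub>R e + a3 *\<^sub>R f, b1 *\<^sub>R x + b2 *\<^sub>R e + b3 *\<^sub>R f, c1 *\<^sub>R x + c2 *\<^sub>R e
      + c3 *\<^sub>R f] :: real^3^3)
      = (vector [vector [a1, a2, a3], vector [b1, b2, b3], vector [c1, c2, c3]] :: real^3^3) ** vector
          [x, e, f]"
  by (simp add: vec_eq_iff forall_3 matrix_matrix_mult_def sum_3)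

lemma det_vector_vector:
  "det (vector [vector [a1, a2, a3], vector [b1, b2, b3], vector [c1, c2, c3]] :: real^3^3)
      = a1 * (b2 * c3 - b3 * c2) - a2 * (b1 * c3 - b3 * c1) + a3 * (b1 * c2 - b2 * c1)"
  unfolding det_3 vector_3 by (simp only: algebra_simps)

text \<open>
  The matrix of the combinations is a product, so the orientation of vectors given in coordinates
  with respect to a frame is the sign of their coordinate determinant.
\<close>

lemma det_linear_combination:
  fixes x e f :: "real^3"
  shows "det (vector [a1 *\<^sub>R x + a2 *\<^sub>R e + a3 *\<^sub>R f, b1 *\<^sub>R x + b2 *\<^sub>R e + b3 *\<^sub>R f, c1 *\<^sub>R x + c2 *\<^sub>R e
      + c3 *\<^sub>R f] :: real^3^3)
    = (a1 * (b2 * c3 - b3 * c2) - a2 * (b1 * c3 - b3 * c1) + a3 * (b1 * c2 - b2 * c1))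
        * det (vector [x, e, f] :: real^3^3)"
  unfolding vector_linear_combination det_mul det_vector_vector ..

text \<open>
  The normalization of the determinant to \<open>\<epsilon>\<close> encodes, for \<open>\<epsilon>\<close> equal to \<open>1\<close> or \<open>- 1\<close>, that \<open>(e, f)\<close> is a positively oriented
  orthonormal basis of the tangent plane at \<open>x\<close>.
\<close>

definition frame :: "surface \<Rightarrow> real \<Rightarrow> real^3 \<Rightarrow> real^3 \<Rightarrow> real^3 \<Rightarrow> bool" where
  "frame S \<epsilon> x e f \<longleftrightarrow> x \<in> points S \<and> form S x e = 0 \<and> form S x f = 0 \<and> form S e f = 0
     \<and> form S e e = 1 \<and> form S f f = 1 \<and> det (vector [x, e, f] :: real^3^3) = \<epsilon>"

lemma frame_form:
  assumes "frame S \<epsilon> x e f"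
  shows "form S x x = curv S" "form S x e = 0" "form S x f = 0" "form S e f = 0" "form S e e = 1" "form S f f
      = 1"
    "form S e x = 0" "form S f x = 0" "form S f e = 0"
proof -
  show *: "form S x x = curv S" "form S x e = 0" "form S x f = 0" "form S e f = 0" "form S e e = 1" "form S f f
      = 1"
    using assms unfolding frame_def by (simp_all add: points_form)
  show "form S e x = 0" "form S f x = 0" "form S f e = 0"
    using * form_commute by metis+
qed

text \<open>
  Up to the sign \<open>\<epsilon>\<close>, the vector \<open>f\<close> is the cross product of \<open>x\<close> and \<open>e\<close>, with the third coordinate multiplied by the curvature so
  that Euclidean orthogonality becomes orthogonality for the form.
\<close>

lemma frame_exists:
  assumes "\<epsilon> = 1 \<or> \<epsilon> = - 1" "x \<in> points S" "e \<in> unit_tangent S x"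
  obtains f where "frame S \<epsilon> x e f"
proof
  define c1 where "c1 = x $ 2 * e $ 3 - x $ 3 * e $ 2"
  define c2 where "c2 = x $ 3 * e $ 1 - x $ 1 * e $ 3"
  define c3 where "c3 = x $ 1 * e $ 2 - x $ 2 * e $ 1"
  note c = c1_def c2_def c3_def
  define f :: "real^3" where "f = vector [\<epsilon> * c1, \<epsilon> * c2, \<epsilon> * curv S * c3]"
  have xe: "form S x x = curv S" "form S x e = 0" "form S e e = 1"
    using assms points_form by (auto simp: unit_tangent_def tangent_space_def)
  (* Lagrange's identity for the form. *)
  have "curv S * (form S x x * form S e e - (form S x e)\<^sup>2) = c1\<^sup>2 + c2\<^sup>2 + curv S * c3\<^sup>2"
    unfolding form_coords c by (cases S) (simp_all add: power2_eq_square algebra_simps)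
  then have norm: "c1\<^sup>2 + c2\<^sup>2 + curv S * c3\<^sup>2 = 1" by (simp add: xe)
  have \<epsilon>: "\<epsilon> * \<epsilon> = 1" using assms(1) by auto
  have "form S f f = (\<epsilon> * \<epsilon>) * (c1\<^sup>2 + c2\<^sup>2 + curv S * c3\<^sup>2)"
    unfolding form_coords f_def by (cases S) (simp_all add: power2_eq_square algebra_simps)
  moreover have "det (vector [x, e, f] :: real^3^3) = \<epsilon> * (c1\<^sup>2 + c2\<^sup>2 + curv S * c3\<^sup>2)"
    unfolding det_3 f_def c by (cases S) (simp_all add: power2_eq_square algebra_simps)
  moreover have "form S x f = 0" "form S e f = 0"
    unfolding form_coords f_def c by (cases S; simp add: algebra_simps)+
  ultimately show "frame S \<epsilon> x e f"
    using assms(2) xe norm \<epsilon> by (simp add: frame_def)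
qed

lemma frame_expansion:
  assumes fr: "frame S \<epsilon> x e f" and "\<epsilon> \<noteq> 0"
  shows "y = (curv S * form S y x) *\<^sub>R x + form S y e *\<^sub>R e + form S y f *\<^sub>R f"
proof -
  define d where "d = y - ((curv S * form S y x) *\<^sub>R x + form S y e *\<^sub>R e + form S y f *\<^sub>R f)"
  (* Multiplying the third coordinate by the curvature turns the form into the dot product. *)
  define g :: "real^3" where "g = vector [d $ 1, d $ 2, curv S * d $ 3]"
  have "form S d x = 0" "form S d e = 0" "form S d f = 0"
    unfolding d_def using frame_form[OF fr] by (simp_all add: form_linear mult_ac)
  then have "(vector [x, e, f] :: real^3^3) *v g = (vector [x, e, f] :: real^3^3) *v 0"
    by (simp add: vec_eq_iff forall_3 matrix_vector_mult_def sum_3 g_def form_coords mult_ac add_ac)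
  moreover have "inj ((*v) (vector [x, e, f] :: real^3^3))"
    using fr assms(2) unfolding frame_def by (simp flip: det_nz_iff_inj)
  ultimately have "g = 0" by (blast dest: injD)
  then have "d = 0" using curv_cases[of S] by (auto simp: g_def vec_eq_iff forall_3)
  then show ?thesis by (simp add: d_def)
qed

lemma frame_combination_form:
  assumes "frame S \<epsilon> x e f"
  shows "form S (a1 *\<^sub>R x + a2 *\<^sub>R e + a3 *\<^sub>R f) (b1 *\<^sub>R x + b2 *\<^sub>R e + b3 *\<^sub>R f)
      = curv S * a1 * b1 + a2 * b2 + a3 * b3"
  using frame_form[OF assms] by (simp add: form_linear)

lemma frame_rotate:
  assumes "frame S \<epsilon> x e f"
  shows "frame S \<epsilon> x (cos \<theta> *\<^sub>R e + sin \<theta> *\<^sub>R f) (- sin \<theta> *\<^sub>R e + cos \<theta> *\<^sub>R f)"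
proof -
  have "det (vector [1 *\<^sub>R x + 0 *\<^sub>R e + 0 *\<^sub>R f, 0 *\<^sub>R x + cos \<theta> *\<^sub>R e + sin \<theta> *\<^sub>R f, 0 *\<^sub>R x + (- sin \<theta>) *\<^sub>R e
      + cos \<theta> *\<^sub>R f] :: real^3^3)
      = ((cos \<theta>)\<^sup>2 + (sin \<theta>)\<^sup>2) * det (vector [x, e, f] :: real^3^3)"
    unfolding det_linear_combination by (simp add: power2_eq_square)
  then have "det (vector [x, cos \<theta> *\<^sub>R e + sin \<theta> *\<^sub>R f, (- sin \<theta>) *\<^sub>R e + cos \<theta> *\<^sub>R f] :: real^3^3) = \<epsilon>"
    using assms by (simp add: frame_def)
  moreover have "form S x (cos \<theta> *\<^sub>R e + sin \<theta> *\<^sub>R f) = 0" "form S x ((- sin \<theta>) *\<^sub>R e + cos \<theta> *\<^sub>R f) = 0"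
    "form S (cos \<theta> *\<^sub>R e + sin \<theta> *\<^sub>R f) ((- sin \<theta>) *\<^sub>R e + cos \<theta> *\<^sub>R f) = 0"
    "form S (cos \<theta> *\<^sub>R e + sin \<theta> *\<^sub>R f) (cos \<theta> *\<^sub>R e + sin \<theta> *\<^sub>R f) = 1"
    "form S ((- sin \<theta>) *\<^sub>R e + cos \<theta> *\<^sub>R f) ((- sin \<theta>) *\<^sub>R e + cos \<theta> *\<^sub>R f) = 1"
    using sin_cos_squared_add3[of \<theta>]
    by (simp_all only: form_linear frame_form[OF assms]) (simp_all add: add.commute)
  moreover have "x \<in> points S" using assms unfolding frame_def by (rule conjunct1)
  ultimately show ?thesis
    unfolding frame_def by (intro conjI)
qed

lemma quarter_turn_frame:
  assumes \<epsilon>: "\<epsilon> = 1 \<or> \<epsilon> = - 1" and fr: "frame S \<epsilon> x e f"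
  shows "quarter_turn S \<epsilon> x e = f"
  unfolding quarter_turn_def
proof (rule the_equality)
  show "f \<in> unit_tangent S x \<and> form S e f = 0 \<and> positively_oriented \<epsilon> x e f"
    using \<epsilon> fr by (auto simp: frame_def unit_tangent_def tangent_space_def positively_oriented_def)
  fix w assume w: "w \<in> unit_tangent S x \<and> form S e w = 0 \<and> positively_oriented \<epsilon> x e w"
  then have w0: "form S w x = 0" "form S w e = 0" "form S w w = 1" "\<epsilon> * det (vector [x, e, w] :: real^3^3) > 0"
    by (auto simp: unit_tangent_def tangent_space_def positively_oriented_def form_commute)
  define c where "c = form S w f"
  have wc: "w = c *\<^sub>R f" using frame_expansion[OF fr, of w] \<epsilon> w0 by (auto simp: c_def)
  then have "c * c = 1" using w0(3) frame_form[OF fr] by (simp add: form_linear)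
  moreover have "det (vector [1 *\<^sub>R x + 0 *\<^sub>R e + 0 *\<^sub>R f, 0 *\<^sub>R x + 1 *\<^sub>R e + 0 *\<^sub>R f, 0 *\<^sub>R x + 0 *\<^sub>R e
      + c *\<^sub>R f] :: real^3^3) = c * \<epsilon>"
    unfolding det_linear_combination using fr by (simp add: frame_def)
  then have "\<epsilon> * (c * \<epsilon>) > 0" using w0(4) wc by simp
  then have "c > 0" using \<epsilon> by auto
  ultimately have "c = 1" by (auto simp: square_eq_1_iff)
  then show "w = f" using wc by simp
qed

definition geodesic_line :: "surface \<Rightarrow> real^3 \<Rightarrow> real^3 \<Rightarrow> real \<Rightarrow> real^3" where
  "geodesic_line S x v s = gcos S s *\<^sub>R x + gsin S s *\<^sub>R v"

definition geodesic_line_velocity :: "surface \<Rightarrow> real^3 \<Rightarrow> real^3 \<Rightarrow> real \<Rightarrow> real^3" where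
  "geodesic_line_velocity S x v s = (- curv S * gsin S s) *\<^sub>R x + gcos S s *\<^sub>R v"

lemma geodesic_line_0 [simp]: "geodesic_line S x v 0 = x" "geodesic_line_velocity S x v 0 = v"
  by (simp_all add: geodesic_line_def geodesic_line_velocity_def)

lemma geodesic_line_deriv:
  "(geodesic_line S x v has_vector_derivative geodesic_line_velocity S x v s) (at s)"
  "(geodesic_line_velocity S x v has_vector_derivative - curv S *\<^sub>R geodesic_line S x v s) (at s)"
proof -
  show "(geodesic_line S x v has_vector_derivative geodesic_line_velocity S x v s) (at s)"
    unfolding geodesic_line_def[abs_def] geodesic_line_velocity_def
    by (rule derivative_eq_intros gcos_deriv gsin_deriv refl)+ simp
  have "((\<lambda>s. (- curv S * gsin S s) *\<^sub>R x + gcos S s *\<^sub>R v) has_vector_derivative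
      (- curv S * gcos S s) *\<^sub>R x + (- curv S * gsin S s) *\<^sub>R v) (at s)"
    by (auto intro!: derivative_eq_intros gcos_deriv gsin_deriv)
  then show "(geodesic_line_velocity S x v has_vector_derivative - curv S *\<^sub>R geodesic_line S x v s) (at s)"
    by (simp add: geodesic_line_def geodesic_line_velocity_def[abs_def] algebra_simps)
qed

lemma velocity_geodesic_line [simp]: "velocity (geodesic_line S x v) s = geodesic_line_velocity S x v s"
  by (rule vector_derivative_at) (rule geodesic_line_deriv)

lemma geodesic_line_form:
  assumes "x \<in> points S" "v \<in> unit_tangent S x"
  shows "form S (geodesic_line S x v s) (geodesic_line S x v s) = curv S"
    "form S (geodesic_line S x v s) (geodesic_line_velocity S x v s) = 0"
    "form S (geodesic_line_velocity S x v s) (geodesic_line_velocity S x v s) = 1"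
proof -
  have f: "form S x x = curv S" "form S x v = 0" "form S v x = 0" "form S v v = 1"
    using assms points_form by (auto simp: unit_tangent_def tangent_space_def form_commute)
  note g = gcos_gsin_square[of S s, unfolded power2_eq_square]
  show "form S (geodesic_line S x v s) (geodesic_line S x v s) = curv S"
    using f g by (cases S) (simp_all add: geodesic_line_def form_linear del: form.simps)
  show "form S (geodesic_line S x v s) (geodesic_line_velocity S x v s) = 0"
    using f g by (cases S) (simp_all add: geodesic_line_def geodesic_line_velocity_def form_linear del:
        form.simps)
  show "form S (geodesic_line_velocity S x v s) (geodesic_line_velocity S x v s) = 1"
    using f g by (cases S) (simp_all add: geodesic_line_def geodesic_line_velocity_def form_linear del:
        form.simps)
qed

text \<open>
  Cauchy--Schwarz in the first two coordinates. It keeps geodesics on the upper sheet.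
\<close>

lemma hyperboloid_tangent_bound:
  assumes "x \<in> points Hyperbolic_Plane" "v \<in> unit_tangent Hyperbolic_Plane x"
  shows "\<bar>v $ 3\<bar> < x $ 3"
proof -
  have x: "(x $ 3)\<^sup>2 = 1 + ((x $ 1)\<^sup>2 + (x $ 2)\<^sup>2)" "x $ 3 > 0"
    using assms(1) by (auto simp: power2_eq_square)
  have v: "x $ 3 * v $ 3 = x $ 1 * v $ 1 + x $ 2 * v $ 2" "(v $ 1)\<^sup>2 + (v $ 2)\<^sup>2 = 1 + (v $ 3)\<^sup>2"
    using assms(2) by (auto simp: power2_eq_square unit_tangent_def tangent_space_def)
  have "(x $ 1 * v $ 1 + x $ 2 * v $ 2)\<^sup>2 + (x $ 1 * v $ 2 - x $ 2 * v $ 1)\<^sup>2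
      = ((x $ 1)\<^sup>2 + (x $ 2)\<^sup>2) * ((v $ 1)\<^sup>2 + (v $ 2)\<^sup>2)"
    by (simp add: power2_eq_square algebra_simps)
  then have "(x $ 3 * v $ 3)\<^sup>2 \<le> ((x $ 3)\<^sup>2 - 1) * (1 + (v $ 3)\<^sup>2)"
    unfolding v x by (smt (verit) zero_le_power2)
  then have "(v $ 3)\<^sup>2 < (x $ 3)\<^sup>2" by (simp add: power_mult_distrib algebra_simps)
  then show ?thesis using x(2) power_less_imp_less_base[of "\<bar>v $ 3\<bar>" 2 "x $ 3"] by simp
qed

lemma geodesic_line_points:
  assumes "x \<in> points S" "v \<in> unit_tangent S x"
  shows "geodesic_line S x v s \<in> points S"
proof (cases S)
  case Sphere
  then show ?thesis using geodesic_line_form(1)[OF assms, of s] by (simp add: norm_eq_1)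
next
  case Hyperbolic_Plane
  have "\<bar>sinh s\<bar> < cosh s"
    using sinh_less_cosh_real[of s] sinh_less_cosh_real[of "- s"] by auto
  then have "\<bar>sinh s * v $ 3\<bar> \<le> cosh s * \<bar>v $ 3\<bar>"
    unfolding abs_mult by (intro mult_right_mono) auto
  also have "\<dots> < cosh s * x $ 3"
    using hyperboloid_tangent_bound[of x v] assms Hyperbolic_Plane by (intro mult_strict_left_mono) auto
  finally have "geodesic_line S x v s $ 3 > 0" by (simp add: Hyperbolic_Plane geodesic_line_def)
  then show ?thesis using geodesic_line_form(1)[OF assms, of s] Hyperbolic_Plane by simp
qed

lemma geodesic_line_unit_speed:
  assumes "x \<in> points S" "v \<in> unit_tangent S x"
  shows "unit_speed_geodesic S (geodesic_line S x v)" "geodesic S (geodesic_line S x v)"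
    "geodesic_line_velocity S x v s \<in> unit_tangent S (geodesic_line S x v s)"
proof -
  show vel: "geodesic_line_velocity S x v s \<in> unit_tangent S (geodesic_line S x v s)" for s
    using geodesic_line_form[OF assms] by (simp add: unit_tangent_def tangent_space_def)
  show "geodesic S (geodesic_line S x v)"
    unfolding geodesic_def
  proof (intro conjI exI allI)
    show "range (geodesic_line S x v) \<subseteq> points S" using geodesic_line_points[OF assms] by auto
    show "(geodesic_line S x v has_vector_derivative geodesic_line_velocity S x v s) (at s)"
      "(geodesic_line_velocity S x v has_vector_derivative - curv S *\<^sub>R geodesic_line S x v s) (at s)" for s
      by (rule geodesic_line_deriv)+
    show "\<forall>w\<in>tangent_space S (geodesic_line S x v s). form S (- curv S *\<^sub>R geodesic_line S x v s) w = 0" for s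
      by (simp add: tangent_space_def form_linear)
  qed
  then show "unit_speed_geodesic S (geodesic_line S x v)"
    using vel by (simp add: unit_speed_geodesic_def)
qed

text \<open>
  Normality of the acceleration forces \<open>\<gamma>'' = - curv S *\<^sub>R \<gamma>\<close>: its component along \<open>\<gamma>\<close> is determined by
  differentiating twice that \<open>form S \<gamma> \<gamma>\<close> is constant. Variation of constants then solves
  this linear equation.
\<close>

lemma geodesic_eq_geodesic_line:
  assumes geo: "geodesic S \<gamma>" and unit: "velocity \<gamma> 0 \<in> unit_tangent S (\<gamma> 0)"
  shows "\<gamma> = geodesic_line S (\<gamma> 0) (velocity \<gamma> 0)"
proof -
  obtain \<gamma>' \<gamma>'' where pt: "\<And>s. \<gamma> s \<in> points S"
    and d1: "\<And>s. (\<gamma> has_vector_derivative \<gamma>' s) (at s)"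
    and d2: "\<And>s. (\<gamma>' has_vector_derivative \<gamma>'' s) (at s)"
    and normal: "\<And>s w. form S (\<gamma> s) w = 0 \<Longrightarrow> form S (\<gamma>'' s) w = 0"
    using geo unfolding geodesic_def tangent_space_def by blast
  have vel: "velocity \<gamma> s = \<gamma>' s" for s using d1 by (rule vector_derivative_at)
  have k: "form S (\<gamma> s) (\<gamma> s) = curv S" for s using points_form[OF pt] .
  have orth: "form S (\<gamma> s) (\<gamma>' s) = 0" for s
  proof -
    have "((\<lambda>s. form S (\<gamma> s) (\<gamma> s)) has_real_derivative (form S (\<gamma>' s) (\<gamma> s) + form S (\<gamma> s) (\<gamma>' s))) (at s)"
      by (rule form_has_derivative d1)+
    then have "form S (\<gamma>' s) (\<gamma> s) + form S (\<gamma> s) (\<gamma>' s) = 0"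
      unfolding k by (rule DERIV_unique) (rule DERIV_const)
    then show ?thesis by (simp add: form_commute)
  qed
  have acc: "form S (\<gamma>'' s) (\<gamma> s) = - form S (\<gamma>' s) (\<gamma>' s)" for s
  proof -
    have "((\<lambda>s. form S (\<gamma> s) (\<gamma>' s)) has_real_derivative (form S (\<gamma>' s) (\<gamma>' s) + form S (\<gamma> s) (\<gamma>'' s))) (at s)"
      by (rule form_has_derivative d1 d2)+
    then have "form S (\<gamma>' s) (\<gamma>' s) + form S (\<gamma> s) (\<gamma>'' s) = 0"
      unfolding orth by (rule DERIV_unique) (rule DERIV_const)
    then show ?thesis by (simp add: form_commute)
  qed
  have speed: "form S (\<gamma>' s) (\<gamma>' s) = 1" for s
  proof -
    have "((\<lambda>s. form S (\<gamma>' s) (\<gamma>' s)) has_real_derivative 0) (at s)" for s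
    proof -
      have "form S (\<gamma>'' s) (\<gamma>' s) = 0" using normal orth by blast
      then show ?thesis
        using form_has_derivative[OF d2 d2, of S s] by (simp add: form_commute)
    qed
    then have "form S (\<gamma>' s) (\<gamma>' s) = form S (\<gamma>' 0) (\<gamma>' 0)"
      using DERIV_isconst_all by blast
    then show ?thesis using unit by (simp add: vel unit_tangent_def)
  qed
  have ode: "\<gamma>'' s = - curv S *\<^sub>R \<gamma> s" for s
  proof -
    have "form S (\<gamma>'' s + curv S *\<^sub>R \<gamma> s) w = 0" for w
    proof -
      define w' where "w' = w - (curv S * form S (\<gamma> s) w) *\<^sub>R \<gamma> s"
      have "form S (\<gamma> s) w' = 0" by (simp add: w'_def form_linear k)
      then have "form S (\<gamma>'' s + curv S *\<^sub>R \<gamma> s) w' = 0" using normal by (simp add: form_linear)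
      moreover have "form S (\<gamma>'' s + curv S *\<^sub>R \<gamma> s) (\<gamma> s) = 0"
        using acc speed k by (simp add: form_linear)
      moreover have "w = w' + (curv S * form S (\<gamma> s) w) *\<^sub>R \<gamma> s" by (simp add: w'_def)
      ultimately show ?thesis by (metis form_linear(2,6) add.right_neutral mult_zero_right)
    qed
    then have "\<gamma>'' s + curv S *\<^sub>R \<gamma> s = 0" by (rule form_nondegenerate)
    then show ?thesis by (simp add: add_eq_0_iff)
  qed
  (* The two constants of integration of the linear equation. *)
  have u: "gcos S s *\<^sub>R \<gamma> s - gsin S s *\<^sub>R \<gamma>' s = \<gamma> 0" for s
  proof -
    have "((\<lambda>s. gcos S s *\<^sub>R \<gamma> s - gsin S s *\<^sub>R \<gamma>' s) has_vector_derivative 0) (at s within UNIV)" for s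
      by (rule derivative_eq_intros gcos_deriv gsin_deriv d1 d2 refl)+ (simp add: ode algebra_simps)
    then obtain c where "\<And>s. gcos S s *\<^sub>R \<gamma> s - gsin S s *\<^sub>R \<gamma>' s = c"
      using has_vector_derivative_zero_constant[of UNIV "\<lambda>s. gcos S s *\<^sub>R \<gamma> s - gsin S s *\<^sub>R \<gamma>' s"] by auto
    from this[of s] this[of 0] show ?thesis by simp
  qed
  have v: "(curv S * gsin S s) *\<^sub>R \<gamma> s + gcos S s *\<^sub>R \<gamma>' s = \<gamma>' 0" for s
  proof -
    have "((\<lambda>s. (curv S * gsin S s) *\<^sub>R \<gamma> s + gcos S s *\<^sub>R \<gamma>' s) has_vector_derivative 0) (at s within UNIV)"
        for s
      by (rule derivative_eq_intros gcos_deriv gsin_deriv d1 d2 refl)+ (simp add: ode algebra_simps)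
    then obtain c where "\<And>s. (curv S * gsin S s) *\<^sub>R \<gamma> s + gcos S s *\<^sub>R \<gamma>' s = c"
      using has_vector_derivative_zero_constant[of UNIV "\<lambda>s. (curv S * gsin S s) *\<^sub>R \<gamma> s + gcos S s *\<^sub>R \<gamma>' s"]
          by auto
    from this[of s] this[of 0] show ?thesis by simp
  qed
  show ?thesis
  proof
    fix s
    have "geodesic_line S (\<gamma> 0) (velocity \<gamma> 0) s
        = gcos S s *\<^sub>R (gcos S s *\<^sub>R \<gamma> s - gsin S s *\<^sub>R \<gamma>' s)
            + gsin S s *\<^sub>R ((curv S * gsin S s) *\<^sub>R \<gamma> s + gcos S s *\<^sub>R \<gamma>' s)"
      unfolding u v by (simp add: geodesic_line_def vel)
    also have "\<dots> = ((gcos S s)\<^sup>2 + curv S * (gsin S s)\<^sup>2) *\<^sub>R \<gamma> s"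
      by (simp add: power2_eq_square algebra_simps)
    finally show "\<gamma> s = geodesic_line S (\<gamma> 0) (velocity \<gamma> 0) s" by (simp add: gcos_gsin_square)
  qed
qed

lemma geodesic_from_eq_geodesic_line:
  assumes "x \<in> points S" "v \<in> unit_tangent S x"
  shows "geodesic_from S x v = geodesic_line S x v"
  unfolding geodesic_from_def
proof (rule the_equality)
  show "geodesic S (geodesic_line S x v) \<and> geodesic_line S x v 0 = x \<and> velocity (geodesic_line S x v) 0 = v"
    using geodesic_line_unit_speed[OF assms] by simp
  show "\<gamma> = geodesic_line S x v" if "geodesic S \<gamma> \<and> \<gamma> 0 = x \<and> velocity \<gamma> 0 = v" for \<gamma>
    using geodesic_eq_geodesic_line[of S \<gamma>] that assms by auto
qed

text \<open>
  The normal field \<open>f\<close> of a geodesic is constant in the ambient space, since the geodesic stays in the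
  plane of its initial point and direction.
\<close>

lemma frame_transport:
  assumes fr: "frame S \<epsilon> x e f"
  shows "frame S \<epsilon> (geodesic_line S x e l) (geodesic_line_velocity S x e l) f"
proof -
  have xe: "x \<in> points S" "e \<in> unit_tangent S x"
    using fr by (auto simp: frame_def unit_tangent_def tangent_space_def)
  have "det (vector [gcos S l *\<^sub>R x + gsin S l *\<^sub>R e + 0 *\<^sub>R f, (- curv S * gsin S l) *\<^sub>R x + gcos S l *\<^sub>R e
      + 0 *\<^sub>R f,
      0 *\<^sub>R x + 0 *\<^sub>R e + 1 *\<^sub>R f] :: real^3^3)
      = ((gcos S l)\<^sup>2 + curv S * (gsin S l)\<^sup>2) * det (vector [x, e, f] :: real^3^3)"
    unfolding det_linear_combination by (simp add: power2_eq_square algebra_simps)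
  then have "det (vector [geodesic_line S x e l, geodesic_line_velocity S x e l, f] :: real^3^3) = \<epsilon>"
    using fr unfolding gcos_gsin_square by (simp add: frame_def geodesic_line_def geodesic_line_velocity_def)
  then show ?thesis
    using geodesic_line_points[OF xe] geodesic_line_form[OF xe] frame_form[OF fr]
    unfolding frame_def by (simp add: geodesic_line_def geodesic_line_velocity_def form_linear)
qed

lemma arm_end_step:
  fixes \<theta> :: real
  assumes \<epsilon>: "\<epsilon> = 1 \<or> \<epsilon> = - 1" and fr: "frame S \<epsilon> x e f"
  defines "e' \<equiv> cos \<theta> *\<^sub>R e + sin \<theta> *\<^sub>R f"
  shows "arm_end S \<epsilon> x e ((l, \<theta>) # joints) = arm_end S \<epsilon> (geodesic_line S x e' l)
      (geodesic_line_velocity S x e' l) joints"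
proof -
  have "frame S \<epsilon> x e' (- sin \<theta> *\<^sub>R e + cos \<theta> *\<^sub>R f)" unfolding e'_def by (rule frame_rotate[OF fr])
  then have "x \<in> points S" "e' \<in> unit_tangent S x"
    by (auto simp: frame_def unit_tangent_def tangent_space_def)
  then show ?thesis
    using quarter_turn_frame[OF \<epsilon> fr] by (simp add: turn_def geodesic_from_eq_geodesic_line e'_def)
qed

section \<open>Stereographic coordinates of the arm\<close>

text \<open>
  The radius in the stereographic coordinate of a point at distance \<open>l\<close> from the centre; hence the
  half angle.
\<close>

fun gtan :: "surface \<Rightarrow> real \<Rightarrow> real" where
  "gtan Sphere l = tan (l / 2)"
| "gtan Hyperbolic_Plane l = tanh (l / 2)"

text \<open>
  The distances at which stereographic projection from the antipode of the centre is defined.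
\<close>

definition admissible :: "surface \<Rightarrow> real \<Rightarrow> bool" where
  "admissible S l \<longleftrightarrow> 0 \<le> l \<and> (S = Sphere \<longrightarrow> l < pi)"

lemma gtan_0 [simp]: "gtan S 0 = 0"
  by (cases S) auto

lemma gtan_strict_mono:
  assumes "0 \<le> a" "a < b" "admissible S b"
  shows "gtan S a < gtan S b"
  using assms by (cases S) (auto simp: admissible_def intro: tan_monotone)

lemma gtan_nonneg: "admissible S a \<Longrightarrow> 0 \<le> gtan S a"
  using gtan_strict_mono[of 0 a S] by (cases "a = 0") (auto simp: admissible_def)

lemma gtan_mono: "0 \<le> a \<Longrightarrow> a \<le> b \<Longrightarrow> admissible S b \<Longrightarrow> gtan S a \<le> gtan S b"
  using gtan_strict_mono[of a b S] by (cases "a = b") auto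

lemma gtan_conformal_pos:
  assumes "admissible S R" "cmod w \<le> gtan S R"
  shows "1 + curv S * (cmod w)\<^sup>2 > 0"
proof (cases S)
  case Hyperbolic_Plane
  have "cmod w < 1" using assms Hyperbolic_Plane tanh_real_lt_1[of "R / 2"] by simp
  then have "(cmod w)\<^sup>2 < 1" by (simp add: abs_square_less_1)
  then show ?thesis using Hyperbolic_Plane by simp
qed (auto intro: add_pos_nonneg)

lemma gcos_gsin_gtan:
  assumes "admissible S l"
  shows "gcos S l = (1 - curv S * (gtan S l)\<^sup>2) / (1 + curv S * (gtan S l)\<^sup>2)"
    "gsin S l = 2 * gtan S l / (1 + curv S * (gtan S l)\<^sup>2)"
proof -
  have "gcos S l = (1 - curv S * (gtan S l)\<^sup>2) / (1 + curv S * (gtan S l)\<^sup>2) \<and>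
    gsin S l = 2 * gtan S l / (1 + curv S * (gtan S l)\<^sup>2)"
  proof (cases S)
    case Sphere
    define h where "h = l / 2"
    have l: "l = 2 * h" by (simp add: h_def)
    have c: "cos h > 0" using assms Sphere by (intro cos_gt_zero_pi) (auto simp: admissible_def h_def)
    have d: "1 + (tan h)\<^sup>2 = 1 / (cos h)\<^sup>2"
      using c sin_cos_squared_add[of h] by (simp add: tan_def field_simps)
    have "cos l = (1 - (tan h)\<^sup>2) * (cos h)\<^sup>2" "sin l = 2 * tan h * (cos h)\<^sup>2"
      using c unfolding l cos_double sin_double by (simp_all add: tan_def field_simps power2_eq_square)
    then show ?thesis using d c by (simp add: Sphere h_def)
  next
    case Hyperbolic_Plane
    define h where "h = l / 2"
    have l: "l = 2 * h" by (simp add: h_def)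
    have c: "cosh h > 0" by simp
    have d: "1 - (tanh h)\<^sup>2 = 1 / (cosh h)\<^sup>2"
    proof -
      have "1 - (tanh h)\<^sup>2 = ((cosh h)\<^sup>2 - (sinh h)\<^sup>2) / (cosh h)\<^sup>2"
        using c by (simp add: tanh_def power_divide diff_divide_distrib)
      then show ?thesis by (simp only: hyperbolic_pythagoras)
    qed
    have "cosh l = (1 + (tanh h)\<^sup>2) * (cosh h)\<^sup>2" "sinh l = 2 * tanh h * (cosh h)\<^sup>2"
      using c unfolding l cosh_double sinh_double by (simp_all add: tanh_def field_simps power2_eq_square)
    then show ?thesis using d c by (simp add: Hyperbolic_Plane h_def)
  qed
  then show "gcos S l = (1 - curv S * (gtan S l)\<^sup>2) / (1 + curv S * (gtan S l)\<^sup>2)"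
    "gsin S l = 2 * gtan S l / (1 + curv S * (gtan S l)\<^sup>2)" by auto
qed

lemma gtan_add:
  assumes "0 \<le> a" "0 \<le> b" "admissible S (a + b)"
  shows "gtan S a * gtan S b < 1" "gtan S (a + b) * (1 - curv S * gtan S a * gtan S b) = gtan S a + gtan S b"
proof -
  have "gtan S a * gtan S b < 1 \<and> gtan S (a + b) * (1 - curv S * gtan S a * gtan S b) = gtan S a + gtan S b"
  proof (cases S)
    case Sphere
    have c: "cos (a / 2) > 0" "cos (b / 2) > 0" "cos ((a + b) / 2) > 0"
      using assms Sphere by (auto intro!: cos_gt_zero_pi simp: admissible_def)
    have e: "cos ((a + b) / 2) = cos (a / 2) * cos (b / 2) - sin (a / 2) * sin (b / 2)"
      "sin ((a + b) / 2) = sin (a / 2) * cos (b / 2) + cos (a / 2) * sin (b / 2)"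
      by (simp_all add: add_divide_distrib cos_add sin_add)
    have tt: "tan (a / 2) * tan (b / 2) = 1 - cos ((a + b) / 2) / (cos (a / 2) * cos (b / 2))"
      using c(1,2) unfolding e tan_def by (simp add: field_simps)
    have "tan (a / 2) * tan (b / 2) < 1" unfolding tt using c by simp
    moreover have "tan ((a + b) / 2) * (1 - tan (a / 2) * tan (b / 2)) = tan (a / 2) + tan (b / 2)"
    proof -
      have "tan ((a + b) / 2) * (cos ((a + b) / 2) / (cos (a / 2) * cos (b / 2)))
          = sin ((a + b) / 2) / (cos (a / 2) * cos (b / 2))"
        using c by (simp add: tan_def)
      also have "\<dots> = tan (a / 2) + tan (b / 2)" using c(1,2) unfolding e tan_def by (simp add: field_simps)
      finally show ?thesis using tt by simp
    qed
    ultimately show ?thesis using Sphere by simp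
  next
    case Hyperbolic_Plane
    have c: "cosh (a / 2) > 0" "cosh (b / 2) > 0" "cosh ((a + b) / 2) > 0" by auto
    have e: "cosh ((a + b) / 2) = cosh (a / 2) * cosh (b / 2) + sinh (a / 2) * sinh (b / 2)"
      "sinh ((a + b) / 2) = sinh (a / 2) * cosh (b / 2) + cosh (a / 2) * sinh (b / 2)"
      by (simp_all add: add_divide_distrib cosh_add sinh_add)
    have "tanh (a / 2) * tanh (b / 2) < 1 * 1"
      using assms by (intro mult_strict_mono') (auto simp: tanh_real_lt_1)
    moreover have "1 + tanh (a / 2) * tanh (b / 2) = cosh ((a + b) / 2) / (cosh (a / 2) * cosh (b / 2))"
      using c(1,2) unfolding e tanh_def by (simp add: field_simps)
    moreover have "tanh ((a + b) / 2) * (cosh ((a + b) / 2) / (cosh (a / 2) * cosh (b / 2)))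
        = tanh (a / 2) + tanh (b / 2)"
    proof -
      have "tanh ((a + b) / 2) * (cosh ((a + b) / 2) / (cosh (a / 2) * cosh (b / 2)))
          = sinh ((a + b) / 2) / (cosh (a / 2) * cosh (b / 2))"
        using c by (simp add: tanh_def)
      also have "\<dots> = tanh (a / 2) + tanh (b / 2)" using c(1,2) unfolding e tanh_def by (simp add: field_simps)
      finally show ?thesis .
    qed
    ultimately show ?thesis using Hyperbolic_Plane by simp
  qed
  then show "gtan S a * gtan S b < 1" "gtan S (a + b) * (1 - curv S * gtan S a * gtan S b)
      = gtan S a + gtan S b" by auto
qed

lemma gtan_surj:
  assumes "r \<ge> 0" "1 + curv S * r\<^sup>2 > 0"
  obtains s where "admissible S s" "gtan S s = r"
proof (cases S)
  case Sphere
  show ?thesis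
  proof
    show "admissible S (2 * arctan r)" "gtan S (2 * arctan r) = r"
      using assms arctan_ubound[of r] Sphere by (auto simp: admissible_def tan_arctan)
  qed
next
  case Hyperbolic_Plane
  have "r < 1" using assms Hyperbolic_Plane by (simp add: abs_square_less_1)
  define y where "y = ln ((1 + r) / (1 - r)) / 2"
  have "exp (- 2 * y) = (1 - r) / (1 + r)"
    using \<open>r < 1\<close> assms(1) by (simp add: y_def exp_minus)
  then have "tanh y = (1 - (1 - r) / (1 + r)) / (1 + (1 - r) / (1 + r))"
    using tanh_real_altdef[of y] by simp
  also have "\<dots> = r" using assms(1) by (simp add: field_simps)
  finally have y: "r = tanh y" by (rule sym)
  then have "y \<ge> 0" using assms(1) by simp
  show ?thesis
  proof
    show "admissible S (2 * y)" "gtan S (2 * y) = r"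
      using y \<open>y \<ge> 0\<close> Hyperbolic_Plane by (auto simp: admissible_def)
  qed
qed

text \<open>
  The inverse of stereographic projection, centred at \<open>x\<close> with axes \<open>e\<close> and \<open>f\<close>.
\<close>

definition stereo :: "surface \<Rightarrow> real^3 \<Rightarrow> real^3 \<Rightarrow> real^3 \<Rightarrow> complex \<Rightarrow> real^3" where
  "stereo S x e f w = (let d = 1 + curv S * (cmod w)\<^sup>2 in
     ((1 - curv S * (cmod w)\<^sup>2) / d) *\<^sub>R x + (2 * Re w / d) *\<^sub>R e + (2 * Im w / d) *\<^sub>R f)"

text \<open>
  The translation by the length of \<open>gtan\<close>-value \<open>t\<close> along the real axis, in stereographic coordinates.
\<close>

definition mobius :: "surface \<Rightarrow> real \<Rightarrow> complex \<Rightarrow> complex" where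
  "mobius S t w = (w + of_real t) / (1 - of_real (curv S * t) * w)"

lemma stereo_0 [simp]: "stereo S x e f 0 = x"
  by (simp add: stereo_def)

lemma stereo_rotate:
  "stereo S x (cos \<theta> *\<^sub>R e + sin \<theta> *\<^sub>R f) (- sin \<theta> *\<^sub>R e + cos \<theta> *\<^sub>R f) w = stereo S x e f (cis \<theta> * w)"
  by (simp add: stereo_def Let_def norm_mult scaleR_add_right scaleR_add_left diff_divide_distrib
      add_divide_distrib
      right_diff_distrib distrib_left scaleR_diff_left scaleR_diff_right mult.commute mult.left_commute)

text \<open>
  Translations are isometries: this is the invariance of the conformal factor.
\<close>

lemma mobius_conformal:
  assumes "1 - of_real (curv S * t) * w \<noteq> 0"
  shows "1 + curv S * (cmod (mobius S t w))\<^sup>2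
    = (1 + curv S * (cmod w)\<^sup>2) * (1 + curv S * t\<^sup>2) / (cmod (1 - of_real (curv S * t) * w))\<^sup>2"
proof -
  have "(cmod (1 - of_real (curv S * t) * w))\<^sup>2 + curv S * (cmod (w + of_real t))\<^sup>2
      = (1 + curv S * (cmod w)\<^sup>2) * (1 + curv S * t\<^sup>2)"
    unfolding cmod_power2 by (cases S) (simp_all add: power2_eq_square algebra_simps)
  moreover have "(cmod (1 - of_real (curv S * t) * w))\<^sup>2 \<noteq> 0" using assms by simp
  ultimately show ?thesis
    unfolding mobius_def norm_divide power_divide by (simp add: field_simps)
qed

lemma mobius_Re_Im:
  "Re (mobius S t w) = (Re w * (1 - curv S * t\<^sup>2)
      + t * (1 - curv S * (cmod w)\<^sup>2)) / (cmod (1 - of_real (curv S * t) * w))\<^sup>2"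
  "Im (mobius S t w) = Im w * (1 + curv S * t\<^sup>2) / (cmod (1 - of_real (curv S * t) * w))\<^sup>2"
  unfolding mobius_def Re_divide Im_divide cmod_power2
  by (cases S; simp add: power2_eq_square algebra_simps)+

text \<open>
  A point with coordinate \<open>w\<close> seen from the end of a joint has the translated coordinate seen from its
  start. All coefficients become rational functions of the half-length parameter \<open>gtan S l\<close>.
\<close>

lemma stereo_transport:
  assumes l: "admissible S l" and nz: "1 + curv S * (cmod w)\<^sup>2 \<noteq> 0" "1 - of_real (curv S * gtan S l) * w \<noteq> 0"
  shows "stereo S (geodesic_line S x e l) (geodesic_line_velocity S x e l) f w
      = stereo S x e f (mobius S (gtan S l) w)"
proof -
  define t where "t = gtan S l"
  define h where "h = 1 + curv S * t\<^sup>2"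
  define n where "n = (cmod w)\<^sup>2"
  define d where "d = 1 + curv S * n"
  define E where "E = (cmod (1 - of_real (curv S * t) * w))\<^sup>2"
  define m where "m = mobius S t w"
  have h: "h > 0" using gtan_conformal_pos[OF l, of "of_real t"] gtan_nonneg[OF l] by (simp add: t_def h_def)
  have d: "d \<noteq> 0" using nz by (simp add: d_def n_def)
  have E: "E \<noteq> 0" using nz by (simp add: E_def t_def)
  have m1: "1 + curv S * (cmod m)\<^sup>2 = d * h / E"
    using mobius_conformal[of S t w] nz unfolding m_def d_def h_def E_def n_def t_def by simp
  then have "1 - curv S * (cmod m)\<^sup>2 = (2 * E - d * h) / E" using E by (simp add: field_simps)
  moreover have "2 * E - d * h = (1 - curv S * n) * (1 - curv S * t\<^sup>2) - 4 * curv S * t * Re w"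
    unfolding E_def d_def h_def n_def cmod_power2 by (cases S) (simp_all add: power2_eq_square algebra_simps)
  ultimately have m2: "1 - curv S * (cmod m)\<^sup>2
      = ((1 - curv S * n) * (1 - curv S * t\<^sup>2) - 4 * curv S * t * Re w) / E"
    by simp
  have m3: "Re m = (Re w * (1 - curv S * t\<^sup>2) + t * (1 - curv S * n)) / E" "Im m = Im w * h / E"
    unfolding m_def mobius_Re_Im E_def n_def h_def by simp_all
  have C: "gcos S l = (1 - curv S * t\<^sup>2) / h" "gsin S l = 2 * t / h"
    using gcos_gsin_gtan[OF l] by (simp_all add: t_def h_def)
  have "stereo S (geodesic_line S x e l) (geodesic_line_velocity S x e l) f w
      = ((1 - curv S * n) / d * gcos S l + 2 * Re w / d * (- curv S * gsin S l)) *\<^sub>R x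
      + ((1 - curv S * n) / d * gsin S l + 2 * Re w / d * gcos S l) *\<^sub>R e + (2 * Im w / d) *\<^sub>R f"
    unfolding stereo_def Let_def geodesic_line_def geodesic_line_velocity_def n_def[symmetric] d_def[symmetric]
    by (simp only: scaleR_add_right scaleR_add_left scaleR_scaleR add_ac)
  also have "(1 - curv S * n) / d * gcos S l + 2 * Re w / d * (- curv S * gsin S l)
      = (1 - curv S * (cmod m)\<^sup>2) / (1 + curv S * (cmod m)\<^sup>2)"
    unfolding m1 m2 C using d E h by (simp add: field_simps)
  also have "(1 - curv S * n) / d * gsin S l + 2 * Re w / d * gcos S l = 2 * Re m / (1 + curv S * (cmod m)\<^sup>2)"
    unfolding m1 m3 C using d E h by (simp add: field_simps)
  also have "2 * Im w / d = 2 * Im m / (1 + curv S * (cmod m)\<^sup>2)"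
    unfolding m1 m3 using d E h by (simp add: field_simps)
  finally show ?thesis
    unfolding stereo_def Let_def m_def t_def .
qed

text \<open>
  The triangle inequality for the distance to the centre, in terms of \<open>gtan\<close>. The first
  conclusion keeps the denominator of the translation in the right half-plane.
\<close>

lemma mobius_bound:
  assumes al: "0 \<le> a" "0 \<le> l" "admissible S (a + l)" and u: "cmod u \<le> gtan S a"
  shows "cmod (of_real (curv S * gtan S l) * u) < 1" "cmod (mobius S (gtan S l) u) \<le> gtan S (a + l)"
proof -
  define t where "t = gtan S l"
  define A where "A = gtan S a"
  have adm: "admissible S a" "admissible S l" using al by (auto simp: admissible_def)
  have t: "t \<ge> 0" "A \<ge> 0" using gtan_nonneg adm by (auto simp: t_def A_def)
  have tA: "t * A < 1" "gtan S (a + l) * (1 - curv S * A * t) = A + t"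
    using gtan_add[OF al] by (simp_all add: t_def A_def mult.commute)
  have tu: "t * cmod u \<le> t * A" using u t by (intro mult_left_mono) (auto simp: A_def)
  have "cmod (of_real (curv S * gtan S l) * u) = t * cmod u"
    using t curv_cases[of S] by (auto simp: norm_mult t_def)
  with tu tA show "cmod (of_real (curv S * gtan S l) * u) < 1" by simp
  then have nz: "1 - of_real (curv S * t) * u \<noteq> 0" by (auto simp: t_def)
  have cs: "cmod (of_real (curv S * t) * u) \<le> A * t"
    using tu t curv_cases[of S] by (auto simp: norm_mult mult.commute)
  have T: "gtan S (a + l) \<ge> 0" using gtan_nonneg al by simp
  show "cmod (mobius S (gtan S l) u) \<le> gtan S (a + l)"
  proof (cases S)
    case Sphere
    have "cmod (u + of_real t) \<le> A + t"
      using norm_triangle_ineq[of u "of_real t"] u t by (simp add: A_def)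
    also have "\<dots> = gtan S (a + l) * (1 - A * t)" using tA(2) Sphere by simp
    also have "\<dots> \<le> gtan S (a + l) * cmod (1 - of_real (curv S * t) * u)"
      using norm_triangle_ineq2[of 1 "of_real (curv S * t) * u"] cs T by (intro mult_left_mono) auto
    finally show ?thesis using nz by (simp add: mobius_def norm_divide divide_le_eq t_def)
  next
    case Hyperbolic_Plane
    define E where "E = cmod (1 - of_real (curv S * t) * u)"
    have E: "0 < E" "E \<le> 1 + A * t"
      using norm_triangle_ineq4[of 1 "of_real (curv S * t) * u"] cs nz by (auto simp: E_def)
    have "A < 1" "t < 1" using Hyperbolic_Plane by (auto simp: A_def t_def tanh_real_lt_1)
    then have pos: "1 - A\<^sup>2 > 0" "1 - t\<^sup>2 > 0" using t by (simp_all add: abs_square_less_1)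
    have m: "1 - (cmod (mobius S t u))\<^sup>2 = (1 - (cmod u)\<^sup>2) * (1 - t\<^sup>2) / E\<^sup>2"
      using mobius_conformal[OF nz] by (simp add: Hyperbolic_Plane E_def)
    have "(cmod u)\<^sup>2 \<le> A\<^sup>2" using u by (intro power_mono) (auto simp: A_def)
    then have "(1 - A\<^sup>2) * (1 - t\<^sup>2) / (1 + A * t)\<^sup>2 \<le> (1 - (cmod u)\<^sup>2) * (1 - t\<^sup>2) / E\<^sup>2"
      using E pos by (intro frac_le mult_right_mono power_mono mult_nonneg_nonneg) auto
    moreover have "(1 - A\<^sup>2) * (1 - t\<^sup>2) / (1 + A * t)\<^sup>2 = 1 - (gtan S (a + l))\<^sup>2"
    proof -
      have p: "1 + A * t > 0" using t by (simp add: add_pos_nonneg)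
      then have "gtan S (a + l) = (A + t) / (1 + A * t)" using tA(2) Hyperbolic_Plane by (simp add: field_simps)
      moreover have "(1 + A * t)\<^sup>2 - (A + t)\<^sup>2 = (1 - A\<^sup>2) * (1 - t\<^sup>2)"
        by (simp add: power2_eq_square algebra_simps)
      moreover have "1 - ((A + t) / (1 + A * t))\<^sup>2 = ((1 + A * t)\<^sup>2 - (A + t)\<^sup>2) / (1 + A * t)\<^sup>2"
        using p by (simp add: power_divide diff_divide_distrib)
      ultimately show ?thesis by simp
    qed
    ultimately have "(cmod (mobius S t u))\<^sup>2 \<le> (gtan S (a + l))\<^sup>2" using m by linarith
    from power2_le_imp_le[OF this T] show ?thesis by (simp only: t_def)
  qed
qed

fun arm_coord :: "surface \<Rightarrow> (real \<times> real) list \<Rightarrow> complex" where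
  "arm_coord S [] = 0"
| "arm_coord S ((l, \<theta>) # joints) = cis \<theta> * mobius S (gtan S l) (arm_coord S joints)"

lemma arm_coord_bound:
  assumes "\<And>j. j \<in> set joints \<Longrightarrow> fst j \<ge> 0" "admissible S (\<Sum>j\<leftarrow>joints. fst j)"
  shows "cmod (arm_coord S joints) \<le> gtan S (\<Sum>j\<leftarrow>joints. fst j)"
  using assms
proof (induction joints)
  case (Cons j joints)
  obtain l \<theta> where j: "j = (l, \<theta>)" by fastforce
  have nn: "0 \<le> (\<Sum>j\<leftarrow>joints. fst j)" using Cons.prems(1) by (intro sum_list_nonneg) auto
  moreover have l: "l \<ge> 0" using Cons.prems(1)[of j] j by auto
  ultimately have "admissible S (\<Sum>j\<leftarrow>joints. fst j)" "admissible S ((\<Sum>j\<leftarrow>joints. fst j) + l)"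
    using Cons.prems(2) by (auto simp: admissible_def j add.commute)
  then show ?case
    using mobius_bound(2)[OF nn l] Cons.IH Cons.prems(1) by (simp add: j norm_mult add.commute)
qed simp

text \<open>
  Rotating the frame by the angle of a joint multiplies the coordinate by a phase, and
  moving along the joint translates it, so the arm is an alternating composition of both.
\<close>

lemma arm_end_stereo:
  assumes \<epsilon>: "\<epsilon> = 1 \<or> \<epsilon> = - 1" and "frame S \<epsilon> x e f"
    and "\<And>j. j \<in> set joints \<Longrightarrow> fst j \<ge> 0" "admissible S (\<Sum>j\<leftarrow>joints. fst j)"
  shows "arm_end S \<epsilon> x e joints = stereo S x e f (arm_coord S joints)"
  using assms(2-)
proof (induction joints arbitrary: x e f)
  case (Cons j joints)
  obtain l \<theta> where j: "j = (l, \<theta>)" by fastforce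
  define e' where "e' = cos \<theta> *\<^sub>R e + sin \<theta> *\<^sub>R f"
  define f' where "f' = - sin \<theta> *\<^sub>R e + cos \<theta> *\<^sub>R f"
  have nn: "0 \<le> (\<Sum>j\<leftarrow>joints. fst j)" using Cons.prems(2) by (intro sum_list_nonneg) auto
  moreover have l: "l \<ge> 0" using Cons.prems(2)[of j] j by auto
  ultimately have adm: "admissible S (\<Sum>j\<leftarrow>joints. fst j)" "admissible S ((\<Sum>j\<leftarrow>joints. fst j)
      + l)" "admissible S l"
    using Cons.prems(3) by (auto simp: admissible_def j add.commute)
  define w where "w = arm_coord S joints"
  have w: "cmod w \<le> gtan S (\<Sum>j\<leftarrow>joints. fst j)"
    unfolding w_def using Cons.prems(2) adm(1) by (intro arm_coord_bound) auto
  have nz: "1 - of_real (curv S * gtan S l) * w \<noteq> 0"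
    using mobius_bound(1)[OF nn l adm(2) w] by auto
  have fr: "frame S \<epsilon> x e' f'" unfolding e'_def f'_def by (rule frame_rotate[OF Cons.prems(1)])
  have "arm_end S \<epsilon> x e (j # joints) = arm_end S \<epsilon> (geodesic_line S x e' l) (geodesic_line_velocity S x e' l)
      joints"
    unfolding j e'_def by (rule arm_end_step[OF \<epsilon> Cons.prems(1)])
  also have "\<dots> = stereo S (geodesic_line S x e' l) (geodesic_line_velocity S x e' l) f' w"
    unfolding w_def using frame_transport[OF fr] Cons.prems(2) adm(1) by (intro Cons.IH) auto
  also have "\<dots> = stereo S x e' f' (mobius S (gtan S l) w)"
    using gtan_conformal_pos[OF adm(1) w] nz adm(3) by (intro stereo_transport) auto
  also have "\<dots> = stereo S x e f (arm_coord S (j # joints))"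
    unfolding e'_def f'_def stereo_rotate by (simp add: j w_def)
  finally show ?case .
qed simp

lemma unit_tangent_angle:
  assumes "frame S \<epsilon> x e f" "\<epsilon> \<noteq> 0" "v \<in> unit_tangent S x"
  obtains \<theta> where "v = cos \<theta> *\<^sub>R e + sin \<theta> *\<^sub>R f"
proof -
  have v: "form S v x = 0" "form S v v = 1"
    using assms(3) by (auto simp: unit_tangent_def tangent_space_def form_commute)
  define a b where "a = form S v e" and "b = form S v f"
  have e: "v = a *\<^sub>R e + b *\<^sub>R f"
    using frame_expansion[OF assms(1,2), of v] v by (simp add: a_def b_def)
  have "a\<^sup>2 + b\<^sup>2 = 1"
    using v(2) frame_form[OF assms(1)] unfolding e by (simp add: form_linear power2_eq_square)
  then show ?thesis using sincos_total_2pi[of a b] that e by metis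
qed

lemma frame_unit_tangent:
  assumes "frame S \<epsilon> x e f"
  shows "x \<in> points S" "cos \<theta> *\<^sub>R e + sin \<theta> *\<^sub>R f \<in> unit_tangent S x"
  using frame_rotate[OF assms, of \<theta>] by (auto simp: frame_def unit_tangent_def tangent_space_def)

lemma geodesic_line_stereo:
  assumes "admissible S s"
  shows "geodesic_line S x (cos \<theta> *\<^sub>R e + sin \<theta> *\<^sub>R f) s = stereo S x e f (cis \<theta> * of_real (gtan S s))"
proof -
  define e' where "e' = cos \<theta> *\<^sub>R e + sin \<theta> *\<^sub>R f"
  define f' where "f' = - sin \<theta> *\<^sub>R e + cos \<theta> *\<^sub>R f"
  have "stereo S (geodesic_line S x e' s) (geodesic_line_velocity S x e' s) f' 0
      = stereo S x e' f' (mobius S (gtan S s) 0)"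
    using assms by (intro stereo_transport) auto
  then show ?thesis
    using stereo_rotate[of S x \<theta> e f "of_real (gtan S s)"] by (simp add: e'_def f'_def mobius_def)
qed

text \<open>
  Unit speed geodesics from the centre are the rays of the disc, and distance and radius
  are related by the increasing function \<open>gtan\<close>.
\<close>

lemma closed_ball_eq_stereo_image:
  assumes fr: "frame S \<epsilon> x e f" "\<epsilon> \<noteq> 0" and R: "admissible S R"
  shows "closed_ball S x R = stereo S x e f ` cball 0 (gtan S R)"
proof (intro equalityI subsetI)
  fix p assume "p \<in> closed_ball S x R"
  then obtain \<gamma> s where \<gamma>: "unit_speed_geodesic S \<gamma>" "\<gamma> 0 = x" "0 \<le> s" "s \<le> R" "p = \<gamma> s"
    unfolding closed_ball_def by blast
  then have v: "velocity \<gamma> 0 \<in> unit_tangent S x" by (auto simp: unit_speed_geodesic_def)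
  then obtain \<theta> where \<theta>: "velocity \<gamma> 0 = cos \<theta> *\<^sub>R e + sin \<theta> *\<^sub>R f" by (rule unit_tangent_angle[OF fr])
  have "p = geodesic_line S x (velocity \<gamma> 0) s"
    using geodesic_eq_geodesic_line[of S \<gamma>] \<gamma> v by (simp add: unit_speed_geodesic_def)
  moreover have s: "admissible S s" using \<gamma> R by (auto simp: admissible_def)
  ultimately have "p = stereo S x e f (cis \<theta> * of_real (gtan S s))"
    unfolding \<theta> by (simp add: geodesic_line_stereo)
  moreover have "cmod (cis \<theta> * of_real (gtan S s)) \<le> gtan S R"
    using gtan_mono[OF \<gamma>(3,4) R] gtan_nonneg[OF s] by (simp add: norm_mult)
  ultimately show "p \<in> stereo S x e f ` cball 0 (gtan S R)" by auto
next
  fix p assume "p \<in> stereo S x e f ` cball 0 (gtan S R)"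
  then obtain w where w: "cmod w \<le> gtan S R" "p = stereo S x e f w" by auto
  obtain s where s: "admissible S s" "gtan S s = cmod w"
    using gtan_surj[of "cmod w" S] gtan_conformal_pos[OF R w(1)] by auto
  have "s \<le> R"
  proof (rule ccontr)
    assume "\<not> s \<le> R"
    then have "gtan S R < gtan S s" using s R by (intro gtan_strict_mono) (auto simp: admissible_def)
    then show False using w s by simp
  qed
  have "w = cis (Arg w) * of_real (gtan S s)"
    using s(2) by (cases "w = 0") (simp_all add: cis_Arg sgn_eq)
  then have "p = geodesic_line S x (cos (Arg w) *\<^sub>R e + sin (Arg w) *\<^sub>R f) s"
    using w(2) geodesic_line_stereo[OF s(1), of x "Arg w" e f] by simp
  then show "p \<in> closed_ball S x R"
    unfolding closed_ball_def
    using geodesic_line_unit_speed(1)[OF frame_unit_tangent(1)[OF fr(1)]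
        frame_unit_tangent(2)[OF fr(1), of "Arg w"]] \<open>s \<le> R\<close> s(1)
    by (intro CollectI exI[of _ "geodesic_line S x (cos (Arg w) *\<^sub>R e + sin (Arg w) *\<^sub>R f)"] exI[of _ s])
      (simp add: admissible_def)
qed

lemma stereo_points:
  assumes fr: "frame S \<epsilon> x e f" and w: "1 + curv S * (cmod w)\<^sup>2 > 0"
  shows "stereo S x e f w \<in> points S"
proof -
  obtain s where s: "admissible S s" "gtan S s = cmod w"
    using gtan_surj[of "cmod w" S] w by auto
  have "w = cis (Arg w) * of_real (gtan S s)"
    using s(2) by (cases "w = 0") (simp_all add: cis_Arg sgn_eq)
  then have "stereo S x e f w = geodesic_line S x (cos (Arg w) *\<^sub>R e + sin (Arg w) *\<^sub>R f) s"
    using geodesic_line_stereo[OF s(1), of x "Arg w" e f] by simp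
  then show ?thesis using geodesic_line_points[OF frame_unit_tangent[OF fr]] by simp
qed

section \<open>Charts at the base point\<close>

text \<open>
  The denominator vanishes only at the antipode \<open>- x\<close> of the centre, which in the hyperbolic case lies on
  the other sheet.
\<close>

definition stereo_coord :: "surface \<Rightarrow> real^3 \<Rightarrow> real^3 \<Rightarrow> real^3 \<Rightarrow> real^3 \<Rightarrow> complex" where
  "stereo_coord S x e f p = Complex (form S p e) (form S p f) /\<^sub>R (1 + curv S * form S p x)"

lemma stereo_form:
  assumes "frame S \<epsilon> x e f"
  shows "form S (stereo S x e f w) e = 2 * Re w / (1 + curv S * (cmod w)\<^sup>2)"
    "form S (stereo S x e f w) f = 2 * Im w / (1 + curv S * (cmod w)\<^sup>2)"
    "form S (stereo S x e f w) x = curv S * ((1 - curv S * (cmod w)\<^sup>2) / (1 + curv S * (cmod w)\<^sup>2))"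
  using frame_form[OF assms] by (simp_all add: stereo_def Let_def form_linear)

lemma stereo_form_base:
  assumes "frame S \<epsilon> x e f" "1 + curv S * (cmod w)\<^sup>2 > 0"
  shows "1 + curv S * form S (stereo S x e f w) x = 2 / (1 + curv S * (cmod w)\<^sup>2)"
  using assms(2) unfolding stereo_form[OF assms(1)] by (simp add: field_simps)

lemma stereo_coord_stereo:
  assumes "frame S \<epsilon> x e f" "1 + curv S * (cmod w)\<^sup>2 > 0"
  shows "stereo_coord S x e f (stereo S x e f w) = w"
  using assms(2) unfolding stereo_coord_def stereo_form_base[OF assms] stereo_form(1,2)[OF assms(1)]
  by (simp add: complex_eq_iff)

lemma stereo_stereo_coord:
  assumes fr: "frame S \<epsilon> x e f" "\<epsilon> \<noteq> 0" and p: "p \<in> points S" "1 + curv S * form S p x > 0"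
  shows "1 + curv S * (cmod (stereo_coord S x e f p))\<^sup>2 > 0" "stereo S x e f (stereo_coord S x e f p) = p"
proof -
  define k where "k = curv S"
  define P where "P = form S p x"
  define w where "w = stereo_coord S x e f p"
  have ex: "p = (k * P) *\<^sub>R x + form S p e *\<^sub>R e + form S p f *\<^sub>R f"
    unfolding k_def P_def by (rule frame_expansion[OF fr])
  have kk: "k * k = 1" by (simp add: k_def)
  have "form S p p = k * (k * P) * (k * P) + form S p e * form S p e + form S p f * form S p f"
    by (subst (1 2) ex) (simp only: frame_combination_form[OF fr(1)] k_def)
  then have sq: "(form S p e)\<^sup>2 + (form S p f)\<^sup>2 = k * (1 - P\<^sup>2)"
    using points_form[OF p(1)] kk by (simp add: k_def power2_eq_square algebra_simps)
  have q: "1 + k * P > 0" using p by (simp add: k_def P_def)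
  have w: "Re w = form S p e / (1 + k * P)" "Im w = form S p f / (1 + k * P)"
    by (simp_all add: w_def stereo_coord_def k_def P_def divide_inverse mult.commute)
  have "(cmod w)\<^sup>2 = k * (1 - P\<^sup>2) / (1 + k * P)\<^sup>2"
    unfolding cmod_power2 w power_divide add_divide_distrib[symmetric] sq ..
  moreover have "1 - P\<^sup>2 = (1 - k * P) * (1 + k * P)"
    using kk by (simp add: power2_eq_square algebra_simps)
  ultimately have n: "k * (cmod w)\<^sup>2 = (1 - k * P) / (1 + k * P)"
    using q kk by (simp add: power2_eq_square k_def)
  have d: "1 + k * (cmod w)\<^sup>2 = 2 / (1 + k * P)" unfolding n using q by (simp add: field_simps)
  have d': "1 - k * (cmod w)\<^sup>2 = 2 * (k * P) / (1 + k * P)" unfolding n using q by (simp add: field_simps)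
  show "1 + curv S * (cmod (stereo_coord S x e f p))\<^sup>2 > 0"
    using d q unfolding k_def[symmetric] w_def[symmetric] by simp
  have "stereo S x e f w = (k * P) *\<^sub>R x + form S p e *\<^sub>R e + form S p f *\<^sub>R f"
    unfolding stereo_def Let_def k_def[symmetric] d d' w using q by simp
  then show "stereo S x e f (stereo_coord S x e f p) = p"
    using ex unfolding w_def by simp
qed

lemma stereo_has_derivative:
  fixes w :: complex
  assumes w: "1 + curv S * (cmod w)\<^sup>2 > 0"
  defines "g \<equiv> 2 / (1 + curv S * (cmod w)\<^sup>2)"
  shows "(stereo S x e f has_derivative (\<lambda>a.
      (- curv S * g\<^sup>2 * (w \<bullet> a)) *\<^sub>R x + (g * Re a - curv S * g\<^sup>2 * (w \<bullet> a) * Re w) *\<^sub>R e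
      + (g * Im a - curv S * g\<^sup>2 * (w \<bullet> a) * Im w) *\<^sub>R f)) (at w)"
proof -
  define G where "G = (\<lambda>w::complex. 2 / (1 + curv S * (w \<bullet> w)))"
  have nn: "(cmod w)\<^sup>2 = w \<bullet> w" for w :: complex by (simp add: power2_norm_eq_inner)
  have pos: "1 + curv S * (w \<bullet> w) > 0" using w by (simp add: nn)
  have Gg: "G w = g" by (simp add: G_def g_def nn)
  have "((\<lambda>w. 1 + curv S * (w \<bullet> w)) has_derivative (\<lambda>a. curv S * (2 * (w \<bullet> a)))) (at w)"
    by (rule derivative_eq_intros refl)+ (simp add: inner_commute algebra_simps)
  from has_derivative_divide[OF has_derivative_const[of 2] this] pos
  have "(G has_derivative (\<lambda>h. - 2 * (inverse (1 + curv S * (w \<bullet> w)) * (curv S * (2 * (w \<bullet> h))) *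
      inverse (1 + curv S * (w \<bullet> w))) + 0 / (1 + curv S * (w \<bullet> w)))) (at w)"
    unfolding G_def by simp
  then have dG: "(G has_derivative (\<lambda>a. - curv S * g\<^sup>2 * (w \<bullet> a))) (at w)"
    unfolding Gg[symmetric] G_def
    by (rule has_derivative_eq_rhs) (simp add: fun_eq_iff power2_eq_square divide_inverse)
  have near: "\<forall>\<^sub>F v in nhds w. 1 + curv S * (v \<bullet> v) > 0"
  proof -
    have "((\<lambda>v. 1 + curv S * (v \<bullet> v)) \<longlongrightarrow> 1 + curv S * (w \<bullet> w)) (nhds w)"
      by (intro tendsto_intros filterlim_ident)
    then show ?thesis using pos order_tendstoD(1) by blast
  qed
  have eq: "stereo S x e f v = (G v - 1) *\<^sub>R x + (G v * Re v) *\<^sub>R e + (G v * Im v) *\<^sub>R f"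
    if "1 + curv S * (v \<bullet> v) > 0" for v
    using that by (simp add: stereo_def Let_def G_def nn field_simps)
  have "((\<lambda>v. (G v - 1) *\<^sub>R x + (G v * Re v) *\<^sub>R e + (G v * Im v) *\<^sub>R f) has_derivative (\<lambda>a.
      (- curv S * g\<^sup>2 * (w \<bullet> a)) *\<^sub>R x + (g * Re a - curv S * g\<^sup>2 * (w \<bullet> a) * Re w) *\<^sub>R e
      + (g * Im a - curv S * g\<^sup>2 * (w \<bullet> a) * Im w) *\<^sub>R f)) (at w)"
    by (rule derivative_eq_intros dG refl)+ (simp add: Gg)
  then show ?thesis
    by (rule has_derivative_transform_eventually)
      (use near eq pos in \<open>auto simp: eventually_at_filter elim: eventually_mono\<close>)
qed

text \<open>
  The derivative stretches all directions by \<open>g = 2 / (1 + curv S * (cmod w)\<^sup>2)\<close>. The verification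
  reduces to the identity \<open>g * (1 + curv S * (cmod w)\<^sup>2) = 2\<close>.
\<close>

lemma stereo_conformal:
  assumes fr: "frame S \<epsilon> x e f" "\<epsilon> = 1 \<or> \<epsilon> = - 1" and w: "1 + curv S * (cmod w)\<^sup>2 > 0"
  shows "\<exists>X'. (stereo S x e f has_derivative X') (at w)
     \<and> (\<exists>c>0. \<forall>a b. form S (X' a) (X' b) = c * (a \<bullet> b))
     \<and> positively_oriented \<epsilon> (stereo S x e f w) (X' 1) (X' \<i>)"
proof -
  define k where "k = curv S"
  define g where "g = 2 / (1 + k * (cmod w)\<^sup>2)"
  define X' where "X' = (\<lambda>a. (- k * g\<^sup>2 * (w \<bullet> a)) *\<^sub>R x + (g * Re a - k * g\<^sup>2 * (w \<bullet> a) * Re w) *\<^sub>R e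
      + (g * Im a - k * g\<^sup>2 * (w \<bullet> a) * Im w) *\<^sub>R f)"
  have g: "g > 0" using w by (simp add: g_def k_def)
  have kk: "k * k = 1" by (simp add: k_def)
  have gn: "g * (1 + k * ((Re w)\<^sup>2 + (Im w)\<^sup>2)) = 2"
  proof -
    have "2 / d * d = 2" if "d \<noteq> 0" for d :: real using that by simp
    moreover have "1 + k * (cmod w)\<^sup>2 \<noteq> 0" using w by (simp add: k_def)
    ultimately show ?thesis unfolding g_def cmod_power2[symmetric] by blast
  qed
  have conf: "form S (X' a) (X' b) = g\<^sup>2 * (a \<bullet> b)" for a b
  proof -
    define u where "u = w \<bullet> a"
    define v where "v = w \<bullet> b"
    have uv: "Re w * Re a + Im w * Im a = u" "Re w * Re b + Im w * Im b = v"
      by (simp_all add: u_def v_def inner_complex_def)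
    have "form S (X' a) (X' b) = k * (- k * g\<^sup>2 * u) * (- k * g\<^sup>2 * v)
        + (g * Re a - k * g\<^sup>2 * u * Re w) * (g * Re b - k * g\<^sup>2 * v * Re w)
        + (g * Im a - k * g\<^sup>2 * u * Im w) * (g * Im b - k * g\<^sup>2 * v * Im w)"
      unfolding X'_def frame_combination_form[OF fr(1)] u_def v_def k_def ..
    also have "\<dots> = g\<^sup>2 * (Re a * Re b + Im a * Im b) + k * (k * k) * g ^ 4 * u * v
        - k * g ^ 3 * (v * (Re w * Re a + Im w * Im a) + u * (Re w * Re b + Im w * Im b))
        + (k * k) * g ^ 4 * u * v * ((Re w)\<^sup>2 + (Im w)\<^sup>2)"
      by (simp add: power2_eq_square power3_eq_cube power4_eq_xxxx algebra_simps)
    also have "\<dots> = g\<^sup>2 * (a \<bullet> b) + k * g ^ 3 * u * v * (g * (1 + k * ((Re w)\<^sup>2 + (Im w)\<^sup>2)) - 2)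
        + (1 - k * k) * g ^ 4 * u * v * ((Re w)\<^sup>2 + (Im w)\<^sup>2)"
      unfolding uv kk by (simp add: inner_complex_def power3_eq_cube power4_eq_xxxx algebra_simps)
        (simp add: kk flip: mult.assoc)
    finally show ?thesis unfolding gn kk by simp
  qed
  have "det (vector [stereo S x e f w, X' 1, X' \<i>] :: real^3^3) = g\<^sup>2 * \<epsilon>"
  proof -
    define p where "p = Re w"
    define q where "q = Im w"
    have st: "stereo S x e f w = (g - 1) *\<^sub>R x + (g * p) *\<^sub>R e + (g * q) *\<^sub>R f"
      using w by (simp add: stereo_def Let_def g_def k_def p_def q_def field_simps)
    have ip: "w \<bullet> 1 = p" "w \<bullet> \<i> = q" by (simp_all add: inner_complex_def p_def q_def)
    have "det (vector [stereo S x e f w, X' 1, X' \<i>] :: real^3^3)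
      = ((g - 1) * ((g - k * g\<^sup>2 * p * p) * (g - k * g\<^sup>2 * q * q) - (- k * g\<^sup>2 * p * q) * (- k * g\<^sup>2 * q * p))
        - g * p * ((- k * g\<^sup>2 * p) * (g - k * g\<^sup>2 * q * q) - (- k * g\<^sup>2 * p * q) * (- k * g\<^sup>2 * q))
        + g * q * ((- k * g\<^sup>2 * p) * (- k * g\<^sup>2 * q * p) - (g - k * g\<^sup>2 * p * p) * (- k * g\<^sup>2 * q))) * \<epsilon>"
      unfolding st X'_def det_linear_combination ip p_def[symmetric] q_def[symmetric]
      using fr(1) by (simp add: frame_def)
    also have "\<dots> = (g\<^sup>2 * (g * (1 + k * (p\<^sup>2 + q\<^sup>2))) - g\<^sup>2) * \<epsilon>"
      by (simp add: power2_eq_square algebra_simps)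
    finally show ?thesis using gn unfolding p_def q_def by simp
  qed
  then have "positively_oriented \<epsilon> (stereo S x e f w) (X' 1) (X' \<i>)"
    using g fr(2) by (auto simp: positively_oriented_def)
  moreover have "(stereo S x e f has_derivative X') (at w)"
    using stereo_has_derivative[OF w] unfolding X'_def g_def k_def .
  ultimately show ?thesis using conf g by (intro exI[of _ X'] conjI exI[of _ "g\<^sup>2"]) auto
qed

definition stereo_domain :: "surface \<Rightarrow> real^3 \<Rightarrow> (real^3) set" where
  "stereo_domain S x = {p \<in> points S. 1 + curv S * form S p x > 0}"

lemma bounded_linear_form: "bounded_linear (\<lambda>p. form S p y)"
  unfolding linear_conv_bounded_linear[symmetric] by (rule linearI) (simp_all add: form_linear)

lemma open_stereo_disc: "open {w. 1 + curv S * (cmod w)\<^sup>2 > 0}"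
  by (intro open_Collect_less continuous_intros)

lemma continuous_on_stereo: "continuous_on {w. 1 + curv S * (cmod w)\<^sup>2 > 0} (stereo S x e f)"
  unfolding stereo_def Let_def by (intro continuous_intros) auto

lemma stereo_image_domain:
  assumes fr: "frame S \<epsilon> x e f" "\<epsilon> \<noteq> 0"
  shows "stereo_coord S x e f ` stereo_domain S x = {w. 1 + curv S * (cmod w)\<^sup>2 > 0}"
    "stereo S x e f ` {w. 1 + curv S * (cmod w)\<^sup>2 > 0} = stereo_domain S x"
proof -
  have 1: "stereo S x e f w \<in> stereo_domain S x" if "1 + curv S * (cmod w)\<^sup>2 > 0" for w
    using that stereo_points[OF fr(1) that] stereo_form_base[OF fr(1) that] by (simp add: stereo_domain_def)
  have 2: "1 + curv S * (cmod (stereo_coord S x e f p))\<^sup>2 > 0" "stereo S x e f (stereo_coord S x e f p) = p"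
    if "p \<in> stereo_domain S x" for p
    using stereo_stereo_coord[OF fr] that by (auto simp: stereo_domain_def)
  show "stereo_coord S x e f ` stereo_domain S x = {w. 1 + curv S * (cmod w)\<^sup>2 > 0}"
    using 1 2(1) stereo_coord_stereo[OF fr(1)] by (force simp: image_iff)
  show "stereo S x e f ` {w. 1 + curv S * (cmod w)\<^sup>2 > 0} = stereo_domain S x"
    using 1 2 by (force simp: image_iff)
qed

lemma stereo_conformal_chart:
  assumes fr: "frame S \<epsilon> x e f" "\<epsilon> = 1 \<or> \<epsilon> = - 1"
  shows "conformal_chart S \<epsilon> (stereo_domain S x) (stereo_coord S x e f)"
proof -
  have \<epsilon>: "\<epsilon> \<noteq> 0" using fr by auto
  let ?D = "{w. 1 + curv S * (cmod w)\<^sup>2 > 0}"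
  have "openin (top_of_set (points S)) (stereo_domain S x)"
  proof -
    have "open {p. 1 + curv S * form S p x > 0}"
      by (intro open_Collect_less continuous_intros bounded_linear.continuous_on[OF bounded_linear_form])
    then show ?thesis
      unfolding stereo_domain_def openin_open by (intro exI[of _ "{p. 1 + curv S * form S p x > 0}"]) auto
  qed
  moreover have "homeomorphism (stereo_domain S x) ?D (stereo_coord S x e f) (stereo S x e f)"
  proof
    show "continuous_on (stereo_domain S x) (stereo_coord S x e f)"
      unfolding stereo_coord_def[abs_def] Complex_eq
      by (intro continuous_intros bounded_linear.continuous_on[OF bounded_linear_form])
        (auto simp: stereo_domain_def)
  qed (use continuous_on_stereo stereo_image_domain[OF fr(1) \<epsilon>] stereo_coord_stereo[OF fr(1)]
        stereo_stereo_coord[OF fr(1) \<epsilon>] in \<open>auto simp: stereo_domain_def\<close>)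
  ultimately show ?thesis
    unfolding conformal_chart_def stereo_image_domain[OF fr(1) \<epsilon>]
    using open_stereo_disc stereo_conformal[OF fr] by blast
qed

lemma stereo_lagrange_chart:
  assumes fr: "frame S \<epsilon> x e f" "\<epsilon> = 1 \<or> \<epsilon> = - 1" and R: "admissible S R"
    and z: "\<And>t. t \<ge> 0 \<Longrightarrow> z t \<in> closed_ball S x R"
  shows "lagrange_chart S \<epsilon> x z (stereo_domain S x) (stereo_coord S x e f)"
proof -
  have \<epsilon>: "\<epsilon> \<noteq> 0" using fr by auto
  have "closed_ball S x R \<subseteq> stereo_domain S x"
    unfolding closed_ball_eq_stereo_image[OF fr(1) \<epsilon> R] stereo_image_domain(2)[OF fr(1) \<epsilon>, symmetric]
    using gtan_conformal_pos[OF R] by (intro image_mono) auto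
  moreover have "x \<in> stereo_domain S x"
    using fr(1) frame_form[OF fr(1)] by (simp add: stereo_domain_def frame_def)
  moreover have "stereo_coord S x e f x = 0"
    using stereo_coord_stereo[OF fr(1), of 0] by simp
  ultimately show ?thesis
    unfolding lagrange_chart_def using stereo_conformal_chart[OF fr] z by blast
qed


text \<open>
  Both coordinates are conformal and respect the same orientation, so the derivative of the
  change of coordinates is a rotation followed by a dilation: it is complex linear and nonzero. It is used at
  the centre, where the quotient of the two coordinates has the form \<open>0 / 0\<close>.
\<close>

lemma conformal_chart_derivative:
  assumes fr: "frame S \<epsilon> x e f" "\<epsilon> = 1 \<or> \<epsilon> = - 1"
    and V: "open V" "q \<in> V" "\<And>p. p \<in> V \<Longrightarrow> Y p \<in> points S" "Y q = x"
    and Y: "(Y has_derivative Y') (at q)" "c > 0" "\<And>a b. form S (Y' a) (Y' b) = c * (a \<bullet> b)"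
      "positively_oriented \<epsilon> x (Y' 1) (Y' \<i>)"
  shows "\<exists>g. g \<noteq> 0 \<and> ((\<lambda>p. stereo_coord S x e f (Y p)) has_field_derivative g) (at q)"
proof -
  have \<epsilon>: "\<epsilon> \<noteq> 0" "\<epsilon> * \<epsilon> = 1" using fr by auto
  have lin: "bounded_linear Y'" using Y(1) by (rule has_derivative_bounded_linear)
  have tangent: "form S (Y' h) x = 0" for h
  proof -
    have line: "((\<lambda>s. q + s *\<^sub>R h) has_derivative (\<lambda>s. s *\<^sub>R h)) (at 0)"
      by (auto intro!: derivative_eq_intros)
    have "((\<lambda>s. Y (q + s *\<^sub>R h)) has_derivative (\<lambda>s. Y' (s *\<^sub>R h))) (at 0)"
      using has_derivative_compose[OF line, of Y Y'] Y(1) by simp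
    then have v: "((\<lambda>s. Y (q + s *\<^sub>R h)) has_vector_derivative Y' h) (at 0)"
      unfolding has_vector_derivative_def using lin by (simp add: linear_simps(5) bounded_linear.linear)
    from form_has_derivative[OF v v, of S] V(4)
    have d: "((\<lambda>s. form S (Y (q + s *\<^sub>R h)) (Y (q + s *\<^sub>R h))) has_real_derivative (form S (Y' h) x
        + form S x (Y' h))) (at 0)"
      by simp
    have "\<forall>\<^sub>F s in nhds 0. q + s *\<^sub>R h \<in> V"
    proof -
      have "((\<lambda>s. q + s *\<^sub>R h) \<longlongrightarrow> q + 0 *\<^sub>R h) (nhds 0)"
        by (intro tendsto_intros filterlim_ident)
      then show ?thesis using V(1,2) by (auto dest: topological_tendstoD)
    qed
    then have ev: "\<forall>\<^sub>F s in nhds 0. form S (Y (q + s *\<^sub>R h)) (Y (q + s *\<^sub>R h)) = curv S"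
      by eventually_elim (simp add: V(3) points_form)
    have "((\<lambda>s. curv S) has_real_derivative (form S (Y' h) x + form S x (Y' h))) (at 0)"
      using d DERIV_cong_ev[OF refl ev refl] by simp
    from DERIV_unique[OF this DERIV_const] show ?thesis by (simp add: form_commute)
  qed
  define \<alpha>1 \<alpha>2 \<beta>1 \<beta>2 where ab: "\<alpha>1 = form S (Y' 1) e" "\<alpha>2 = form S (Y' 1) f"
    "\<beta>1 = form S (Y' \<i>) e" "\<beta>2 = form S (Y' \<i>) f"
  have Y1: "Y' 1 = 0 *\<^sub>R x + \<alpha>1 *\<^sub>R e + \<alpha>2 *\<^sub>R f" and Yi: "Y' \<i> = 0 *\<^sub>R x + \<beta>1 *\<^sub>R e + \<beta>2 *\<^sub>R f"
    using frame_expansion[OF fr(1) \<epsilon>(1), of "Y' 1"] frame_expansion[OF fr(1) \<epsilon>(1), of "Y' \<i>"]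
    by (simp_all add: tangent ab)
  have c: "\<alpha>1 * \<alpha>1 + \<alpha>2 * \<alpha>2 = c" "\<beta>1 * \<beta>1 + \<beta>2 * \<beta>2 = c" "\<alpha>1 * \<beta>1 + \<alpha>2 * \<beta>2 = 0"
    using Y(3)[of 1 1] Y(3)[of \<i> \<i>] Y(3)[of 1 \<i>] unfolding Y1 Yi frame_combination_form[OF fr(1)]
    by (simp_all add: inner_complex_def)
  have "det (vector [1 *\<^sub>R x + 0 *\<^sub>R e + 0 *\<^sub>R f, Y' 1, Y' \<i>] :: real^3^3) = (\<alpha>1 * \<beta>2 - \<alpha>2 * \<beta>1) * \<epsilon>"
    unfolding Y1 Yi det_linear_combination using fr(1) by (simp add: frame_def)
  then have "\<epsilon> * ((\<alpha>1 * \<beta>2 - \<alpha>2 * \<beta>1) * \<epsilon>) > 0"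
    using Y(4) by (simp add: positively_oriented_def)
  then have pos: "\<alpha>1 * \<beta>2 - \<alpha>2 * \<beta>1 > 0" using fr(2) by auto
  have "(\<alpha>1 * \<beta>2 - \<alpha>2 * \<beta>1)\<^sup>2 + (\<alpha>1 * \<beta>1 + \<alpha>2 * \<beta>2)\<^sup>2 = (\<alpha>1 * \<alpha>1 + \<alpha>2 * \<alpha>2) * (\<beta>1 * \<beta>1 + \<beta>2 * \<beta>2)"
    by (simp add: power2_eq_square algebra_simps)
  then have "(\<alpha>1 * \<beta>2 - \<alpha>2 * \<beta>1)\<^sup>2 = c\<^sup>2" unfolding c by (simp add: power2_eq_square)
  (* Orthogonality and equal lengths leave only the sign, which is decided by the orientation. *)
  then have area: "\<alpha>1 * \<beta>2 - \<alpha>2 * \<beta>1 = c" using pos Y(2) by (simp add: power2_eq_iff)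
  have "(\<beta>1 + \<alpha>2)\<^sup>2 + (\<beta>2 - \<alpha>1)\<^sup>2 = (\<alpha>1 * \<alpha>1 + \<alpha>2 * \<alpha>2) + (\<beta>1 * \<beta>1 + \<beta>2 * \<beta>2) - 2 * (\<alpha>1 * \<beta>2 - \<alpha>2 * \<beta>1)"
    by (simp add: power2_eq_square algebra_simps)
  also have "\<dots> = 0" unfolding c area by simp
  (* The Cauchy--Riemann equations. *)
  finally have \<beta>: "\<beta>1 = - \<alpha>2" "\<beta>2 = \<alpha>1" by (simp_all add: sum_power2_eq_zero_iff eq_neg_iff_add_eq_0)
  define g where "g = Complex \<alpha>1 \<alpha>2 / 2"
  have "g \<noteq> 0" using c(1) Y(2) by (auto simp: g_def complex_eq_iff)
  define n where "n = (\<lambda>p. Complex (form S (Y p) e) (form S (Y p) f))"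
  define d where "d = (\<lambda>p. 1 + curv S * form S (Y p) x)"
  have lf: "((\<lambda>p. form S (Y p) y) has_derivative (\<lambda>h. form S (Y' h) y)) (at q)" for y
    by (rule bounded_linear.has_derivative[OF bounded_linear_form Y(1)])
  have dn: "(n has_derivative (\<lambda>h. Complex (form S (Y' h) e) (form S (Y' h) f))) (at q)"
    unfolding n_def Complex_eq by (rule derivative_eq_intros lf refl)+ simp
  have dd: "(d has_derivative (\<lambda>h. 0)) (at q)"
    unfolding d_def by (rule derivative_eq_intros lf refl)+ (simp add: tangent)
  have nq: "n q = 0" "d q = 2"
    using frame_form[OF fr(1)] by (simp_all add: n_def d_def V(4) complex_eq_iff)
  have "((\<lambda>p. inverse (d p) *\<^sub>R n p) has_derivative (\<lambda>h. g * h)) (at q)"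
  proof (rule has_derivative_eq_rhs)
    have "((\<lambda>p. inverse (d p)) has_derivative (\<lambda>h. - (inverse (d q) * 0 * inverse (d q)))) (at q)"
      by (rule Deriv.has_derivative_inverse[OF _ dd]) (simp add: nq)
    from has_derivative_scaleR[OF this dn]
    show "((\<lambda>p. inverse (d p) *\<^sub>R n p) has_derivative
        (\<lambda>h. inverse (d q) *\<^sub>R Complex (form S (Y' h) e) (form S (Y' h) f)
        + (- (inverse (d q) * 0 * inverse (d q))) *\<^sub>R n q)) (at q)" .
    show "(\<lambda>h. inverse (d q) *\<^sub>R Complex (form S (Y' h) e) (form S (Y' h) f)
        + (- (inverse (d q) * 0 * inverse (d q))) *\<^sub>R n q) = (\<lambda>h. g * h)"
    proof
      fix h
      have "h = Re h *\<^sub>R 1 + Im h *\<^sub>R \<i>" by (simp add: complex_eq_iff)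
      then have "Y' h = Y' (Re h *\<^sub>R 1 + Im h *\<^sub>R \<i>)" by (rule arg_cong)
      also have "\<dots> = Re h *\<^sub>R Y' 1 + Im h *\<^sub>R Y' \<i>"
        using lin by (simp only: linear_simps)
      finally have "form S (Y' h) e = Re h * \<alpha>1 - Im h * \<alpha>2" "form S (Y' h) f = Re h * \<alpha>2 + Im h * \<alpha>1"
        by (simp_all add: form_linear ab[symmetric] \<beta>)
      then show "inverse (d q) *\<^sub>R Complex (form S (Y' h) e) (form S (Y' h) f)
        + (- (inverse (d q) * 0 * inverse (d q))) *\<^sub>R n q = g * h"
        by (simp add: nq g_def complex_eq_iff field_simps)
    qed
  qed
  then have "((\<lambda>p. stereo_coord S x e f (Y p)) has_field_derivative g) (at q)"
    by (simp add: stereo_coord_def has_field_derivative_def n_def d_def)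
  with \<open>g \<noteq> 0\<close> show ?thesis by blast
qed

text \<open>
  Both coordinates vanish exactly at the centre. Their quotient extends continuously and without zeros
  over the centre by the complex derivative there, and a nonvanishing function on a disc has a
  logarithm. This bounds the difference between the arguments in the two coordinates.
\<close>

lemma chart_stereo_quotient:
  assumes fr: "frame S \<epsilon> x e f" "\<epsilon> = 1 \<or> \<epsilon> = - 1" and R: "admissible S R"
    and chart: "conformal_chart S \<epsilon> U \<psi>" "x \<in> U" "\<psi> x = 0" "closed_ball S x R \<subseteq> U"
  obtains L where "continuous_on (cball 0 (gtan S R)) L"
    "\<And>w. w \<in> cball 0 (gtan S R) \<Longrightarrow> \<psi> (stereo S x e f w) = w * exp (L w)"
proof -
  have \<epsilon>: "\<epsilon> \<noteq> 0" using fr by auto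
  define D where "D = {w. 1 + curv S * (cmod w)\<^sup>2 > 0}"
  have D0: "0 \<in> D" by (simp add: D_def)
  obtain Y where Y: "homeomorphism U (\<psi> ` U) \<psi> Y"
    and Yd: "\<And>p. p \<in> \<psi> ` U \<Longrightarrow> \<exists>X'. (Y has_derivative X') (at p) \<and>
           (\<exists>c>0. \<forall>a b. form S (X' a) (X' b) = c * (a \<bullet> b)) \<and> positively_oriented \<epsilon> (Y p) (X' 1) (X' \<i>)"
    and op: "openin (top_of_set (points S)) U" "open (\<psi> ` U)"
    using chart(1) unfolding conformal_chart_def by blast
  have YU: "Y (\<psi> p) = p" if "p \<in> U" for p using Y that by (simp add: homeomorphism_def)
  have Y0: "Y 0 = x" "0 \<in> \<psi> ` U" using YU[OF chart(2)] chart(2,3) by (auto simp: image_iff intro!: bexI[of _ x])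
  have UP: "U \<subseteq> points S" using op(1) openin_imp_subset by blast
  define G where "G = (\<lambda>p. stereo_coord S x e f (Y p))"
  obtain g where g: "g \<noteq> 0" "(G has_field_derivative g) (at 0)"
  proof -
    obtain X' c where X': "(Y has_derivative X') (at 0)" "c > 0" "\<And>a b. form S (X' a) (X' b) = c * (a \<bullet> b)"
      "positively_oriented \<epsilon> x (X' 1) (X' \<i>)"
      using Yd[OF Y0(2)] Y0(1) by auto
    have "Y p \<in> points S" if "p \<in> \<psi> ` U" for p using that YU UP by auto
    from conformal_chart_derivative[OF fr op(2) Y0(2) this Y0(1) X'] that show ?thesis
      unfolding G_def by blast
  qed
  define T where "T = D \<inter> stereo S x e f -` U"
  have openT: "open T"
  proof -
    obtain W where W: "open W" "U = points S \<inter> W" using op(1) by (auto simp: openin_open)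
    have "T = D \<inter> stereo S x e f -` W"
      using stereo_points[OF fr(1)] by (auto simp: T_def W(2) D_def)
    then show ?thesis
      using continuous_open_preimage[OF continuous_on_stereo[of S x e f] open_stereo_disc W(1)]
          by (simp add: D_def)
  qed
  define F where "F = (\<lambda>w. \<psi> (stereo S x e f w))"
  have T0: "0 \<in> T" using D0 chart(2) by (simp add: T_def)
  have F0: "F 0 = 0" by (simp add: F_def chart(3))
  have GF: "G (F w) = w" if "w \<in> T" for w
    using that YU stereo_coord_stereo[OF fr(1)] by (simp add: G_def F_def T_def D_def)
  have cF: "continuous_on T F"
    unfolding F_def
  proof (rule continuous_on_compose2[of U \<psi>])
    show "continuous_on U \<psi>" using Y by (simp add: homeomorphism_def)
    show "continuous_on T (stereo S x e f)"
      by (rule continuous_on_subset[OF continuous_on_stereo]) (auto simp: T_def D_def)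
  qed (auto simp: T_def)
  have Fnz: "F w \<noteq> 0" if "w \<in> T" "w \<noteq> 0" for w
    using GF[OF that(1)] GF[OF T0] F0 that(2) by auto
  have dF: "(F has_field_derivative inverse g) (at 0)"
  proof (rule has_field_derivative_inverse_basic[where f = G and t = T])
    show "DERIV G (F 0) :> g" using g(2) F0 by simp
    show "continuous (at 0) F" using cF openT T0 by (simp add: continuous_on_eq_continuous_at)
  qed (use g openT T0 GF in auto)
  define H where "H = (\<lambda>w. if w = 0 then inverse g else F w / w)"
  have cH: "continuous_on T H"
    unfolding continuous_on_eq_continuous_at[OF openT]
  proof
    fix w assume w: "w \<in> T"
    show "isCont H w"
    proof (cases "w = 0")
      case True
      have "((\<lambda>h. F h / h) \<longlongrightarrow> H 0) (at 0)"
        using dF F0 by (simp add: has_field_derivative_iff H_def)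
      then show ?thesis
        unfolding True isCont_def by (rule Lim_transform_eventually) (auto simp: H_def eventually_at_filter)
    next
      case False
      have "isCont (\<lambda>w. F w / w) w"
        using cF openT w False by (intro continuous_intros) (simp_all add: continuous_on_eq_continuous_at)
      moreover have "\<forall>\<^sub>F v in nhds w. F v / v = H v"
        using t1_space_nhds[OF False] by eventually_elim (simp add: H_def)
      ultimately show ?thesis using isCont_cong by fastforce
    qed
  qed
  have sub: "cball 0 (gtan S R) \<subseteq> T"
    using chart(4) gtan_conformal_pos[OF R] unfolding closed_ball_eq_stereo_image[OF fr(1) \<epsilon> R]
    by (auto simp: T_def D_def)
  have "H w \<noteq> 0" if "w \<in> cball 0 (gtan S R)" for w
    using Fnz[of w] sub that g(1) by (auto simp: H_def)
  then obtain L where L: "continuous_on (cball 0 (gtan S R)) L" "\<And>w. w \<in> cball 0 (gtan S R) \<Longrightarrow> H w = exp (L w)"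
    using continuous_logarithm_on_contractible[OF continuous_on_subset[OF cH sub]
        convex_imp_contractible[OF convex_cball]]
    by metis
  have "F w = w * exp (L w)" if "w \<in> cball 0 (gtan S R)" for w
    using L(2)[OF that] F0 by (cases "w = 0") (simp_all add: H_def field_simps)
  with L(1) show ?thesis using that unfolding F_def by blast
qed

section \<open>Geodesic triangles\<close>

text \<open>
  The cosine of the angle opposite to the side \<open>a\<close> in a triangle with sides \<open>a, b, c\<close>.
\<close>

definition cosine_law :: "surface \<Rightarrow> real \<Rightarrow> real \<Rightarrow> real \<Rightarrow> real" where
  "cosine_law S a b c = curv S * (gcos S a - gcos S b * gcos S c) / (gsin S b * gsin S c)"

lemma unit_speed_geodesic_eq_geodesic_line:
  assumes "unit_speed_geodesic S \<sigma>"
  shows "\<sigma> = geodesic_line S (\<sigma> 0) (velocity \<sigma> 0)" "\<sigma> 0 \<in> points S" "velocity \<sigma> 0 \<in> unit_tangent S (\<sigma> 0)"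
proof -
  show v: "velocity \<sigma> 0 \<in> unit_tangent S (\<sigma> 0)" using assms by (simp add: unit_speed_geodesic_def)
  show "\<sigma> = geodesic_line S (\<sigma> 0) (velocity \<sigma> 0)"
    using assms v by (intro geodesic_eq_geodesic_line) (simp add: unit_speed_geodesic_def)
  show "\<sigma> 0 \<in> points S" using assms by (auto simp: unit_speed_geodesic_def geodesic_def)
qed

lemma geodesic_line_reverse:
  "gcos S l *\<^sub>R geodesic_line S x v l + gsin S l *\<^sub>R (- geodesic_line_velocity S x v l) = x"
  "- geodesic_line_velocity S (geodesic_line S x v l) (- geodesic_line_velocity S x v l) l = v"
proof -
  note g = gcos_gsin_square[of S l, unfolded power2_eq_square]
  have "gcos S l *\<^sub>R geodesic_line S x v l + gsin S l *\<^sub>R (- geodesic_line_velocity S x v l)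
      = (gcos S l * gcos S l + curv S * (gsin S l * gsin S l)) *\<^sub>R x"
    by (simp add: geodesic_line_def geodesic_line_velocity_def algebra_simps)
  then show "gcos S l *\<^sub>R geodesic_line S x v l + gsin S l *\<^sub>R (- geodesic_line_velocity S x v l) = x" unfolding g
      by simp
  have "- geodesic_line_velocity S (geodesic_line S x v l) (- geodesic_line_velocity S x v l) l
      = (gcos S l * gcos S l + curv S * (gsin S l * gsin S l)) *\<^sub>R v"
    by (simp add: geodesic_line_def geodesic_line_velocity_def algebra_simps)
  then show "- geodesic_line_velocity S (geodesic_line S x v l) (- geodesic_line_velocity S x v l) l
      = v" unfolding g by simp
qed

text \<open>
  The law of cosines: the form of the two vertices joined by \<open>\<sigma>1\<close> is computed along \<open>\<sigma>1\<close> and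
  from the third vertex.
\<close>

lemma triangle_angle:
  assumes geo: "unit_speed_geodesic S \<sigma>1" "unit_speed_geodesic S \<sigma>2" "unit_speed_geodesic S \<sigma>3"
    and ends: "\<sigma>1 a = \<sigma>2 0" "\<sigma>2 b = \<sigma>3 0" "\<sigma>3 c = \<sigma>1 0"
    and nz: "gsin S b \<noteq> 0" "gsin S c \<noteq> 0"
  shows "angle_between S (velocity \<sigma>3 0) (- velocity \<sigma>2 b) = arccos (cosine_law S a b c)"
proof -
  define V where "V = \<sigma>3 0"
  define v where "v = velocity \<sigma>3 0"
  define u where "u = - velocity \<sigma>2 b"
  define p where "p = \<sigma>2 0"
  define q where "q = velocity \<sigma>2 0"
  note a1 = unit_speed_geodesic_eq_geodesic_line[OF geo(1)]
      and a2 = unit_speed_geodesic_eq_geodesic_line[OF geo(2)]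
    and a3 = unit_speed_geodesic_eq_geodesic_line[OF geo(3)]
  have s2: "\<sigma>2 = geodesic_line S p q" using a2(1) by (simp add: p_def q_def)
  have Vb: "V = geodesic_line S p q b" using ends(2) s2 by (simp add: V_def)
  have ub: "u = - geodesic_line_velocity S p q b" by (simp add: u_def s2)
  have Vf: "form S V V = curv S" "form S V v = 0" "form S v V = 0" "form S v v = 1"
    using a3 points_form by (auto simp: V_def v_def unit_tangent_def tangent_space_def form_commute)
  have uf: "form S V u = 0" "form S u V = 0" "form S u u = 1"
    using geodesic_line_form[of p S q b] a2 unfolding Vb ub p_def[symmetric] q_def[symmetric]
    by (simp_all add: form_linear form_commute)
  have P: "p = gcos S b *\<^sub>R V + gsin S b *\<^sub>R u"
    using geodesic_line_reverse(1)[of S b p q] unfolding Vb ub by simp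
  have Q: "\<sigma>3 c = gcos S c *\<^sub>R V + gsin S c *\<^sub>R v"
    using a3(1) unfolding V_def v_def geodesic_line_def by metis
  have "form S (\<sigma>1 0) (\<sigma>1 a) = curv S * gcos S a"
  proof -
    have "\<sigma>1 a = gcos S a *\<^sub>R \<sigma>1 0 + gsin S a *\<^sub>R velocity \<sigma>1 0"
      using a1(1) unfolding geodesic_line_def by metis
    then show ?thesis
      using a1(2,3) points_form[of "\<sigma>1 0" S] by (simp add: form_linear unit_tangent_def tangent_space_def)
  qed
  moreover have "form S (\<sigma>1 0) (\<sigma>1 a) = curv S * gcos S b * gcos S c + gsin S b * gsin S c * form S v u"
    unfolding ends(1) ends(3)[symmetric] Q unfolding p_def[symmetric] P
    by (simp add: form_linear Vf uf)
  ultimately have "form S v u = cosine_law S a b c"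
    using nz by (simp add: cosine_law_def field_simps)
  then show ?thesis
    unfolding angle_between_def v_def[symmetric] u_def[symmetric] Vf uf by simp
qed

lemma gsin_pos:
  assumes "0 < l" "admissible S l"
  shows "gsin S l > 0"
  using assms by (cases S) (auto simp: admissible_def sin_gt_zero)

text \<open>
  The two bounds compare \<open>a\<close> with \<open>b + c\<close> and with \<open>\<bar>b - c\<bar>\<close>, through the addition theorems.
\<close>

lemma cosine_law_bounds:
  assumes "0 < a" "0 < b" "0 < c" "a < b + c" "b < c + a" "c < a + b" "admissible S (a + b + c)"
  shows "- 1 < cosine_law S a b c" "cosine_law S a b c < 1"
proof -
  have pos: "gsin S b * gsin S c > 0"
    using assms by (intro mult_pos_pos gsin_pos) (auto simp: admissible_def)
  have "- (gsin S b * gsin S c) < curv S * (gcos S a - gcos S b * gcos S c) \<and>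
    curv S * (gcos S a - gcos S b * gcos S c) < gsin S b * gsin S c"
  proof (cases S)
    case Sphere
    then have l: "a + b + c < pi" using assms by (simp add: admissible_def)
    have "cos (b + c) < cos a" using assms l by (intro cos_monotone_0_pi) auto
    moreover have "cos a < cos \<bar>b - c\<bar>" using assms l by (intro cos_monotone_0_pi) auto
    ultimately show ?thesis using Sphere by (simp add: cos_add cos_diff)
  next
    case Hyperbolic_Plane
    have "cosh a < cosh (b + c)" using assms by (simp add: cosh_real_nonneg_less_iff)
    moreover have "cosh \<bar>b - c\<bar> < cosh a"
      using assms by (subst cosh_real_nonneg_less_iff) auto
    ultimately show ?thesis using Hyperbolic_Plane by (simp add: cosh_add cosh_diff)
  qed
  then show "- 1 < cosine_law S a b c" "cosine_law S a b c < 1"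
    unfolding cosine_law_def using pos by (auto simp: field_simps)
qed

lemma geodesic_triangle_angles:
  assumes "geodesic_triangle S a b c \<alpha> \<beta> \<gamma>"
    and "gsin S a \<noteq> 0" "gsin S b \<noteq> 0" "gsin S c \<noteq> 0"
  shows "\<alpha> = arccos (cosine_law S a b c)" "\<beta> = arccos (cosine_law S b c a)" "\<gamma> = arccos (cosine_law S c a b)"
proof -
  obtain \<sigma>1 \<sigma>2 \<sigma>3 where geo: "unit_speed_geodesic S \<sigma>1" "unit_speed_geodesic S \<sigma>2" "unit_speed_geodesic S \<sigma>3"
    and ends: "\<sigma>1 a = \<sigma>2 0" "\<sigma>2 b = \<sigma>3 0" "\<sigma>3 c = \<sigma>1 0"
    and angles: "\<alpha> = angle_between S (velocity \<sigma>3 0) (- velocity \<sigma>2 b)"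
        "\<beta> = angle_between S (velocity \<sigma>1 0) (- velocity \<sigma>3 c)"
        "\<gamma> = angle_between S (velocity \<sigma>2 0) (- velocity \<sigma>1 a)"
    using assms(1) unfolding geodesic_triangle_def by blast
  show "\<alpha> = arccos (cosine_law S a b c)" "\<beta> = arccos (cosine_law S b c a)" "\<gamma> = arccos (cosine_law S c a b)"
    unfolding angles using triangle_angle geo ends assms(2-) by blast+
qed

text \<open>
  Two sides are drawn from \<open>x\<close> at the angle prescribed by the law of cosines, and their ends then have
  the distance needed for the third side.
\<close>

lemma geodesic_triangle_exists:
  assumes "0 < a" "0 < b" "0 < c" "a < b + c" "b < c + a" "c < a + b" "admissible S (a + b + c)"
    and fr: "frame S \<epsilon> x e f"
  shows "geodesic_triangle S a b c (arccos (cosine_law S a b c)) (arccos (cosine_law S b c a))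
      (arccos (cosine_law S c a b))"
proof -
  have adm: "admissible S a" "admissible S b" "admissible S c" using assms by (auto simp: admissible_def)
  have sp: "gsin S a > 0" "gsin S b > 0" "gsin S c > 0" using adm assms(1-3) gsin_pos by auto
  define \<alpha> where "\<alpha> = arccos (cosine_law S a b c)"
  have cos\<alpha>: "cos \<alpha> = cosine_law S a b c"
    unfolding \<alpha>_def using cosine_law_bounds[OF assms(1-7)] by (intro cos_arccos) auto
  define u where "u = cos \<alpha> *\<^sub>R e + sin \<alpha> *\<^sub>R f"
  have x: "x \<in> points S" "e \<in> unit_tangent S x" "u \<in> unit_tangent S x"
    using frame_rotate[OF fr, of \<alpha>] fr by (auto simp: u_def frame_def unit_tangent_def tangent_space_def)
  have eu: "form S e u = cosine_law S a b c" using frame_form[OF fr] by (simp add: u_def form_linear cos\<alpha>)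
  define p where "p = geodesic_line S x e c"
  define q where "q = geodesic_line S x u b"
  have pq: "p \<in> points S" "q \<in> points S" using geodesic_line_points x by (simp_all add: p_def q_def)
  have fpq: "form S p q = curv S * gcos S a"
  proof -
    have f: "form S x x = curv S" "form S x u = 0" "form S e x = 0"
      using x points_form by (auto simp: unit_tangent_def tangent_space_def form_commute)
    have "form S p q = curv S * gcos S b * gcos S c + gsin S b * gsin S c * cosine_law S a b c"
      unfolding p_def q_def geodesic_line_def by (simp add: form_linear f eu)
    also have "gsin S b * gsin S c * cosine_law S a b c = curv S * (gcos S a - gcos S b * gcos S c)"
      using sp by (simp add: cosine_law_def)
    finally show ?thesis by (simp add: algebra_simps)
  qed
  define v where "v = (q - gcos S a *\<^sub>R p) /\<^sub>R gsin S a"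
  have v: "v \<in> unit_tangent S p"
  proof -
    have f: "form S p p = curv S" "form S q q = curv S" "form S q p = curv S * gcos S a"
      using pq points_form fpq by (auto simp: form_commute)
    have "form S p v = 0" by (simp add: v_def form_linear f fpq)
    moreover have "form S v v = 1"
    proof -
      have "form S v v = curv S * (1 - gcos S a * gcos S a) / (gsin S a * gsin S a)"
        by (simp add: v_def form_linear f fpq divide_inverse algebra_simps)
      also have "1 - gcos S a * gcos S a = curv S * (gsin S a * gsin S a)"
        using gcos_gsin_square[of S a] by (simp add: power2_eq_square)
      finally show ?thesis using sp by simp
    qed
    ultimately show ?thesis by (simp add: unit_tangent_def tangent_space_def)
  qed
  define \<sigma>1 where "\<sigma>1 = geodesic_line S p v"
  define \<sigma>2 where "\<sigma>2 = geodesic_line S q (- geodesic_line_velocity S x u b)"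
  define \<sigma>3 where "\<sigma>3 = geodesic_line S x e"
  have "- geodesic_line_velocity S x u b \<in> unit_tangent S q"
    using geodesic_line_unit_speed(3)[OF x(1,3), of b]
        by (simp add: q_def unit_tangent_def tangent_space_def form_linear)
  then have geo: "unit_speed_geodesic S \<sigma>1" "unit_speed_geodesic S \<sigma>2" "unit_speed_geodesic S \<sigma>3"
    using geodesic_line_unit_speed(1) pq v x by (auto simp: \<sigma>1_def \<sigma>2_def \<sigma>3_def)
  have ends: "\<sigma>1 a = \<sigma>2 0" "\<sigma>2 b = \<sigma>3 0" "\<sigma>3 c = \<sigma>1 0"
  proof -
    show "\<sigma>1 a = \<sigma>2 0" using sp by (simp add: \<sigma>1_def \<sigma>2_def geodesic_line_def v_def)
    show "\<sigma>2 b = \<sigma>3 0"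
      using geodesic_line_reverse(1)[of S b x u] by (simp add: \<sigma>2_def \<sigma>3_def q_def geodesic_line_def)
    show "\<sigma>3 c = \<sigma>1 0" by (simp add: \<sigma>1_def \<sigma>3_def p_def)
  qed
  have "geodesic_triangle S a b c (angle_between S (velocity \<sigma>3 0) (- velocity \<sigma>2 b))
      (angle_between S (velocity \<sigma>1 0) (- velocity \<sigma>3 c)) (angle_between S (velocity \<sigma>2 0) (- velocity \<sigma>1 a))"
    unfolding geodesic_triangle_def using geo ends by blast
  then show ?thesis
    using geodesic_triangle_angles[of S a b c] sp by (metis less_irrefl)
qed

lemma cosine_law_gtan:
  assumes "0 < l1" "0 < l2" "0 < l3" "admissible S l1" "admissible S l2" "admissible S l3"
  defines "a \<equiv> gtan S l1" and "b \<equiv> gtan S l2" and "c \<equiv> gtan S l3"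
  shows "cosine_law S l1 l2 l3 = (b\<^sup>2 + c\<^sup>2 - a\<^sup>2 * (1 + (b * c)\<^sup>2)) / (2 * b * c * (1 + curv S * a\<^sup>2))"
proof -
  have pos: "1 + curv S * a\<^sup>2 > 0" "1 + curv S * b\<^sup>2 > 0" "1 + curv S * c\<^sup>2 > 0"
    using gtan_conformal_pos[of S l1 "of_real a"] gtan_conformal_pos[of S l2 "of_real b"]
      gtan_conformal_pos[of S l3 "of_real c"] gtan_nonneg assms(4-6) by (auto simp: a_def b_def c_def)
  have bc: "b > 0" "c > 0"
    using gtan_strict_mono[of 0 l2 S] gtan_strict_mono[of 0 l3 S] assms(1-6) by (auto simp: b_def c_def)
  define ha hb hc where h: "ha = 1 + curv S * a\<^sup>2" "hb = 1 + curv S * b\<^sup>2" "hc = 1 + curv S * c\<^sup>2"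
  have nz: "ha \<noteq> 0" "hb \<noteq> 0" "hc \<noteq> 0" using pos h by auto
  have C: "gcos S l1 = (1 - curv S * a\<^sup>2) / ha" "gcos S l2 = (1 - curv S * b\<^sup>2) / hb" "gcos S l3
      = (1 - curv S * c\<^sup>2) / hc"
    "gsin S l2 = 2 * b / hb" "gsin S l3 = 2 * c / hc"
    using gcos_gsin_gtan assms(4-6) by (simp_all add: a_def b_def c_def h)
  have "cosine_law S l1 l2 l3
      = curv S * ((1 - curv S * a\<^sup>2) * hb * hc - ha * (1 - curv S * b\<^sup>2) * (1 - curv S * c\<^sup>2)) / (4 * b * c * ha)"
    unfolding cosine_law_def C using nz bc by (simp add: field_simps)
  also have "curv S * ((1 - curv S * a\<^sup>2) * hb * hc - ha * (1 - curv S * b\<^sup>2) * (1 - curv S * c\<^sup>2))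
      = 2 * (b\<^sup>2 + c\<^sup>2 - a\<^sup>2 * (1 + (b * c)\<^sup>2))"
    unfolding h by (cases S) (simp_all add: power_mult_distrib algebra_simps)
  also have "2 * (b\<^sup>2 + c\<^sup>2 - a\<^sup>2 * (1 + (b * c)\<^sup>2)) / (4 * b * c * ha)
      = (b\<^sup>2 + c\<^sup>2 - a\<^sup>2 * (1 + (b * c)\<^sup>2)) / (2 * b * c * ha)"
  proof -
    have "2 * r / (4 * b * c * ha) = r / (2 * b * c * ha)" for r
      using nz bc by (simp add: field_simps)
    then show ?thesis .
  qed
  finally show ?thesis by (simp only: h)
qed

text \<open>
  In stereographic coordinates at the start of the second joint, the end of the third joint is
  \<open>(b + c * cis \<theta>) / (1 - \<kappa> * b * c * cis \<theta>)\<close>. Its modulus is \<open>a\<close>, so the triangle closes, and its argument is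
  the angle between the second side and the closing side. The right-hand side is the law of cosines
  for that angle in terms of the half-length parameters.
\<close>

lemma Arg_quotient_angle:
  fixes \<kappa> a b c \<theta> :: real
  assumes \<kappa>: "\<kappa> = 1 \<or> \<kappa> = - 1" and pos: "a > 0" "b > 0" "c > 0" "b * c < 1"
    and h: "1 + \<kappa> * a\<^sup>2 > 0" "1 + \<kappa> * b\<^sup>2 > 0" "1 + \<kappa> * c\<^sup>2 > 0"
    and \<theta>: "0 < \<theta>" "\<theta> < pi" "cos \<theta> = (a\<^sup>2 * (1 + (b * c)\<^sup>2) - b\<^sup>2 - c\<^sup>2) / (2 * b * c * (1 + \<kappa> * a\<^sup>2))"
  shows "Arg (of_real b + of_real c * cis \<theta>) - Arg (1 - of_real (\<kappa> * b * c) * cis \<theta>)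
    = arccos ((a\<^sup>2 + b\<^sup>2 - c\<^sup>2 * (1 + (a * b)\<^sup>2)) / (2 * a * b * (1 + \<kappa> * c\<^sup>2)))"
proof -
  define B where "B = of_real b + of_real c * cis \<theta>"
  define A where "A = 1 - of_real (\<kappa> * b * c) * cis \<theta>"
  define y where "y = cos \<theta>"
  define \<delta> where "\<delta> = Arg B - Arg A"
  have sin\<theta>: "sin \<theta> > 0" using \<theta> by (intro sin_gt_zero)
  have ss: "(sin \<theta>)\<^sup>2 = 1 - y\<^sup>2" by (simp add: sin_squared_eq y_def)
  have kk: "\<kappa> * \<kappa> = 1" "\<kappa>\<^sup>2 = 1" using \<kappa> by auto
  have ReA: "Re A > 0"
  proof -
    have "norm (of_real (\<kappa> * b * c) * cis \<theta>) = b * c" using \<kappa> pos by (auto simp: norm_mult)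
    then have "\<bar>Re (of_real (\<kappa> * b * c) * cis \<theta>)\<bar> \<le> b * c" by (metis abs_Re_le_cmod)
    moreover have "Re (1 - w) = 1 - Re w" for w by simp
    ultimately show ?thesis using pos unfolding A_def by fastforce
  qed
  have ImB: "Im B > 0" using pos sin\<theta> by (simp add: B_def)
  have argA: "\<bar>Arg A\<bar> < pi / 2" using ReA unfolding Arg_Re_pos by simp
  have argB: "0 < Arg B" "Arg B < pi" using ImB Arg_lt_pi by auto
  have nz: "A \<noteq> 0" "B \<noteq> 0" using ReA ImB by auto
  have polar: "B * cnj A = of_real (norm B * norm A) * cis \<delta>"
  proof -
    have "A = of_real (norm A) * cis (Arg A)" "B = of_real (norm B) * cis (Arg B)"
      using nz by (simp_all add: cis_Arg sgn_eq)
    then have "B * cnj A = of_real (norm B) * cis (Arg B) * cnj (of_real (norm A) * cis (Arg A))"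
      by simp
    then show ?thesis by (simp add: \<delta>_def cis_cnj cis_mult[symmetric] cis_divide[symmetric] divide_inverse
        mult_ac)
  qed
  have n0: "norm B * norm A > 0" using nz by simp
  have "Im (B * cnj A) = c * sin \<theta> * (1 + \<kappa> * b\<^sup>2)"
    by (simp add: A_def B_def power2_eq_square algebra_simps)
  then have "norm B * norm A * sin \<delta> > 0"
    unfolding polar using pos sin\<theta> h by simp
  then have sin\<delta>: "sin \<delta> > 0" using n0 by (simp add: zero_less_mult_iff)
  have "0 < \<delta>"
  proof (rule ccontr)
    assume "\<not> 0 < \<delta>"
    then have "sin (- \<delta>) \<ge> 0" using argA argB by (intro sin_ge_zero) (auto simp: \<delta>_def)
    then show False using sin\<delta> by simp
  qed
  moreover have "\<delta> < pi"
  proof (rule ccontr)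
    assume "\<not> \<delta> < pi"
    then have "sin (\<delta> - pi) \<ge> 0" using argA argB by (intro sin_ge_zero) (auto simp: \<delta>_def)
    then show False using sin\<delta> by simp
  qed
  ultimately have "\<delta> = arccos (cos \<delta>)" by (simp add: arccos_cos)
  moreover have "cos \<delta> = (a\<^sup>2 + b\<^sup>2 - c\<^sup>2 * (1 + (a * b)\<^sup>2)) / (2 * a * b * (1 + \<kappa> * c\<^sup>2))"
  proof -
    define H where "H = 1 + \<kappa> * a\<^sup>2"
    define K where "K = a\<^sup>2 * (1 + (b * c)\<^sup>2) - b\<^sup>2 - c\<^sup>2"
    have H0: "H > 0" using h(1) by (simp add: H_def)
    have "y = K / (2 * b * c * H)" using \<theta>(3) by (simp only: y_def K_def H_def)
    then have yK: "2 * b * c * y * H = K" using pos H0 by simp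
    have "(norm A)\<^sup>2 = 1 - 2 * \<kappa> * b * c * y + \<kappa>\<^sup>2 * (b * c)\<^sup>2 * (y\<^sup>2 + (sin \<theta>)\<^sup>2)"
      unfolding cmod_power2 A_def by (simp add: power2_diff power_mult_distrib y_def[symmetric] algebra_simps)
    then have nA: "(norm A)\<^sup>2 = 1 + (b * c)\<^sup>2 - 2 * \<kappa> * b * c * y"
      unfolding ss kk by simp
    have "(norm B)\<^sup>2 = b\<^sup>2 + 2 * b * c * y + c\<^sup>2 * (y\<^sup>2 + (sin \<theta>)\<^sup>2)"
      unfolding cmod_power2 B_def by (simp add: power2_sum power_mult_distrib y_def[symmetric] algebra_simps)
    then have nB: "(norm B)\<^sup>2 = b\<^sup>2 + c\<^sup>2 + 2 * b * c * y"
      unfolding ss by simp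
    have HnA: "H * (norm A)\<^sup>2 = (1 + \<kappa> * b\<^sup>2) * (1 + \<kappa> * c\<^sup>2)"
    proof -
      have "H * (norm A)\<^sup>2 = H * (1 + (b * c)\<^sup>2) - \<kappa> * (2 * b * c * y * H)"
        unfolding nA by (simp add: algebra_simps)
      also have "\<dots> = (1 + \<kappa> * b\<^sup>2) * (1 + \<kappa> * c\<^sup>2)"
        unfolding yK unfolding K_def H_def using \<kappa> by (auto simp: power_mult_distrib algebra_simps)
      finally show ?thesis .
    qed
    have "H * (norm B)\<^sup>2 = H * (b\<^sup>2 + c\<^sup>2) + 2 * b * c * y * H"
      unfolding nB by (simp add: algebra_simps)
    also have "\<dots> = a\<^sup>2 * ((1 + \<kappa> * b\<^sup>2) * (1 + \<kappa> * c\<^sup>2))"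
      unfolding yK unfolding K_def H_def using \<kappa> by (auto simp: power_mult_distrib algebra_simps)
    also have "\<dots> = H * (a * norm A)\<^sup>2" unfolding HnA[symmetric] by (simp add: power_mult_distrib)
    finally have "(norm B)\<^sup>2 = (a * norm A)\<^sup>2" using H0 by simp
    then have nBA: "norm B = a * norm A" using pos by (simp add: power2_eq_iff_nonneg)
    have re: "Re (B * cnj A) = b * (1 - \<kappa> * c\<^sup>2) + c * (1 - \<kappa> * b\<^sup>2) * y"
    proof -
      have "Re (B * cnj A) = b + c * y - \<kappa> * b\<^sup>2 * c * y - \<kappa> * b * c\<^sup>2 * (y\<^sup>2 + (sin \<theta>)\<^sup>2)"
        by (simp add: A_def B_def y_def[symmetric] power2_eq_square algebra_simps)
      then show ?thesis unfolding ss by (simp add: algebra_simps)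
    qed
    have "2 * b * H * Re (B * cnj A) = 2 * b\<^sup>2 * (1 - \<kappa> * c\<^sup>2) * H + (1 - \<kappa> * b\<^sup>2) * (2 * b * c * y * H)"
      unfolding re by (simp add: power2_eq_square algebra_simps)
    also have "\<dots> = (1 + \<kappa> * b\<^sup>2) * (a\<^sup>2 + b\<^sup>2 - c\<^sup>2 * (1 + (a * b)\<^sup>2))"
      unfolding yK unfolding K_def H_def using \<kappa> by (auto simp: power2_eq_square algebra_simps)
    finally have e1: "2 * b * H * Re (B * cnj A) = (1 + \<kappa> * b\<^sup>2) * (a\<^sup>2 + b\<^sup>2 - c\<^sup>2 * (1 + (a * b)\<^sup>2))" .
    have "Re (B * cnj A) = a * (norm A)\<^sup>2 * cos \<delta>"
      unfolding polar nBA by (simp add: power2_eq_square)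
    then have "2 * a * b * cos \<delta> * (H * (norm A)\<^sup>2) = 2 * b * H * Re (B * cnj A)" by simp
    then have "(1 + \<kappa> * b\<^sup>2) * (2 * a * b * cos \<delta> * (1 + \<kappa> * c\<^sup>2))
        = (1 + \<kappa> * b\<^sup>2) * (a\<^sup>2 + b\<^sup>2 - c\<^sup>2 * (1 + (a * b)\<^sup>2))"
      unfolding e1 HnA by (simp add: mult_ac)
    then have "cos \<delta> * (2 * a * b * (1 + \<kappa> * c\<^sup>2)) = a\<^sup>2 + b\<^sup>2 - c\<^sup>2 * (1 + (a * b)\<^sup>2)"
      using h(2) by (simp add: mult_ac)
    moreover have "2 * a * b * (1 + \<kappa> * c\<^sup>2) \<noteq> 0" using pos h(3) by simp
    ultimately show ?thesis using nonzero_eq_divide_eq by blast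
  qed
  ultimately show ?thesis unfolding \<delta>_def A_def B_def by simp
qed

section \<open>The angular velocity of the arm\<close>

text \<open>
  The coordinate of the end of the arm is \<open>N\<close> times a factor whose argument is \<open>\<theta>1 + \<omega>1 * t\<close> up to a bounded error:
  the two denominators of the Moebius transformations have positive real part, and the
  change of chart is the exponential of a bounded function.
\<close>

lemma arm_chart_angular_velocity:
  fixes S :: surface and x e f :: "real^3" and \<epsilon> l1 l2 l3 \<omega>1 \<omega>2 \<omega>3 \<theta>1 \<theta>2 \<theta>3 :: real
  defines "joints \<equiv> \<lambda>t. [(l1, \<theta>1 + \<omega>1 * t), (l2, \<theta>2 + \<omega>2 * t), (l3, \<theta>3 + \<omega>3 * t)]"
    and "N \<equiv> \<lambda>t. of_real (gtan S l1) * (1 - of_real (curv S * gtan S l2 * gtan S l3) * cis (\<theta>3 + \<omega>3 * t))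
      + cis (\<theta>2 + \<omega>2 * t) * (of_real (gtan S l2) + of_real (gtan S l3) * cis (\<theta>3 + \<omega>3 * t))"
  assumes fr: "frame S \<epsilon> x e f" "\<epsilon> = 1 \<or> \<epsilon> = - 1"
    and len: "0 \<le> l1" "0 \<le> l2" "0 \<le> l3" "admissible S (l1 + l2 + l3)"
    and chart: "lagrange_chart S \<epsilon> x (\<lambda>t. arm_end S \<epsilon> x e (joints t)) U \<psi>"
    and vel: "has_asymptotic_angular_velocity N \<omega>"
  shows "has_asymptotic_angular_velocity (\<lambda>t. \<psi> (arm_end S \<epsilon> x e (joints t))) (\<omega>1 + \<omega>)"
proof -
  have \<epsilon>: "\<epsilon> \<noteq> 0" using fr by auto
  define a b c \<kappa> where abc: "a = gtan S l1" "b = gtan S l2" "c = gtan S l3" "\<kappa> = curv S"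
  define w where "w = (\<lambda>t. arm_coord S (joints t))"
  have sum: "(\<Sum>j\<leftarrow>joints t. fst j) = l1 + l2 + l3" for t by (simp add: joints_def)
  have nn: "fst j \<ge> 0" if "j \<in> set (joints t)" for j t using that len by (auto simp: joints_def)
  have z: "arm_end S \<epsilon> x e (joints t) = stereo S x e f (w t)" for t
    unfolding w_def using nn len by (intro arm_end_stereo[OF fr(2,1)]) (auto simp: sum)
  have wb: "cmod (w t) \<le> gtan S (l1 + l2 + l3)" for t
    using arm_coord_bound[of "joints t" S] nn len(4) unfolding w_def sum by auto

  (* The radius belonging to the chart may exceed the range of the stereographic coordinate, as on a
     sphere; it is then replaced by the total length of the arm. *)
  obtain R where R: "admissible S R" "closed_ball S x R \<subseteq> U" "\<And>t. t \<ge> 0 \<Longrightarrow> cmod (w t) \<le> gtan S R"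
  proof -
    obtain R' where R': "closed_ball S x R' \<subseteq> U" "\<And>t. t \<ge> 0 \<Longrightarrow> stereo S x e f (w t) \<in> closed_ball S x R'"
      using chart unfolding lagrange_chart_def z by blast
    show ?thesis
    proof (cases "l1 + l2 + l3 \<le> R'")
      case True
      then have "closed_ball S x (l1 + l2 + l3) \<subseteq> closed_ball S x R'"
        by (force simp: closed_ball_def)
      then show ?thesis using that[of "l1 + l2 + l3"] len(4) R'(1) wb by blast
    next
      case False
      have "R' \<ge> 0" using R'(2)[of 0] by (auto simp: closed_ball_def)
      then have adm: "admissible S R'" using False len(4) by (auto simp: admissible_def)
      have "cmod (w t) \<le> gtan S R'" if t: "t \<ge> 0" for t
      proof -
        obtain v where v': "v \<in> cball 0 (gtan S R')" "stereo S x e f (w t) = stereo S x e f v"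
          using R'(2)[OF t] unfolding closed_ball_eq_stereo_image[OF fr(1) \<epsilon> adm] by blast
        then have v: "cmod v \<le> gtan S R'" "stereo S x e f v = stereo S x e f (w t)" by simp_all
        have "w t = v"
          using stereo_coord_stereo[OF fr(1) gtan_conformal_pos[OF len(4) wb[of t]]]
            stereo_coord_stereo[OF fr(1) gtan_conformal_pos[OF adm v(1)]] v(2) by simp
        then show ?thesis using v(1) by simp
      qed
      then show ?thesis using that[of R'] adm R'(1) by blast
    qed
  qed
  obtain L where L: "continuous_on (cball 0 (gtan S R)) L"
      "\<And>v. v \<in> cball 0 (gtan S R) \<Longrightarrow> \<psi> (stereo S x e f v) = v * exp (L v)"
    using chart_stereo_quotient[OF fr R(1) _ _ _ R(2)] chart unfolding lagrange_chart_def by metis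

  define E where "E = (\<lambda>t. 1 - of_real (\<kappa> * b) * (cis (\<theta>3 + \<omega>3 * t) * of_real c))"
  define u where "u = (\<lambda>t. (cis (\<theta>3 + \<omega>3 * t) * of_real c + of_real b) / E t)"
  define F where "F = (\<lambda>t. 1 - of_real (\<kappa> * a) * (cis (\<theta>2 + \<omega>2 * t) * u t))"
  have pos: "Re (E t) > 0" "Re (F t) > 0" for t
  proof -
    have adm: "admissible S (l3 + l2)" "admissible S ((l3 + l2) + l1)" "admissible S l3"
      using len by (auto simp: admissible_def add_ac)
    have c: "cmod (cis (\<theta>3 + \<omega>3 * t) * of_real c) \<le> gtan S l3"
      using gtan_nonneg[OF adm(3)] by (simp add: abc norm_mult)
    note m = mobius_bound[OF len(3,2) adm(1) c]
    have "cmod (u t) \<le> gtan S (l3 + l2)"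
      using m(2) by (simp add: mobius_def u_def E_def abc)
    then have "cmod (cis (\<theta>2 + \<omega>2 * t) * u t) \<le> gtan S (l3 + l2)"
      by (simp add: norm_mult)
    note m' = mobius_bound(1)[OF _ len(1) adm(2) this]
    have half: "Re (1 - v) > 0" if "cmod v < 1" for v
      using abs_Re_le_cmod[of v] that by simp
    show "Re (E t) > 0" using half[OF m(1)] by (simp only: E_def abc)
    have "0 \<le> l3 + l2" using len by simp
    from half[OF m'[OF this]] show "Re (F t) > 0" by (simp only: F_def abc)
  qed
  have nz: "E t \<noteq> 0" "F t \<noteq> 0" for t using pos[of t] by auto
  have w_eq: "w t = cis (\<theta>1 + \<omega>1 * t) * (N t / (E t * F t))" for t
  proof -
    have "w t = cis (\<theta>1 + \<omega>1 * t) * ((cis (\<theta>2 + \<omega>2 * t) * u t + of_real a) / F t)"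
      by (simp add: w_def joints_def mobius_def u_def E_def F_def abc)
    moreover have "cis (\<theta>2 + \<omega>2 * t) * u t + of_real a = N t / E t"
    proof -
      have "(cis (\<theta>2 + \<omega>2 * t) * u t + of_real a) * E t
          = cis (\<theta>2 + \<omega>2 * t) * (cis (\<theta>3 + \<omega>3 * t) * of_real c + of_real b) + of_real a * E t"
        using nz(1)[of t] by (simp add: u_def distrib_right)
      also have "\<dots> = N t"
        by (simp add: N_def E_def abc algebra_simps)
      finally show ?thesis using nz(1)[of t] by (simp add: field_simps)
    qed
    ultimately show ?thesis by simp
  qed
  have cE: "continuous_on T E" for T unfolding E_def by (intro continuous_intros)
  have cu: "continuous_on T u" for T unfolding u_def by (intro continuous_intros cE) (use nz in auto)
  have cF: "continuous_on T F" for T unfolding F_def by (intro continuous_intros cu)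
  have cw: "continuous_on T w" for T
    unfolding w_eq N_def by (intro continuous_intros cE cF) (use nz in auto)
  have cLw: "continuous_on {0..} (\<lambda>t. L (w t))"
    by (rule continuous_on_compose2[OF L(1) cw]) (use R(3) in auto)
  define B where "B = (\<lambda>t. Im (L (w t)) - Arg (E t) - Arg (F t))"
  have cB: "continuous_on {0..} B"
    unfolding B_def using pos pos_Re_not_nonpos by (intro continuous_intros cLw cE cF) auto
  obtain M where M: "\<And>t. t \<ge> 0 \<Longrightarrow> \<bar>B t\<bar> \<le> M"
  proof -
    have "bounded (L ` cball 0 (gtan S R))"
      using L(1) compact_continuous_image compact_cball compact_imp_bounded by blast
    then obtain M where M: "\<And>v. v \<in> cball 0 (gtan S R) \<Longrightarrow> cmod (L v) \<le> M"
      unfolding bounded_iff by blast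
    have "\<bar>B t\<bar> \<le> M + pi + pi" if "t \<ge> 0" for t
    proof -
      have "\<bar>Im (L (w t))\<bar> \<le> M"
        using M[of "w t"] R(3)[OF that] abs_Im_le_cmod[of "L (w t)"] by auto
      moreover have "\<bar>Arg v\<bar> \<le> pi" for v using mpi_less_Arg[of v] Arg_le_pi[of v] by linarith
      from this[of "E t"] this[of "F t"] calculation show ?thesis unfolding B_def by linarith
    qed
    with that show ?thesis by blast
  qed
  show ?thesis
  proof (rule asymptotic_angular_velocity_mult[OF vel])
    show "continuous_on {0..} (\<lambda>t. \<theta>1 + \<omega>1 * t + B t)" by (intro continuous_intros cB)
    show "((\<lambda>t. (\<theta>1 + \<omega>1 * t + B t) / t) \<longlongrightarrow> \<omega>1) at_top"
    proof -
      have inv: "((\<lambda>t. k / t) \<longlongrightarrow> 0) at_top" for k :: real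
        by (intro tendsto_divide_0[OF tendsto_const] filterlim_at_top_imp_at_infinity filterlim_ident)
      have "((\<lambda>t. B t / t) \<longlongrightarrow> 0) at_top"
        by (rule Lim_null_comparison[OF _ inv[of M]])
          (use M in \<open>auto intro!: eventually_mono[OF eventually_gt_at_top[of 0]] divide_right_mono simp:
              abs_divide\<close>)
      from tendsto_add[OF tendsto_add[OF inv[of \<theta>1] tendsto_const[of \<omega>1]] this]
      have "((\<lambda>t. \<theta>1 / t + \<omega>1 + B t / t) \<longlongrightarrow> \<omega>1) at_top" by simp
      moreover have "\<forall>\<^sub>F t in at_top. \<theta>1 / t + \<omega>1 + B t / t = (\<theta>1 + \<omega>1 * t + B t) / t"
        using eventually_gt_at_top[of 0] by eventually_elim (simp add: add_divide_distrib)
      ultimately show ?thesis by (rule Lim_transform_eventually)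
    qed
    fix t :: real assume t: "t \<ge> 0"
    show "exp (Re (L (w t))) / (cmod (E t) * cmod (F t)) \<noteq> 0" using nz by simp
    have inv: "inverse v = of_real (inverse (cmod v)) * cis (- Arg v)" if "v \<noteq> 0" for v
    proof -
      have "v = of_real (cmod v) * cis (Arg v)" using that by (simp add: cis_Arg sgn_eq)
      then have "inverse v = inverse (of_real (cmod v) * cis (Arg v))" by simp
      then show ?thesis by simp
    qed
    have "\<psi> (arm_end S \<epsilon> x e (joints t)) = w t * exp (L (w t))"
      unfolding z using R(3)[OF t] by (intro L(2)) simp
    also have "\<dots> = N t * (cis (\<theta>1 + \<omega>1 * t) * (inverse (E t) * inverse (F t)) * exp (L (w t)))"
      unfolding w_eq by (simp add: divide_inverse mult_ac)
    also have "exp (L (w t)) = of_real (exp (Re (L (w t)))) * cis (Im (L (w t)))"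
      by (simp add: exp_eq_polar)
    also have "cis (\<theta>1 + \<omega>1 * t) * (inverse (E t) * inverse (F t))
        * (of_real (exp (Re (L (w t)))) * cis (Im (L (w t))))
        = of_real (exp (Re (L (w t))) / (cmod (E t) * cmod (F t)))
          * (cis (\<theta>1 + \<omega>1 * t) * cis (Im (L (w t))) * cis (- Arg (E t)) * cis (- Arg (F t)))"
      unfolding inv[OF nz(1)] inv[OF nz(2)] by (simp add: divide_inverse mult_ac)
    also have "cis (\<theta>1 + \<omega>1 * t) * cis (Im (L (w t))) * cis (- Arg (E t)) * cis (- Arg (F t))
        = cis (\<theta>1 + \<omega>1 * t + B t)"
      unfolding cis_mult B_def by (simp add: algebra_simps)
    finally show "\<psi> (arm_end S \<epsilon> x e (joints t))
        = N t * (of_real (exp (Re (L (w t))) / (cmod (E t) * cmod (F t))) * cis (\<theta>1 + \<omega>1 * t + B t))" .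
  qed
qed

lemma rationally_independent_ratio:
  fixes \<omega>2 \<omega>3 :: real
  assumes "\<And>b c :: rat. of_rat b * \<omega>2 + of_rat c * \<omega>3 = 0 \<Longrightarrow> b = 0 \<and> c = 0"
  shows "\<omega>3 \<noteq> 0" "\<omega>2 / \<omega>3 \<notin> \<rat>"
proof -
  show \<omega>: "\<omega>3 \<noteq> 0" using assms[of 0 1] by auto
  show "\<omega>2 / \<omega>3 \<notin> \<rat>"
  proof
    assume "\<omega>2 / \<omega>3 \<in> \<rat>"
    then obtain r where "\<omega>2 / \<omega>3 = of_rat r" by (auto elim: Rats_cases)
    then have "of_rat 1 * \<omega>2 + of_rat (- r) * \<omega>3 = 0" using \<omega> by (simp add: of_rat_minus field_simps)
    then show False using assms by fastforce
  qed
qed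

theorem theorem3:
  fixes S :: surface and x\<^sub>0 e\<^sub>0 :: "real^3"
    and \<epsilon> l\<^sub>1 l\<^sub>2 l\<^sub>3 \<omega>\<^sub>1 \<omega>\<^sub>2 \<omega>\<^sub>3 :: real
  assumes orientation: "\<epsilon> = 1 \<or> \<epsilon> = -1"
    and base: "x\<^sub>0 \<in> points S" "e\<^sub>0 \<in> unit_tangent S x\<^sub>0"
    and lengths: "l\<^sub>1 > 0" "l\<^sub>2 > 0" "l\<^sub>3 > 0"
    and triangle: "l\<^sub>1 < l\<^sub>2 + l\<^sub>3" "l\<^sub>2 < l\<^sub>3 + l\<^sub>1" "l\<^sub>3 < l\<^sub>1 + l\<^sub>2"
    and nonneg: "\<omega>\<^sub>1 \<ge> 0" "\<omega>\<^sub>2 \<ge> 0" "\<omega>\<^sub>3 \<ge> 0"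
    and rat_indep: "\<And>a b c :: rat. of_rat a * \<omega>\<^sub>1 + of_rat b * \<omega>\<^sub>2 + of_rat c * \<omega>\<^sub>3 = 0
                      \<Longrightarrow> a = 0 \<and> b = 0 \<and> c = 0"
    and short: "S = Sphere \<Longrightarrow> l\<^sub>1 + l\<^sub>2 + l\<^sub>3 < pi"
  shows "\<exists>\<alpha>\<^sub>1 \<alpha>\<^sub>2 \<alpha>\<^sub>3.
    geodesic_triangle S l\<^sub>1 l\<^sub>2 l\<^sub>3 \<alpha>\<^sub>1 \<alpha>\<^sub>2 \<alpha>\<^sub>3 \<and>
    (\<forall>\<beta>\<^sub>1 \<beta>\<^sub>2 \<beta>\<^sub>3. geodesic_triangle S l\<^sub>1 l\<^sub>2 l\<^sub>3 \<beta>\<^sub>1 \<beta>\<^sub>2 \<beta>\<^sub>3 \<longrightarrow>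
       \<beta>\<^sub>1 = \<alpha>\<^sub>1 \<and> \<beta>\<^sub>2 = \<alpha>\<^sub>2 \<and> \<beta>\<^sub>3 = \<alpha>\<^sub>3) \<and>
    (\<forall>\<theta>\<^sub>1 \<theta>\<^sub>2 \<theta>\<^sub>3 :: real.
       let z = (\<lambda>t. arm_end S \<epsilon> x\<^sub>0 e\<^sub>0
                  [(l\<^sub>1, \<theta>\<^sub>1 + \<omega>\<^sub>1 * t), (l\<^sub>2, \<theta>\<^sub>2 + \<omega>\<^sub>2 * t), (l\<^sub>3, \<theta>\<^sub>3 + \<omega>\<^sub>3 * t)])
       in (\<exists>U \<psi>. lagrange_chart S \<epsilon> x\<^sub>0 z U \<psi>) \<and>
          (\<forall>U \<psi>. lagrange_chart S \<epsilon> x\<^sub>0 z U \<psi> \<longrightarrow>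
             has_asymptotic_angular_velocity (\<lambda>t. \<psi> (z t))
               (\<omega>\<^sub>1 + (pi - \<alpha>\<^sub>1) / pi * \<omega>\<^sub>2 + \<alpha>\<^sub>3 / pi * \<omega>\<^sub>3)))"
proof -
  obtain f where fr: "frame S \<epsilon> x\<^sub>0 e\<^sub>0 f" using frame_exists[OF orientation base] .
  have \<epsilon>: "\<epsilon> \<noteq> 0" using orientation by auto
  have adm: "admissible S (l\<^sub>1 + l\<^sub>2 + l\<^sub>3)" "admissible S l\<^sub>1" "admissible S l\<^sub>2" "admissible S l\<^sub>3" "admissible S
      (l\<^sub>2 + l\<^sub>3)"
    using lengths short by (auto simp: admissible_def)
  have sp: "gsin S l\<^sub>1 \<noteq> 0" "gsin S l\<^sub>2 \<noteq> 0" "gsin S l\<^sub>3 \<noteq> 0"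
    using gsin_pos lengths adm by (metis less_irrefl)+
  define \<alpha>\<^sub>1 where "\<alpha>\<^sub>1 = arccos (cosine_law S l\<^sub>1 l\<^sub>2 l\<^sub>3)"
  define \<alpha>\<^sub>2 where "\<alpha>\<^sub>2 = arccos (cosine_law S l\<^sub>2 l\<^sub>3 l\<^sub>1)"
  define \<alpha>\<^sub>3 where "\<alpha>\<^sub>3 = arccos (cosine_law S l\<^sub>3 l\<^sub>1 l\<^sub>2)"
  define a b c \<kappa> where abc: "a = gtan S l\<^sub>1" "b = gtan S l\<^sub>2" "c = gtan S l\<^sub>3" "\<kappa> = curv S"
  define \<theta> where "\<theta> = pi - \<alpha>\<^sub>1"

  have \<kappa>: "\<kappa> = 1 \<or> \<kappa> = - 1" unfolding abc by (rule curv_cases)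
  have pos: "a > 0" "b > 0" "c > 0"
    using gtan_strict_mono[of 0 _ S] lengths adm unfolding abc by (metis gtan_0 order_refl)+
  have conf: "1 + \<kappa> * a\<^sup>2 > 0" "1 + \<kappa> * b\<^sup>2 > 0" "1 + \<kappa> * c\<^sup>2 > 0"
    using gtan_conformal_pos[of S l\<^sub>1 "of_real a"] gtan_conformal_pos[of S l\<^sub>2 "of_real b"]
      gtan_conformal_pos[of S l\<^sub>3 "of_real c"] adm pos by (auto simp: abc)
  have bc: "b * c < 1" unfolding abc using lengths adm by (intro gtan_add(1)) auto
  have bounds: "- 1 < cosine_law S l\<^sub>1 l\<^sub>2 l\<^sub>3" "cosine_law S l\<^sub>1 l\<^sub>2 l\<^sub>3 < 1"
    using cosine_law_bounds[OF lengths triangle adm(1)] by auto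
  have \<theta>: "0 < \<theta>" "\<theta> < pi"
    using arccos_lt_bounded[OF bounds] by (auto simp: \<theta>_def \<alpha>\<^sub>1_def)
  have cos\<theta>: "cos \<theta> = (a\<^sup>2 * (1 + (b * c)\<^sup>2) - b\<^sup>2 - c\<^sup>2) / (2 * b * c * (1 + \<kappa> * a\<^sup>2))"
  proof -
    have "cos \<theta> = - cosine_law S l\<^sub>1 l\<^sub>2 l\<^sub>3"
      using bounds by (simp add: \<theta>_def \<alpha>\<^sub>1_def cos_arccos)
    also have "\<dots> = - ((b\<^sup>2 + c\<^sup>2 - a\<^sup>2 * (1 + (b * c)\<^sup>2)) / (2 * b * c * (1 + \<kappa> * a\<^sup>2)))"
      unfolding abc using cosine_law_gtan[OF lengths adm(2-4)] by simp
    finally show ?thesis by (simp add: minus_divide_left)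
  qed
  have args: "Arg (of_real b + of_real c * cis \<theta>) - Arg (1 - of_real (\<kappa> * b * c) * cis \<theta>) = \<alpha>\<^sub>3"
    unfolding Arg_quotient_angle[OF \<kappa> pos bc conf \<theta> cos\<theta>] \<alpha>\<^sub>3_def
    using cosine_law_gtan[OF lengths(3,1,2) adm(4,2,3)] by (simp add: abc)
  have ratio: "\<omega>\<^sub>3 \<noteq> 0" "\<omega>\<^sub>2 / \<omega>\<^sub>3 \<notin> \<rat>"
    using rationally_independent_ratio[of \<omega>\<^sub>2 \<omega>\<^sub>3] rat_indep[of 0] by auto
  then have \<omega>\<^sub>3: "\<omega>\<^sub>3 > 0" using nonneg by simp

  have dynamics: "let z = (\<lambda>t. arm_end S \<epsilon> x\<^sub>0 e\<^sub>0
                  [(l\<^sub>1, \<theta>\<^sub>1 + \<omega>\<^sub>1 * t), (l\<^sub>2, \<theta>\<^sub>2 + \<omega>\<^sub>2 * t), (l\<^sub>3, \<theta>\<^sub>3 + \<omega>\<^sub>3 * t)])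
       in (\<exists>U \<psi>. lagrange_chart S \<epsilon> x\<^sub>0 z U \<psi>) \<and>
          (\<forall>U \<psi>. lagrange_chart S \<epsilon> x\<^sub>0 z U \<psi> \<longrightarrow>
             has_asymptotic_angular_velocity (\<lambda>t. \<psi> (z t))
               (\<omega>\<^sub>1 + (pi - \<alpha>\<^sub>1) / pi * \<omega>\<^sub>2 + \<alpha>\<^sub>3 / pi * \<omega>\<^sub>3))" for \<theta>\<^sub>1 \<theta>\<^sub>2 \<theta>\<^sub>3 :: real
    unfolding Let_def
  proof (intro conjI allI impI)
    define joints where "joints = (\<lambda>t. [(l\<^sub>1, \<theta>\<^sub>1 + \<omega>\<^sub>1 * t), (l\<^sub>2, \<theta>\<^sub>2 + \<omega>\<^sub>2 * t), (l\<^sub>3, \<theta>\<^sub>3 + \<omega>\<^sub>3 * t)])"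
    have ball: "arm_end S \<epsilon> x\<^sub>0 e\<^sub>0 (joints t) \<in> closed_ball S x\<^sub>0 (l\<^sub>1 + l\<^sub>2 + l\<^sub>3)" for t
    proof -
      have sum: "(\<Sum>j\<leftarrow>joints t. fst j) = l\<^sub>1 + l\<^sub>2 + l\<^sub>3" and nn: "\<And>j. j \<in> set (joints t) \<Longrightarrow> fst j \<ge> 0"
        using lengths by (auto simp: joints_def)
      have "arm_end S \<epsilon> x\<^sub>0 e\<^sub>0 (joints t) = stereo S x\<^sub>0 e\<^sub>0 f (arm_coord S (joints t))"
        using adm(1) by (intro arm_end_stereo[OF orientation fr nn]) (auto simp: sum)
      moreover have "cmod (arm_coord S (joints t)) \<le> gtan S (l\<^sub>1 + l\<^sub>2 + l\<^sub>3)"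
        using arm_coord_bound[of "joints t" S] adm(1) nn unfolding sum by blast
      ultimately show ?thesis
        unfolding closed_ball_eq_stereo_image[OF fr \<epsilon> adm(1)] by auto
    qed
    show "\<exists>U \<psi>. lagrange_chart S \<epsilon> x\<^sub>0 (\<lambda>t. arm_end S \<epsilon> x\<^sub>0 e\<^sub>0
        [(l\<^sub>1, \<theta>\<^sub>1 + \<omega>\<^sub>1 * t), (l\<^sub>2, \<theta>\<^sub>2 + \<omega>\<^sub>2 * t), (l\<^sub>3, \<theta>\<^sub>3 + \<omega>\<^sub>3 * t)]) U \<psi>"
      using stereo_lagrange_chart[OF fr orientation adm(1), of "\<lambda>t. arm_end S \<epsilon> x\<^sub>0 e\<^sub>0 (joints t)"] ball
      unfolding joints_def by blast
    fix U \<psi>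
    assume "lagrange_chart S \<epsilon> x\<^sub>0 (\<lambda>t. arm_end S \<epsilon> x\<^sub>0 e\<^sub>0
        [(l\<^sub>1, \<theta>\<^sub>1 + \<omega>\<^sub>1 * t), (l\<^sub>2, \<theta>\<^sub>2 + \<omega>\<^sub>2 * t), (l\<^sub>3, \<theta>\<^sub>3 + \<omega>\<^sub>3 * t)]) U \<psi>"
    moreover have "has_asymptotic_angular_velocity
        (\<lambda>t. of_real a * (1 - of_real (\<kappa> * b * c) * cis (\<theta>\<^sub>3 + \<omega>\<^sub>3 * t))
          + cis (\<theta>\<^sub>2 + \<omega>\<^sub>2 * t) * (of_real b + of_real c * cis (\<theta>\<^sub>3 + \<omega>\<^sub>3 * t)))
        (\<omega>\<^sub>2 * \<theta> / pi + \<omega>\<^sub>3 * \<alpha>\<^sub>3 / pi)"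
      using linkage_mean_motion[OF \<kappa> pos bc conf(1) \<theta> cos\<theta> \<omega>\<^sub>3 ratio(2), of \<theta>\<^sub>3 \<theta>\<^sub>2] unfolding args .
    ultimately have "has_asymptotic_angular_velocity (\<lambda>t. \<psi> (arm_end S \<epsilon> x\<^sub>0 e\<^sub>0
        [(l\<^sub>1, \<theta>\<^sub>1 + \<omega>\<^sub>1 * t), (l\<^sub>2, \<theta>\<^sub>2 + \<omega>\<^sub>2 * t), (l\<^sub>3, \<theta>\<^sub>3 + \<omega>\<^sub>3 * t)]))
        (\<omega>\<^sub>1 + (\<omega>\<^sub>2 * \<theta> / pi + \<omega>\<^sub>3 * \<alpha>\<^sub>3 / pi))"
      using lengths adm(1) unfolding abc
      by (intro arm_chart_angular_velocity[OF fr orientation]) auto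
    moreover have "\<omega>\<^sub>1 + (\<omega>\<^sub>2 * \<theta> / pi + \<omega>\<^sub>3 * \<alpha>\<^sub>3 / pi) = \<omega>\<^sub>1 + (pi - \<alpha>\<^sub>1) / pi * \<omega>\<^sub>2 + \<alpha>\<^sub>3 / pi * \<omega>\<^sub>3"
      by (simp add: \<theta>_def mult.commute)
    ultimately show "has_asymptotic_angular_velocity (\<lambda>t. \<psi> (arm_end S \<epsilon> x\<^sub>0 e\<^sub>0
        [(l\<^sub>1, \<theta>\<^sub>1 + \<omega>\<^sub>1 * t), (l\<^sub>2, \<theta>\<^sub>2 + \<omega>\<^sub>2 * t), (l\<^sub>3, \<theta>\<^sub>3 + \<omega>\<^sub>3 * t)]))
        (\<omega>\<^sub>1 + (pi - \<alpha>\<^sub>1) / pi * \<omega>\<^sub>2 + \<alpha>\<^sub>3 / pi * \<omega>\<^sub>3)" by (simp only:)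
  qed
  have "geodesic_triangle S l\<^sub>1 l\<^sub>2 l\<^sub>3 \<alpha>\<^sub>1 \<alpha>\<^sub>2 \<alpha>\<^sub>3"
    unfolding \<alpha>\<^sub>1_def \<alpha>\<^sub>2_def \<alpha>\<^sub>3_def by (rule geodesic_triangle_exists[OF lengths triangle adm(1) fr])
  moreover have "\<forall>\<beta>\<^sub>1 \<beta>\<^sub>2 \<beta>\<^sub>3. geodesic_triangle S l\<^sub>1 l\<^sub>2 l\<^sub>3 \<beta>\<^sub>1 \<beta>\<^sub>2 \<beta>\<^sub>3 \<longrightarrow>
       \<beta>\<^sub>1 = \<alpha>\<^sub>1 \<and> \<beta>\<^sub>2 = \<alpha>\<^sub>2 \<and> \<beta>\<^sub>3 = \<alpha>\<^sub>3"
    unfolding \<alpha>\<^sub>1_def \<alpha>\<^sub>2_def \<alpha>\<^sub>3_def using geodesic_triangle_angles[OF _ sp] by blast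
  ultimately show ?thesis using dynamics by blast
qed

end
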